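(* Let $n\ge2$ and $u\in C_c^2(\mathbb H^n\setminus\{0\})$. Then $$\|\Delta_{\mathbb H}u\|^2=\|\Delta_{\rho,\mathbb H}u\|^2+\|(\Delta_{\mathbb H}-\Delta_{\rho,\mathbb H})u\|^2+2\sum_{j=1}^n\|\partial_\rho(\mathcal L_ju)\|^2-2\sum_{j=1}^n\|\mathcal L_ju\|^2-2\sum_{j=1}^n\Big\|\frac{\mathcal L_ju}{\sinh\rho}\Big\|^2 .$$ Moreover, $$\|\Delta_{\mathbb H}u\|^2\ge\|\Delta_{\rho,\mathbb H}u\|^2+\frac12\sum_{j=1}^n\Big\|\frac{\mathcal L_ju}{\rho}\Big\|^2+\frac{(n+1)(n-3)}{2}\sum_{j=1}^n\|\coth\rho\,\mathcal L_ju\|^2 .$$ Consequently, if $n\ge3$, then $\|\Delta_{\mathbb H}u\|\ge\|\Delta_{\rho,\mathbb H}u\|$ for all $u\in C_c^2(\mathbb H^n\setminus\{0\})$.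
   Context: $\mathbb H^n$ denotes the Poincaré ball model of hyperbolic space: the unit ball $\{x\in\mathbb R^n:|x|<1\}$ with metric $\frac{4|dx|^2}{(1-|x|^2)^2}$. Write $r=|x|$ and $\rho=\ln\frac{1+r}{1-r}$ (hyperbolic distance to the origin), $\partial_\rho=\frac{1-r^2}{2}\partial_r$ where $\partial_r=\sum_i\frac{x_i}{r}\partial_{x_i}$. $\Delta_{\mathbb H}$ is the Laplace–Beltrami operator of $\mathbb H^n$, $\Delta_{\rho,\mathbb H}=\partial_\rho^2+(n-1)\coth\rho\,\partial_\rho$ its radial part, and $\mathcal L_j=\frac{1-r^2}{2}\big(\partial_{x_j}-\frac{x_j}{r}\partial_r\big)$ for $1\le j\le n$. $\|\cdot\|$ is the norm of $L^2(\mathbb H^n)$ with respect to the hyperbolic volume measure. *)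

theory Defs
  imports "HOL-Analysis.Analysis"
begin

text \<open>Poincare ball model of H^n, points are x :: real^'n with norm x < 1,
  n = CARD('n). Functions are real^'n => real; only values on the ball matter.\<close>

definition pd :: "'n::finite \<Rightarrow> (real^'n \<Rightarrow> real) \<Rightarrow> real^'n \<Rightarrow> real" where
  "pd i f x = frechet_derivative f (at x) (axis i 1)"

definition C2_on :: "(real^'n::finite) set \<Rightarrow> (real^'n \<Rightarrow> real) \<Rightarrow> bool" where
  "C2_on S f \<longleftrightarrow> (\<forall>x\<in>S. f differentiable (at x)) \<and>
     (\<forall>i. \<forall>x\<in>S. pd i f differentiable (at x)) \<and>
     (\<forall>i j. continuous_on S (pd j (pd i f)))"

definition Cc2_punct :: "(real^'n::finite \<Rightarrow> real) \<Rightarrow> bool" where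
  "Cc2_punct u \<longleftrightarrow> C2_on (ball 0 1 - {0}) u \<and>
     compact (closure {x. u x \<noteq> 0}) \<and> closure {x. u x \<noteq> 0} \<subseteq> ball 0 1 - {0}"

definition hrho :: "real^'n::finite \<Rightarrow> real" where
  "hrho x = ln ((1 + norm x) / (1 - norm x))"

definition d_r :: "(real^'n::finite \<Rightarrow> real) \<Rightarrow> real^'n \<Rightarrow> real" where
  "d_r f x = (\<Sum>i\<in>UNIV. (x $ i / norm x) * pd i f x)"

definition d_rho :: "(real^'n::finite \<Rightarrow> real) \<Rightarrow> real^'n \<Rightarrow> real" where
  "d_rho f x = (1 - (norm x)\<^sup>2) / 2 * d_r f x"

definition Lj :: "'n::finite \<Rightarrow> (real^'n \<Rightarrow> real) \<Rightarrow> real^'n \<Rightarrow> real" where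
  "Lj j f x = (1 - (norm x)\<^sup>2) / 2 * (pd j f x - x $ j / norm x * d_r f x)"

text \<open>Laplace-Beltrami operator of g = 4|dx|^2/(1-|x|^2)^2 in coordinates:
  (1/sqrt g) sum_i d_i (sqrt g g^ii d_i f), sqrt g = (2/(1-r^2))^n, g^ii = ((1-r^2)/2)^2.\<close>
definition lap_H :: "(real^'n::finite \<Rightarrow> real) \<Rightarrow> real^'n \<Rightarrow> real" where
  "lap_H f x = ((1 - (norm x)\<^sup>2) / 2) ^ CARD('n) *
     (\<Sum>i\<in>UNIV. pd i (\<lambda>y. (2 / (1 - (norm y)\<^sup>2)) ^ CARD('n) * ((1 - (norm y)\<^sup>2) / 2)\<^sup>2 * pd i f y) x)"

definition lap_rho :: "(real^'n::finite \<Rightarrow> real) \<Rightarrow> real^'n \<Rightarrow> real" where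
  "lap_rho f x = d_rho (d_rho f) x
      + (real CARD('n) - 1) * (cosh (hrho x) / sinh (hrho x)) * d_rho f x"

text \<open>L^2(H^n) norm with respect to the hyperbolic volume (2/(1-|x|^2))^n dx.\<close>
definition hnorm :: "(real^'n::finite \<Rightarrow> real) \<Rightarrow> real" where
  "hnorm f = sqrt (LINT x : ball 0 1 | lborel. (f x)\<^sup>2 * (2 / (1 - (norm x)\<^sup>2)) ^ CARD('n))"

end

theory Submission
  imports Defs
begin

text \<open>
  Let \<open>w\<close> be the tangential part of the Euclidean gradient of \<open>u\<close> and \<open>ur\<close> its radial derivative. Then
  \<open>Lj j u\<close> is \<open>w j\<close> times the conformal factor \<open>kap\<close>, and \<open>lap_H u - lap_rho u\<close> is
  \<open>kap\<^sup>2 * div w\<close>. The cross term in the square of the norm of \<open>lap_H u\<close> contains the second radial derivative of \<open>u\<close>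
  times \<open>div w\<close>; exchanging one radial with one tangential derivative turns it into
  the sum of the squares of \<open>d_rho (Lj j u)\<close> minus those of \<open>coth \<rho> * Lj j u\<close>, which is the identity.

  The inequality combines a Hardy inequality for each \<open>Lj j u\<close>, obtained by completing the square
  with \<open>1 / (2 * \<rho>) - (n - 1) / 2 * coth \<rho>\<close>, with the spectral gap \<open>n - 1\<close> of the
  unit sphere applied to \<open>div w\<close>. For \<open>n \<ge> 3\<close> the gap is Bochner's formula together with
  the bound of the Hilbert-Schmidt norm of the spherical Hessian by its trace; for \<open>n = 2\<close> it is Wirtinger's
  inequality on circles, averaged over rotations.

  All integrations by parts take place in Euclidean space. Since \<open>u\<close> is only C2, derivatives are
  exchanged in the weak form of the lemma \<open>integral_pd_swap\<close>.
\<close>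

section \<open>Partial derivatives\<close>

text \<open>The constants of the inequality come from the following balance. Doubled, as it enters
  the identity, the Hardy inequality for the \<open>Lj j u\<close> yields the coefficient 1/2 for
  the square of \<open>1 / \<rho>\<close>, (n - 1)^2 / 2 for the square of
  \<open>coth \<rho>\<close>, and the loss n - 1 for the square of \<open>1 / sinh \<rho>\<close>.
  The gap n - 1 on the spheres lets the norm of \<open>lap_H u - lap_rho u\<close> cover exactly
  this loss. The two negative sums of the identity combine, by coth^2 = 1 + 1 / sinh^2, into -2
  times the coth term, and (n - 1)^2 / 2 - 2 = (n + 1) * (n - 3) / 2.

  The plane is a case of its own because Bochner's formula compares the two sides of the gap only
  after multiplication by n - 2.

  The support of \<open>u\<close> is a compact subset of the punctured ball. Weights that are
  singular at the origin or on the boundary sphere are C1 near it, and their products with functions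
  supported there are C1 on the whole space, so no boundary terms arise.\<close>

definition C1_on :: "(real^'n::finite) set \<Rightarrow> (real^'n \<Rightarrow> real) \<Rightarrow> bool" where
  "C1_on S f \<longleftrightarrow> (\<forall>x\<in>S. f differentiable (at x)) \<and> (\<forall>i. continuous_on S (pd i f))"

lemma pd_eq:
  assumes "(f has_derivative f') (at x)"
  shows "pd i f x = f' (axis i 1)"
  using frechet_derivative_at[OF assms] by (simp add: pd_def)

lemma has_derivative_pd:
  assumes "f differentiable (at x)"
  shows "(f has_derivative (\<lambda>h. \<Sum>i\<in>UNIV. h $ i * pd i f x)) (at x)"
proof -
  let ?D = "frechet_derivative f (at x)"
  have D: "(f has_derivative ?D) (at x)"
    using assms frechet_derivative_works by blast
  then have lin: "linear ?D" by (rule has_derivative_linear)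
  have "?D h = (\<Sum>i\<in>UNIV. h $ i * pd i f x)" for h
  proof -
    have "?D h = ?D (\<Sum>i\<in>UNIV. (h $ i) *\<^sub>R axis i 1)"
      by (simp add: basis_expansion scalar_mult_eq_scaleR [symmetric])
    also have "\<dots> = (\<Sum>i\<in>UNIV. h $ i * pd i f x)"
      by (simp add: linear_sum[OF lin] linear_scale[OF lin] pd_def)
    finally show ?thesis .
  qed
  then have "?D = (\<lambda>h. \<Sum>i\<in>UNIV. h $ i * pd i f x)" by auto
  with D show ?thesis by simp
qed

lemma pd_const [simp]: "pd i (\<lambda>x. c) x = 0"
  by (subst pd_eq[OF has_derivative_const]) simp

lemma pd_add:
  assumes "f differentiable (at x)" "g differentiable (at x)"
  shows "pd i (\<lambda>x. f x + g x) x = pd i f x + pd i g x"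
  using assms unfolding frechet_derivative_works
  by (subst pd_eq[OF has_derivative_add]) (auto simp: pd_def)

lemma pd_diff:
  assumes "f differentiable (at x)" "g differentiable (at x)"
  shows "pd i (\<lambda>x. f x - g x) x = pd i f x - pd i g x"
  using assms unfolding frechet_derivative_works
  by (subst pd_eq[OF has_derivative_diff]) (auto simp: pd_def)

lemma pd_mult:
  assumes "f differentiable (at x)" "g differentiable (at x)"
  shows "pd i (\<lambda>x. f x * g x) x = f x * pd i g x + pd i f x * g x"
  using assms unfolding frechet_derivative_works
  by (subst pd_eq[OF has_derivative_mult]) (auto simp: pd_def)

lemma pd_sum:
  assumes "finite I" "\<And>k. k \<in> I \<Longrightarrow> f k differentiable (at x)"
  shows "pd i (\<lambda>x. \<Sum>k\<in>I. f k x) x = (\<Sum>k\<in>I. pd i (f k) x)"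
  using assms unfolding frechet_derivative_works
  by (subst pd_eq[OF has_derivative_sum]) (auto simp: pd_def)

lemma pd_coord: "pd i (\<lambda>x::real^'n. x $ j) x = (if i = j then 1 else 0)"
proof -
  have "((\<lambda>x::real^'n. x $ j) has_derivative (\<lambda>h. h $ j)) (at x)"
    by (rule bounded_linear.has_derivative[OF bounded_linear_vec_nth has_derivative_ident])
  from pd_eq[OF this, of i] show ?thesis by (auto simp: axis_def)
qed

lemma differentiable_coord: "(\<lambda>x::real^'n. x $ j) differentiable (at x)"
  using bounded_linear.has_derivative[OF bounded_linear_vec_nth has_derivative_ident]
  by (rule differentiableI)

lemma has_derivative_radial:
  fixes x :: "real^'n"
  assumes "x \<noteq> 0" "(g has_real_derivative g') (at (norm x))"
  shows "((\<lambda>x. g (norm x)) has_derivative (\<lambda>h. g' * (inner h (sgn x)))) (at x)"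
proof -
  have "((\<lambda>x. g (norm x)) has_derivative (\<lambda>h. (*) g' (inner h (sgn x)))) (at x)"
    using has_derivative_compose[OF has_derivative_norm[OF assms(1)], of g "(*) g'"] assms(2)
    by (simp add: has_field_derivative_def)
  then show ?thesis .
qed

lemma pd_radial:
  fixes x :: "real^'n"
  assumes "x \<noteq> 0" "(g has_real_derivative g') (at (norm x))"
  shows "pd i (\<lambda>x. g (norm x)) x = g' * (x $ i / norm x)"
  by (subst pd_eq[OF has_derivative_radial[OF assms]])
     (simp add: sgn_div_norm inner_axis' field_simps)

lemma differentiable_radial:
  fixes x :: "real^'n"
  assumes "x \<noteq> 0" "(g has_real_derivative g') (at (norm x))"
  shows "(\<lambda>x. g (norm x)) differentiable (at x)"
  using has_derivative_radial[OF assms] by (rule differentiableI)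

text \<open>\<open>frechet_derivative\<close> chooses among the derivatives of a function, and
  functions that agree near \<open>x\<close> have the same ones. Hence the equality holds also where
  neither function is differentiable.\<close>

lemma pd_cong_open:
  assumes "open S" "x \<in> S" "\<And>y. y \<in> S \<Longrightarrow> f y = g y"
  shows "pd i f x = pd i g x"
proof -
  have *: "(f has_derivative D) (at x) \<longleftrightarrow> (g has_derivative D) (at x)" for D
    using assms has_derivative_transform_within_open[of f D x UNIV S g]
          has_derivative_transform_within_open[of g D x UNIV S f] by auto
  then show ?thesis by (simp add: pd_def frechet_derivative_def)
qed

lemma differentiable_cong_open:
  assumes "open S" "x \<in> S" "\<And>y. y \<in> S \<Longrightarrow> f y = g y" "g differentiable (at x)"
  shows "f differentiable (at x)"
  using assms has_derivative_transform_within_open[of g _ x UNIV S f]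
  unfolding differentiable_def by metis

lemma C1_on_D:
  assumes "C1_on S f"
  shows "x \<in> S \<Longrightarrow> f differentiable (at x)" "continuous_on S (pd i f)"
  using assms by (auto simp: C1_on_def)

lemma C1_on_continuous: "C1_on S f \<Longrightarrow> continuous_on S f"
  by (auto simp: C1_on_def continuous_at_imp_continuous_on differentiable_imp_continuous_within)

lemma C1_on_const: "C1_on S (\<lambda>x. c)"
  by (simp add: C1_on_def)

lemma C1_on_coord: "C1_on S (\<lambda>x. x $ j)"
  by (simp add: C1_on_def differentiable_coord pd_coord)

lemma C1_on_add:
  assumes "C1_on S f" "C1_on S g" shows "C1_on S (\<lambda>x. f x + g x)"
  using assms unfolding C1_on_def
  by (auto simp: pd_add cong: continuous_on_cong intro!: continuous_intros)

lemma C1_on_diff: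
  assumes "C1_on S f" "C1_on S g" shows "C1_on S (\<lambda>x. f x - g x)"
  using assms unfolding C1_on_def
  by (auto simp: pd_diff cong: continuous_on_cong intro!: continuous_intros)

lemma C1_on_mult:
  assumes "C1_on S f" "C1_on S g" shows "C1_on S (\<lambda>x. f x * g x)"
  using assms C1_on_continuous[OF assms(1)] C1_on_continuous[OF assms(2)] unfolding C1_on_def
  by (auto simp: pd_mult cong: continuous_on_cong intro!: continuous_intros)

lemma C1_on_sum:
  assumes "finite I" "\<And>k. k \<in> I \<Longrightarrow> C1_on S (f k)"
  shows "C1_on S (\<lambda>x. \<Sum>k\<in>I. f k x)"
  using assms by (induction I) (auto intro: C1_on_const C1_on_add)

lemma C1_on_radial:
  assumes "\<And>x. x \<in> S \<Longrightarrow> x \<noteq> 0"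
    and "\<And>x. x \<in> S \<Longrightarrow> (g has_real_derivative g' (norm x)) (at (norm x))"
    and "continuous_on (norm ` S) g'"
  shows "C1_on S (\<lambda>x. g (norm x))"
proof -
  have "continuous_on S (\<lambda>x. g' (norm x) * (x $ i / norm x))" for i
    using assms(1) by (intro continuous_intros continuous_on_compose2[OF assms(3)]) auto
  moreover have "pd i (\<lambda>x. g (norm x)) x = g' (norm x) * (x $ i / norm x)" if "x \<in> S" for x i
    using assms(1,2) that by (intro pd_radial) auto
  moreover have "(\<lambda>x. g (norm x)) differentiable (at x)" if "x \<in> S" for x
    by (rule differentiable_radial[OF assms(1,2)]) (use that in auto)
  ultimately show ?thesis unfolding C1_on_def by (auto cong: continuous_on_cong)
qed

section \<open>Integration by parts for C1 functions\<close>

lemma integrable_continuous_compact: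
  fixes f :: "'a::euclidean_space \<Rightarrow> real"
  assumes "compact K" "continuous_on K f" "\<And>x. x \<notin> K \<Longrightarrow> f x = 0"
  shows "integrable lborel f"
proof -
  have "f = (\<lambda>x. indicator K x *\<^sub>R f x)"
    using assms(3) by (intro ext) (auto simp: indicator_def)
  then show ?thesis using borel_integrable_compact[OF assms(1,2)] by simp
qed

lemma lborel_integral_translate:
  fixes f :: "'a::euclidean_space \<Rightarrow> real"
  assumes "f \<in> borel_measurable borel"
  shows "(\<integral>x. f (x + c) \<partial>lborel) = (\<integral>x. f x \<partial>lborel)"
proof -
  have "(\<integral>x. f x \<partial>lborel) = (\<integral>x. f x \<partial>distr lborel borel ((+) c))"
    by (simp add: lborel_distr_plus)
  also have "\<dots> = (\<integral>x. f (c + x) \<partial>lborel)"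
    using assms by (intro integral_distr) auto
  finally show ?thesis by (simp add: add.commute)
qed

lemma has_real_derivative_pd:
  fixes f :: "real^'n \<Rightarrow> real"
  assumes "f differentiable (at (x + t *\<^sub>R axis i 1))"
  shows "((\<lambda>t. f (x + t *\<^sub>R axis i 1)) has_real_derivative pd i f (x + t *\<^sub>R axis i 1)) (at t)"
proof -
  let ?y = "x + t *\<^sub>R axis i 1"
  have "((\<lambda>t. x + t *\<^sub>R axis i 1) has_derivative (\<lambda>s. s *\<^sub>R axis i (1::real))) (at t)"
    by (auto intro!: derivative_eq_intros)
  from has_derivative_compose[OF this has_derivative_pd[OF assms]]
  have "((\<lambda>t. f (x + t *\<^sub>R axis i 1)) has_derivative (\<lambda>s. \<Sum>k\<in>UNIV. (s *\<^sub>R axis i 1) $ k * pd k f ?y)) (at t)" .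
  moreover have "(\<Sum>k\<in>UNIV. (s *\<^sub>R axis i 1) $ k * pd k f ?y) = pd i f ?y * s" for s
    by (simp add: axis_def if_distrib[of "\<lambda>a. _ * a"] if_distrib[of "\<lambda>a. a * _"] cong: if_cong)
  ultimately show ?thesis by (simp add: has_field_derivative_def)
qed

lemma pd_mean_value:
  fixes f :: "real^'n \<Rightarrow> real"
  assumes "\<And>y. f differentiable (at y)" "t \<noteq> 0"
  obtains s where "\<bar>s\<bar> < \<bar>t\<bar>" "t > 0 \<Longrightarrow> s > 0"
    "f (x + t *\<^sub>R axis i 1) - f x = t * pd i f (x + s *\<^sub>R axis i 1)"
proof (cases "t > 0")
  case True
  from MVT2[OF this, of "\<lambda>t. f (x + t *\<^sub>R axis i 1)" "\<lambda>t. pd i f (x + t *\<^sub>R axis i 1)"]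
  obtain s where "0 < s" "s < t" "f (x + t *\<^sub>R axis i 1) - f x = t * pd i f (x + s *\<^sub>R axis i 1)"
    using has_real_derivative_pd[OF assms(1)] by auto
  then show ?thesis using that[of s] True by auto
next
  case False
  with assms(2) have "t < 0" by simp
  from MVT2[OF this, of "\<lambda>t. f (x + t *\<^sub>R axis i 1)" "\<lambda>t. pd i f (x + t *\<^sub>R axis i 1)"]
  obtain s where "t < s" "s < 0" "f x - f (x + t *\<^sub>R axis i 1) = (0 - t) * pd i f (x + s *\<^sub>R axis i 1)"
    using has_real_derivative_pd[OF assms(1)] by auto
  then show ?thesis using that[of s] False by (auto simp: algebra_simps)
qed

lemma pd_zero_outside:
  assumes "closed K" "\<And>x. x \<notin> K \<Longrightarrow> f x = 0" "x \<notin> K"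
  shows "pd i f x = 0"
  using pd_cong_open[of "- K" x f "\<lambda>_. 0"] assms by auto

text \<open>Dominated convergence: the mean value theorem bounds every quotient by the maximum of
  \<open>pd i f\<close>, and steps of length at most 1 keep all supports in one ball. The sign
  \<open>s\<close> admits forward and backward quotients; \<open>integral_pd_swap\<close> uses one
  of each.\<close>

lemma difference_quotient_tendsto:
  fixes f h :: "real^'n \<Rightarrow> real"
  assumes f: "C1_on UNIV f" and K: "compact K" "\<And>x. x \<notin> K \<Longrightarrow> f x = 0"
    and h: "continuous_on UNIV h" and s: "\<bar>s\<bar> = 1"
  shows "(\<lambda>m. \<integral>x. (f (x + (s / Suc m) *\<^sub>R axis i 1) - f x) / (s / Suc m) * h x \<partial>lborel)
           \<longlonglongrightarrow> (\<integral>x. pd i f x * h x \<partial>lborel)"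
proof -
  define t where "t m = s / Suc m" for m
  have t0: "t m \<noteq> 0" "\<bar>t m\<bar> \<le> 1" for m using s by (auto simp: t_def)
  have t_lim: "t \<longlonglongrightarrow> 0"
    unfolding t_def using LIMSEQ_inverse_real_of_nat[THEN tendsto_mult_left, of s]
    by (simp add: divide_inverse)
  obtain R where R: "K \<subseteq> cball 0 R"
    using compact_imp_bounded[OF K(1)] bounded_iff[of K] by (metis mem_cball_0 subsetI)
  let ?B = "cball (0::real^'n) (R + 1)"
  have diff: "f differentiable (at x)" for x using C1_on_D(1)[OF f] by simp
  have pc: "continuous_on UNIV (pd i f)" using C1_on_D(2)[OF f] .
  have fc: "continuous_on UNIV f" by (rule C1_on_continuous[OF f])
  have pz: "pd i f x = 0" if "x \<notin> K" for x
    using pd_zero_outside[OF compact_imp_closed[OF K(1)] K(2) that] .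
  have "compact (pd i f ` K)"
    using K(1) pc by (intro compact_continuous_image) (auto intro: continuous_on_subset)
  from compact_imp_bounded[OF this] obtain B where B: "\<And>x. x \<in> K \<Longrightarrow> \<bar>pd i f x\<bar> \<le> B"
    by (auto simp: bounded_iff)
  have B': "\<bar>pd i f x\<bar> \<le> max B 0" for x using B[of x] pz[of x] by (cases "x \<in> K") auto
  have "compact (h ` ?B)"
    using h by (intro compact_continuous_image) (auto intro: continuous_on_subset)
  from compact_imp_bounded[OF this] obtain C where C: "\<And>x. x \<in> ?B \<Longrightarrow> \<bar>h x\<bar> \<le> C"
    unfolding bounded_iff by (metis imageI real_norm_def)
  show ?thesis unfolding t_def[symmetric]
  proof (rule integral_dominated_convergence[where w="\<lambda>x. indicator ?B x *\<^sub>R (max B 0 * C)"])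
    show "(\<lambda>x. pd i f x * h x) \<in> borel_measurable lborel"
      using pc h by (auto intro!: borel_measurable_continuous_onI continuous_intros)
    show "(\<lambda>x. (f (x + t m *\<^sub>R axis i 1) - f x) / t m * h x) \<in> borel_measurable lborel" for m
      using t0(1)[of m] by (auto intro!: borel_measurable_continuous_onI continuous_intros
           continuous_on_compose2[OF fc] h)
    show "integrable lborel (\<lambda>x. indicator ?B x *\<^sub>R (max B 0 * C))"
      by (intro borel_integrable_compact) auto
    show "AE x in lborel. (\<lambda>m. (f (x + t m *\<^sub>R axis i 1) - f x) / t m * h x) \<longlonglongrightarrow> pd i f x * h x"
    proof (intro AE_I2 tendsto_mult_right)
      fix x
      have "((\<lambda>t. f (x + t *\<^sub>R axis i 1)) has_real_derivative pd i f x) (at 0)"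
        using has_real_derivative_pd[of f x 0 i] diff by simp
      then have "((\<lambda>t. (f (x + t *\<^sub>R axis i 1) - f x) / t) \<longlongrightarrow> pd i f x) (at 0)"
        by (simp add: DERIV_def)
      then show "(\<lambda>m. (f (x + t m *\<^sub>R axis i 1) - f x) / t m) \<longlonglongrightarrow> pd i f x"
        by (rule filterlim_compose) (use t_lim t0 in \<open>auto simp: filterlim_at\<close>)
    qed
    show "AE x in lborel. norm ((f (x + t m *\<^sub>R axis i 1) - f x) / t m * h x)
            \<le> indicator ?B x *\<^sub>R (max B 0 * C)" for m
    proof (intro AE_I2)
      fix x
      show "norm ((f (x + t m *\<^sub>R axis i 1) - f x) / t m * h x) \<le> indicator ?B x *\<^sub>R (max B 0 * C)"
      proof (cases "x \<in> ?B")
        case True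
        obtain r where "f (x + t m *\<^sub>R axis i 1) - f x = t m * pd i f (x + r *\<^sub>R axis i 1)"
          using pd_mean_value[OF diff t0(1)[of m]] by blast
        then have "(f (x + t m *\<^sub>R axis i 1) - f x) / t m = pd i f (x + r *\<^sub>R axis i 1)"
          using t0(1)[of m] by simp
        then have "norm ((f (x + t m *\<^sub>R axis i 1) - f x) / t m * h x)
            = \<bar>pd i f (x + r *\<^sub>R axis i 1)\<bar> * \<bar>h x\<bar>" by (simp add: abs_mult)
        also have "\<dots> \<le> max B 0 * C"
          by (intro mult_mono B' C True) auto
        finally show ?thesis using True by simp
      next
        case False
        have "norm x \<le> norm (x + t m *\<^sub>R axis i 1) + norm (t m *\<^sub>R axis i (1::real))"
          using norm_triangle_ineq4[of "x + t m *\<^sub>R axis i 1" "t m *\<^sub>R axis i 1"] by simp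
        also have "norm (t m *\<^sub>R axis i (1::real)) \<le> 1" using t0 by simp
        finally have "x + t m *\<^sub>R axis i 1 \<notin> K" "x \<notin> K" using False R by (auto simp: subset_iff)
        then show ?thesis using False K(2) by simp
      qed
    qed
  qed
qed

lemma integrable_mult_translate:
  fixes f h :: "real^'n \<Rightarrow> real"
  assumes "continuous_on UNIV f" "continuous_on UNIV h" "compact K" "\<And>x. x \<notin> K \<Longrightarrow> f x = 0"
  shows "integrable lborel (\<lambda>x. f (x + c) * h x)"
proof (rule integrable_continuous_compact)
  show "compact ((\<lambda>x. x - c) ` K)"
    using assms(3) by (intro compact_continuous_image continuous_intros) auto
  show "continuous_on ((\<lambda>x. x - c) ` K) (\<lambda>x. f (x + c) * h x)"
    by (intro continuous_intros continuous_on_compose2[OF assms(1)] continuous_on_subset[OF assms(2)]) auto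
  fix x assume "x \<notin> (\<lambda>x. x - c) ` K"
  then have "x + c \<notin> K" by (metis add_diff_cancel_right' imageI)
  then show "f (x + c) * h x = 0" using assms(4) by simp
qed

text \<open>By translation invariance every difference quotient has integral 0, and the derivative
  is their limit. This takes the place of iterated integration along the coordinate
  \<open>i\<close>.\<close>

lemma integral_pd_eq_0:
  fixes f :: "real^'n \<Rightarrow> real"
  assumes f: "C1_on UNIV f" and K: "compact K" "\<And>x. x \<notin> K \<Longrightarrow> f x = 0"
  shows "(\<integral>x. pd i f x \<partial>lborel) = 0"
proof -
  have fc: "continuous_on UNIV f" by (rule C1_on_continuous[OF f])
  have int: "integrable lborel (\<lambda>x. f (x + c))" for c
    using integrable_mult_translate[OF fc _ K, of "\<lambda>_. 1" c] by simp
  have "(\<integral>x. (f (x + c) - f x) / t * 1 \<partial>lborel) = 0" for c t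
  proof -
    have "(\<integral>x. (f (x + c) - f x) \<partial>lborel) = 0"
      using int[of c] int[of 0] lborel_integral_translate[of f c] fc
      by (simp add: borel_measurable_continuous_onI)
    then show ?thesis by simp
  qed
  with difference_quotient_tendsto[OF f K, of "\<lambda>_. 1" 1 i]
  have "(\<lambda>m. 0) \<longlonglongrightarrow> (\<integral>x. pd i f x * 1 \<partial>lborel)"
    by (simp only:) simp
  from LIMSEQ_unique[OF tendsto_const this] show ?thesis by simp
qed

lemma C1_on_translate:
  assumes "C1_on UNIV f"
  shows "C1_on UNIV (\<lambda>x. f (x + c))" "pd i (\<lambda>x. f (x + c)) x = pd i f (x + c)"
proof -
  have d: "f differentiable (at x)" for x using assms by (simp add: C1_on_def)
  have *: "((\<lambda>x. f (x + c)) has_derivative (\<lambda>h. \<Sum>i\<in>UNIV. h $ i * pd i f (x + c))) (at x)" for x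
    using has_derivative_compose[OF _ has_derivative_pd[OF d], of "\<lambda>x. x + c" "\<lambda>h. h" x UNIV]
    by (simp add: has_derivative_add_const)
  have p: "pd i (\<lambda>x. f (x + c)) x = pd i f (x + c)" for i x
    by (subst pd_eq[OF *]) (simp add: axis_def if_distrib[of "\<lambda>a. a * _"] cong: if_cong)
  then show "pd i (\<lambda>x. f (x + c)) x = pd i f (x + c)" by blast
  have "continuous_on UNIV (\<lambda>x. pd i f (x + c))" for i
    by (intro continuous_on_compose2[OF C1_on_D(2)[OF assms]] continuous_intros) auto
  then show "C1_on UNIV (\<lambda>x. f (x + c))"
    unfolding C1_on_def p using * by (auto intro: differentiableI)
qed

text \<open>For smooth functions this is two integrations by parts. For functions that are only C1 the
  derivative along \<open>i\<close> is replaced by a difference quotient, which is moved from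
  one factor to the other by translation invariance.\<close>

lemma integral_pd_swap:
  fixes f g :: "real^'n \<Rightarrow> real"
  assumes f: "C1_on UNIV f" and g: "C1_on UNIV g"
    and K: "compact K" "\<And>x. x \<notin> K \<Longrightarrow> f x = 0" "\<And>x. x \<notin> K \<Longrightarrow> g x = 0"
  shows "(\<integral>x. pd i f x * pd j g x \<partial>lborel) = (\<integral>x. pd j f x * pd i g x \<partial>lborel)"
proof -
  have fc: "continuous_on UNIV f" and gc: "continuous_on UNIV g"
    by (rule C1_on_continuous[OF f], rule C1_on_continuous[OF g])
  have pfc: "continuous_on UNIV (pd k f)" and pgc: "continuous_on UNIV (pd k g)" for k
    using f g by (auto simp: C1_on_def)
  have pf0: "pd k f x = 0" if "x \<notin> K" for k x
    using pd_zero_outside[OF compact_imp_closed[OF K(1)] K(2) that] .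
  have pg0: "pd k g x = 0" if "x \<notin> K" for k x
    using pd_zero_outside[OF compact_imp_closed[OF K(1)] K(3) that] .
  \<comment> \<open>The increment \<open>f (x + c) - f x\<close> is again C1, so its product with
    \<open>g\<close> may be differentiated along \<open>j\<close> and integrated to 0. Translating
    by \<open>c\<close> in the term with \<open>pd j f (x + c)\<close> then moves the increment to
    \<open>g\<close>.\<close>
  have step: "(\<integral>x. (f (x + c) - f x) * pd j g x \<partial>lborel) = - (\<integral>x. pd j f x * (g (x - c) - g x) \<partial>lborel)" for c
  proof -
    have P: "C1_on UNIV (\<lambda>x. (f (x + c) - f x) * g x)"
      by (intro C1_on_mult C1_on_diff C1_on_translate(1) f g)
    have D: "(\<lambda>x. f (x + c)) differentiable at x" "f differentiable at x" "g differentiable at x" for x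
      using f g C1_on_translate(1)[OF f] by (auto simp: C1_on_def)
    have "0 = (\<integral>x. pd j (\<lambda>x. (f (x + c) - f x) * g x) x \<partial>lborel)"
      using integral_pd_eq_0[OF P K(1)] K(3) by simp
    also have "\<dots> = (\<integral>x. (f (x + c) - f x) * pd j g x + (pd j f (x + c) * g x - pd j f x * g x) \<partial>lborel)"
      by (simp add: pd_mult pd_diff D C1_on_translate[OF f] algebra_simps)
    also have "\<dots> = (\<integral>x. (f (x + c) - f x) * pd j g x \<partial>lborel) + ((\<integral>x. pd j f (x + c) * g x \<partial>lborel) - (\<integral>x. pd j f x * g x \<partial>lborel))"
    proof (subst Bochner_Integration.integral_add)
      show "integrable lborel (\<lambda>x. (f (x + c) - f x) * pd j g x)"
        unfolding left_diff_distrib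
        by (intro Bochner_Integration.integrable_diff integrable_mult_translate[OF fc pgc K(1,2)]
              integrable_mult_translate[OF fc pgc K(1,2), of 0, simplified])
      have i: "integrable lborel (\<lambda>x. pd j f (x + c) * g x)" "integrable lborel (\<lambda>x. pd j f x * g x)"
        using integrable_mult_translate[OF pfc gc K(1) pf0] integrable_mult_translate[OF pfc gc K(1) pf0, of j 0]
        by auto
      then show "integrable lborel (\<lambda>x. pd j f (x + c) * g x - pd j f x * g x)" by simp
      show "(\<integral>x. (f (x + c) - f x) * pd j g x \<partial>lborel) + (\<integral>x. pd j f (x + c) * g x - pd j f x * g x \<partial>lborel)
        = (\<integral>x. (f (x + c) - f x) * pd j g x \<partial>lborel) + ((\<integral>x. pd j f (x + c) * g x \<partial>lborel) - (\<integral>x. pd j f x * g x \<partial>lborel))"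
        using i by simp
    qed
    also have "(\<integral>x. pd j f (x + c) * g x \<partial>lborel) = (\<integral>x. pd j f x * g (x - c) \<partial>lborel)"
    proof -
      have "(\<lambda>x. pd j f (x + c) * g x) \<in> borel_measurable borel"
        by (intro borel_measurable_continuous_onI continuous_intros continuous_on_compose2[OF pfc] gc) auto
      from lborel_integral_translate[OF this, of "-c"] show ?thesis by simp
    qed
    also have "(\<integral>x. pd j f x * g (x - c) \<partial>lborel) - (\<integral>x. pd j f x * g x \<partial>lborel) =
      (\<integral>x. pd j f x * (g (x - c) - g x) \<partial>lborel)"
    proof -
      have "integrable lborel (\<lambda>x. pd j f x * g (x - c))"
        using integrable_mult_translate[OF gc pfc K(1,3), of "-c"] by (simp add: mult.commute)
      moreover have "integrable lborel (\<lambda>x. pd j f x * g x)"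
        using integrable_mult_translate[OF gc pfc K(1,3), of 0] by (simp add: mult.commute)
      ultimately show ?thesis by (simp add: right_diff_distrib)
    qed
    finally show ?thesis by simp
  qed
  have "(\<lambda>m. \<integral>x. (f (x + (1 / Suc m) *\<^sub>R axis i 1) - f x) / (1 / Suc m) * pd j g x \<partial>lborel)
           \<longlonglongrightarrow> (\<integral>x. pd i f x * pd j g x \<partial>lborel)"
    by (rule difference_quotient_tendsto[OF f K(1,2) pgc]) auto
  \<comment> \<open>The sign from the integration by parts is absorbed by the step: a forward
    quotient of \<open>f\<close> becomes a backward quotient of \<open>g\<close>.\<close>
  moreover have "(\<integral>x. (f (x + (1 / Suc m) *\<^sub>R axis i 1) - f x) / (1 / Suc m) * pd j g x \<partial>lborel)
      = (\<integral>x. (g (x + (-1 / Suc m) *\<^sub>R axis i 1) - g x) / (-1 / Suc m) * pd j f x \<partial>lborel)" for m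
  proof -
    have "(\<integral>x. (f (x + (1 / Suc m) *\<^sub>R axis i 1) - f x) / (1 / Suc m) * pd j g x \<partial>lborel)
      = (\<integral>x. Suc m * ((f (x + (1 / Suc m) *\<^sub>R axis i 1) - f x) * pd j g x) \<partial>lborel)"
      by (simp add: field_simps)
    also have "\<dots> = Suc m * - (\<integral>x. pd j f x * (g (x - (1 / Suc m) *\<^sub>R axis i 1) - g x) \<partial>lborel)"
      by (simp only: integral_mult_right_zero step)
    also have "\<dots> = (\<integral>x. Suc m * - (pd j f x * (g (x - (1 / Suc m) *\<^sub>R axis i 1) - g x)) \<partial>lborel)"
      by (simp only: integral_mult_right_zero integral_minus)
    also have "\<dots> = (\<integral>x. (g (x + (-1 / Suc m) *\<^sub>R axis i 1) - g x) / (-1 / Suc m) * pd j f x \<partial>lborel)"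
      by (simp add: field_simps)
    finally show ?thesis .
  qed
  ultimately have "(\<lambda>m. \<integral>x. (g (x + (-1 / Suc m) *\<^sub>R axis i 1) - g x) / (-1 / Suc m) * pd j f x \<partial>lborel)
           \<longlonglongrightarrow> (\<integral>x. pd i f x * pd j g x \<partial>lborel)" by simp
  moreover have "(\<lambda>m. \<integral>x. (g (x + (-1 / Suc m) *\<^sub>R axis i 1) - g x) / (-1 / Suc m) * pd j f x \<partial>lborel)
           \<longlonglongrightarrow> (\<integral>x. pd i g x * pd j f x \<partial>lborel)"
    by (rule difference_quotient_tendsto[OF g K(1,3) pfc]) auto
  ultimately have "(\<integral>x. pd i f x * pd j g x \<partial>lborel) = (\<integral>x. pd i g x * pd j f x \<partial>lborel)"
    by (rule LIMSEQ_unique)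
  then show ?thesis by (simp only: mult.commute)
qed

section \<open>Symmetry of the mixed second derivatives\<close>

lemma second_difference_mean_value:
  fixes u :: "real^'n \<Rightarrow> real"
  assumes "\<And>x. u differentiable (at x)" "\<And>x. pd i u differentiable (at x)" "t > 0"
  obtains a b where "\<bar>a\<bar> < t" "\<bar>b\<bar> < t"
    "u (x + t *\<^sub>R axis i 1 + t *\<^sub>R axis j 1) - u (x + t *\<^sub>R axis i 1) - u (x + t *\<^sub>R axis j 1) + u x
      = t * t * pd j (pd i u) (x + a *\<^sub>R axis i 1 + b *\<^sub>R axis j 1)"
proof -
  let ?F = "\<lambda>y. u (y + t *\<^sub>R axis j 1) - u y"
  have tr: "(\<lambda>y. u (y + c)) differentiable (at y)" "pd i (\<lambda>y. u (y + c)) y = pd i u (y + c)" for c y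
  proof -
    have *: "((\<lambda>x. u (x + c)) has_derivative (\<lambda>h. \<Sum>i\<in>UNIV. h $ i * pd i u (y + c))) (at y)"
      using has_derivative_compose[OF _ has_derivative_pd[OF assms(1)], of "\<lambda>x. x + c" "\<lambda>h. h" y UNIV]
      by (simp add: has_derivative_add_const)
    show "(\<lambda>y. u (y + c)) differentiable (at y)" using * by (rule differentiableI)
    show "pd i (\<lambda>y. u (y + c)) y = pd i u (y + c)"
      by (subst pd_eq[OF *]) (simp add: axis_def if_distrib[of "\<lambda>a. a * _"] cong: if_cong)
  qed
  have F: "?F differentiable (at y)" for y by (intro differentiable_diff tr assms)
  have "t \<noteq> 0" using assms by simp
  from pd_mean_value[OF F this, of x i] obtain a where a: "\<bar>a\<bar> < \<bar>t\<bar>"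
     "?F (x + t *\<^sub>R axis i 1) - ?F x = t * pd i ?F (x + a *\<^sub>R axis i 1)" by blast
  from pd_mean_value[OF assms(2) \<open>t \<noteq> 0\<close>, of "x + a *\<^sub>R axis i 1" j]
  obtain b where b: "\<bar>b\<bar> < \<bar>t\<bar>" "pd i u (x + a *\<^sub>R axis i 1 + t *\<^sub>R axis j 1) - pd i u (x + a *\<^sub>R axis i 1)
     = t * pd j (pd i u) (x + a *\<^sub>R axis i 1 + b *\<^sub>R axis j 1)" by blast
  have "pd i ?F (x + a *\<^sub>R axis i 1) = t * pd j (pd i u) (x + a *\<^sub>R axis i 1 + b *\<^sub>R axis j 1)"
    using b by (simp add: pd_diff tr assms)
  with a b show ?thesis using assms(3) that[of a b] by (simp add: algebra_simps)
qed

text \<open>The second difference of \<open>u\<close> along \<open>i\<close> and \<open>j\<close> is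
  symmetric in the two directions. It is \<open>t * t\<close> times a value of either mixed
  derivative at some point within \<open>2 * t\<close> of \<open>x\<close>, and continuity gives
  equality in the limit.\<close>

lemma pd_commute:
  fixes u :: "real^'n \<Rightarrow> real"
  assumes u: "\<And>x. u differentiable (at x)" "\<And>i x. pd i u differentiable (at x)"
    and c: "\<And>i j. continuous_on UNIV (pd j (pd i u))"
  shows "pd j (pd i u) x = pd i (pd j u) x"
proof -
  have "\<exists>p q. norm (p - x) \<le> 2 * (1 / Suc m) \<and> norm (q - x) \<le> 2 * (1 / Suc m) \<and> pd j (pd i u) p = pd i (pd j u) q" for m
  proof -
    define t :: real where "t = 1 / Suc m"
    have t: "t > 0" by (simp add: t_def)
    obtain a b where ab: "\<bar>a\<bar> < t" "\<bar>b\<bar> < t"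
    "u (x + t *\<^sub>R axis i 1 + t *\<^sub>R axis j 1) - u (x + t *\<^sub>R axis i 1) - u (x + t *\<^sub>R axis j 1) + u x
      = t * t * pd j (pd i u) (x + a *\<^sub>R axis i 1 + b *\<^sub>R axis j 1)"
      using second_difference_mean_value[OF u t] by blast
    obtain a' b' where ab': "\<bar>a'\<bar> < t" "\<bar>b'\<bar> < t"
    "u (x + t *\<^sub>R axis j 1 + t *\<^sub>R axis i 1) - u (x + t *\<^sub>R axis j 1) - u (x + t *\<^sub>R axis i 1) + u x
      = t * t * pd i (pd j u) (x + a' *\<^sub>R axis j 1 + b' *\<^sub>R axis i 1)"
      using second_difference_mean_value[OF u t] by blast
    have bound: "norm (x + \<alpha> *\<^sub>R axis k 1 + \<beta> *\<^sub>R axis l 1 - x) \<le> 2 * t" if "\<bar>\<alpha>\<bar> < t" "\<bar>\<beta>\<bar> < t" for \<alpha> \<beta> k l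
    proof -
      have "norm (x + \<alpha> *\<^sub>R axis k 1 + \<beta> *\<^sub>R axis l 1 - x) = norm (\<alpha> *\<^sub>R axis k 1 + \<beta> *\<^sub>R axis l (1::real) :: real^'n)"
        by (simp add: algebra_simps)
      also have "\<dots> \<le> norm (\<alpha> *\<^sub>R axis k (1::real) :: real^'n) + norm (\<beta> *\<^sub>R axis l (1::real) :: real^'n)"
        by (rule norm_triangle_ineq)
      finally show ?thesis using that by simp
    qed
    have "t * t * pd j (pd i u) (x + a *\<^sub>R axis i 1 + b *\<^sub>R axis j 1)
        = t * t * pd i (pd j u) (x + a' *\<^sub>R axis j 1 + b' *\<^sub>R axis i 1)"
      using ab(3) ab'(3) by (simp add: algebra_simps)
    then have "pd j (pd i u) (x + a *\<^sub>R axis i 1 + b *\<^sub>R axis j 1)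
        = pd i (pd j u) (x + a' *\<^sub>R axis j 1 + b' *\<^sub>R axis i 1)" using t by simp
    with bound[OF ab(1,2)] bound[OF ab'(1,2)] show ?thesis unfolding t_def by blast
  qed
  then obtain p q where pq: "\<And>m. norm (p m - x) \<le> 2 * (1 / Suc m)" "\<And>m. norm (q m - x) \<le> 2 * (1 / Suc m)"
    "\<And>m. pd j (pd i u) (p m) = pd i (pd j u) (q m)" by metis
  have z: "(\<lambda>m. 2 * (1 / Suc m)) \<longlonglongrightarrow> (0::real)"
    using LIMSEQ_inverse_real_of_nat[THEN tendsto_mult_left, of 2] by (simp add: divide_inverse)
  have "(\<lambda>m. p m - x) \<longlonglongrightarrow> 0" "(\<lambda>m. q m - x) \<longlonglongrightarrow> 0"
    using pq(1,2) by (intro Lim_null_comparison[OF _ z]; simp)+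
  then have lim: "p \<longlonglongrightarrow> x" "q \<longlonglongrightarrow> x" by (auto simp: LIM_zero_iff)
  have "(\<lambda>m. pd j (pd i u) (p m)) \<longlonglongrightarrow> pd j (pd i u) x"
    using continuous_on_tendsto_compose[OF c lim(1)] by simp
  moreover have "(\<lambda>m. pd i (pd j u) (q m)) \<longlonglongrightarrow> pd i (pd j u) x"
    using continuous_on_tendsto_compose[OF c lim(2)] by simp
  ultimately show ?thesis using pq(3) LIMSEQ_unique by simp
qed

section \<open>Divergence identities on the punctured ball\<close>

abbreviation pball :: "(real^'n::finite) set" where
  "pball \<equiv> ball 0 1 - {0}"

lemma open_pball: "open pball" by auto

lemma norm_pball: "x \<in> pball \<Longrightarrow> 0 < norm x \<and> norm x < 1" by auto

text \<open>The derivative is an argument because it appears in the integrands after integration by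
  parts. The interval is open at both ends so as to admit powers of \<open>1 / r\<close> and of
  \<open>1 / kap r\<close>.\<close>

definition radial_C1 :: "(real \<Rightarrow> real) \<Rightarrow> (real \<Rightarrow> real) \<Rightarrow> bool" where
  "radial_C1 g g' \<longleftrightarrow> (\<forall>r. 0 < r \<and> r < 1 \<longrightarrow> (g has_real_derivative g' r) (at r)) \<and>
     continuous_on {0<..<1} g'"

lemma radial_C1_on: "radial_C1 g g' \<Longrightarrow> C1_on pball (\<lambda>x. g (norm x))"
  by (rule C1_on_radial[where g'=g']) (auto simp: radial_C1_def elim!: continuous_on_subset)

lemma radial_pd: "radial_C1 g g' \<Longrightarrow> x \<in> pball \<Longrightarrow> pd i (\<lambda>x. g (norm x)) x = g' (norm x) * (x $ i / norm x)"
  by (rule pd_radial) (auto simp: radial_C1_def)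

lemma radial_C1_const: "radial_C1 (\<lambda>_. c) (\<lambda>_. 0)"
  by (auto simp: radial_C1_def)

lemma radial_C1_inverse: "radial_C1 (\<lambda>r. 1 / r) (\<lambda>r. - 1 / r\<^sup>2)"
  by (auto simp: radial_C1_def power2_eq_square intro!: derivative_eq_intros continuous_intros)

lemma radial_C1_mult:
  assumes "radial_C1 f f'" "radial_C1 g g'"
  shows "radial_C1 (\<lambda>r. f r * g r) (\<lambda>r. f' r * g r + f r * g' r)"
proof -
  have "continuous_on {0<..<1} h" if "radial_C1 h h'" for h h'
    using that by (intro continuous_at_imp_continuous_on) (auto simp: radial_C1_def intro: DERIV_isCont)
  with assms show ?thesis unfolding radial_C1_def
    by (auto intro!: continuous_intros derivative_eq_intros)
qed

lemma radial_C1_divide_r: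
  assumes "radial_C1 g g'"
  shows "radial_C1 (\<lambda>r. g r / r) (\<lambda>r. g' r / r - g r / r\<^sup>2)"
  using radial_C1_mult[OF assms radial_C1_inverse] by simp

lemma norm_sum_squares: "(\<Sum>i\<in>UNIV. x $ i * x $ i) = (norm (x::real^'n))\<^sup>2"
  by (simp add: norm_vec_def L2_set_def sum_nonneg power2_eq_square)

lemma norm_coord_continuous: "continuous_on S (\<lambda>x::real^'n. x $ i)" by (intro continuous_intros)

lemma d_r_eq: "d_r f x = (\<Sum>i\<in>UNIV. x $ i * pd i f x) / norm x"
  by (simp add: d_r_def sum_divide_distrib)

lemma pd_radial_coord:
  fixes x :: "real^'n"
  assumes g: "radial_C1 g g'" and x: "x \<in> pball"
  shows "pd j (\<lambda>x. g (norm x) * x $ i) x = g' (norm x) / norm x * (x $ i * x $ j) + (if i = j then g (norm x) else 0)"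
proof -
  have "(\<lambda>x. g (norm x)) differentiable (at x)"
    using radial_C1_on[OF g] x by (auto simp: C1_on_def)
  then show ?thesis
    by (simp add: pd_mult differentiable_coord pd_coord radial_pd[OF g x])
qed

lemma div_radial_coord:
  fixes x :: "real^'n"
  assumes g: "radial_C1 g g'" and x: "x \<in> pball"
  shows "(\<Sum>i\<in>UNIV. pd i (\<lambda>x. g (norm x) * x $ i) x) = g' (norm x) * norm x + real CARD('n) * g (norm x)"
proof -
  have "(\<Sum>i\<in>UNIV. pd i (\<lambda>x. g (norm x) * x $ i) x)
      = (\<Sum>i\<in>UNIV. g' (norm x) / norm x * (x $ i * x $ i)) + real CARD('n) * g (norm x)"
    by (simp add: pd_radial_coord[OF assms] sum.distrib)
  also have "(\<Sum>i\<in>UNIV. g' (norm x) / norm x * (x $ i * x $ i)) = g' (norm x) * norm x"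
    using norm_pball[OF x]
    by (simp only: sum_distrib_left[symmetric] norm_sum_squares) (simp add: power2_eq_square)
  finally show ?thesis .
qed

section \<open>Functions supported in a fixed compact subset of the punctured ball, and their
  integration by parts\<close>

locale punctured_support =
  fixes K :: "(real^'n::finite) set"
  assumes compact_K: "compact K" and K_sub: "K \<subseteq> pball"
begin

definition C0c :: "(real^'n \<Rightarrow> real) \<Rightarrow> bool" where
  "C0c f \<longleftrightarrow> continuous_on pball f \<and> (\<forall>x. x \<notin> K \<longrightarrow> f x = 0)"

definition C1c :: "(real^'n \<Rightarrow> real) \<Rightarrow> bool" where
  "C1c f \<longleftrightarrow> C1_on pball f \<and> (\<forall>x. x \<notin> K \<longrightarrow> f x = 0)"

lemma C0c_zero: "C0c f \<Longrightarrow> x \<notin> K \<Longrightarrow> f x = 0" by (auto simp: C0c_def)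
lemma C1c_zero: "C1c f \<Longrightarrow> x \<notin> K \<Longrightarrow> f x = 0" by (auto simp: C1c_def)
lemma C1c_C1: "C1c f \<Longrightarrow> C1_on pball f" by (auto simp: C1c_def)
lemma C1c_diff_at: "C1c f \<Longrightarrow> x \<in> pball \<Longrightarrow> f differentiable (at x)" by (auto simp: C1c_def C1_on_def)

lemma C1c_C0c: "C1c f \<Longrightarrow> C0c f"
  by (auto simp: C1c_def C0c_def C1_on_continuous)

lemma C0c_integrable: "C0c f \<Longrightarrow> integrable lborel f"
  using compact_K K_sub by (intro integrable_continuous_compact[of K]) (auto simp: C0c_def elim!: continuous_on_subset)

lemma pd_zero_K: "(\<And>x. x \<notin> K \<Longrightarrow> f x = 0) \<Longrightarrow> x \<notin> K \<Longrightarrow> pd i f x = 0"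
  using pd_zero_outside[OF compact_imp_closed[OF compact_K]] by blast

lemma C1c_pd_zero: "C1c f \<Longrightarrow> x \<notin> K \<Longrightarrow> pd i f x = 0"
  using pd_zero_K C1c_zero by blast

lemma C1c_pd: "C1c f \<Longrightarrow> C0c (pd i f)"
  using C1c_pd_zero by (auto simp: C0c_def C1c_def C1_on_def)

text \<open>The open sets \<open>pball\<close> and \<open>- K\<close> cover the space, and on the
  second one \<open>f\<close> is zero. This carries functions that are regular on the punctured ball
  over to the integration lemmas, which are stated on the whole space.\<close>

lemma C1c_global:
  assumes "C1c f" shows "C1_on UNIV f"
proof -
  have op: "open (- K)" using compact_K by (simp add: compact_imp_closed open_Compl)
  have un: "pball \<union> - K = UNIV" using K_sub by auto
  have "f differentiable (at x)" for x
  proof (cases "x \<in> K")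
    case True then show ?thesis using assms K_sub C1c_diff_at by blast
  next
    case False
    then show ?thesis
      using differentiable_cong_open[OF op, of x f "\<lambda>_. 0"] C1c_zero[OF assms] by auto
  qed
  moreover have "continuous_on UNIV (pd i f)" for i
  proof -
    have "continuous_on (- K) (pd i f)"
      using C1c_pd_zero[OF assms] by (subst continuous_on_cong[of _ _ _ "\<lambda>_. 0"]) auto
    moreover have "continuous_on pball (pd i f)" using assms by (simp add: C1c_def C1_on_def)
    ultimately show ?thesis using continuous_on_open_Un[OF open_pball op] un by metis
  qed
  ultimately show ?thesis by (simp add: C1_on_def)
qed

lemma C0c_mult: "continuous_on pball g \<Longrightarrow> C0c f \<Longrightarrow> C0c (\<lambda>x. g x * f x)"
  by (auto simp: C0c_def intro!: continuous_intros)
lemma C0c_mult_right: "continuous_on pball g \<Longrightarrow> C0c f \<Longrightarrow> C0c (\<lambda>x. f x * g x)"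
  by (auto simp: C0c_def intro!: continuous_intros)
lemma C0c_mult2: "C0c g \<Longrightarrow> C0c f \<Longrightarrow> C0c (\<lambda>x. g x * f x)"
  by (auto simp: C0c_def intro!: continuous_intros)
lemma C0c_power2: "C0c f \<Longrightarrow> C0c (\<lambda>x. (f x)\<^sup>2)"
  by (auto simp: C0c_def intro!: continuous_intros)
lemma C0c_add: "C0c g \<Longrightarrow> C0c f \<Longrightarrow> C0c (\<lambda>x. g x + f x)"
  by (auto simp: C0c_def intro!: continuous_intros)
lemma C0c_diff: "C0c g \<Longrightarrow> C0c f \<Longrightarrow> C0c (\<lambda>x. g x - f x)"
  by (auto simp: C0c_def intro!: continuous_intros)
lemma C0c_sum: "(\<And>k. k \<in> I \<Longrightarrow> C0c (f k)) \<Longrightarrow> C0c (\<lambda>x. \<Sum>k\<in>I. f k x)"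
  by (auto simp: C0c_def intro!: continuous_intros)

lemma C1c_mult: "C1_on pball g \<Longrightarrow> C1c f \<Longrightarrow> C1c (\<lambda>x. g x * f x)"
  by (auto simp: C1c_def C1_on_mult)
lemma C1c_diff: "C1c g \<Longrightarrow> C1c f \<Longrightarrow> C1c (\<lambda>x. g x - f x)"
  by (auto simp: C1c_def C1_on_diff)
lemma C1c_sum: "finite I \<Longrightarrow> (\<And>k. k \<in> I \<Longrightarrow> C1c (f k)) \<Longrightarrow> C1c (\<lambda>x. \<Sum>k\<in>I. f k x)"
  by (auto simp: C1c_def C1_on_sum)

lemma integral_cong_K:
  assumes "\<And>x. x \<in> K \<Longrightarrow> f x = g x" "\<And>x. x \<notin> K \<Longrightarrow> f x = 0" "\<And>x. x \<notin> K \<Longrightarrow> g x = 0"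
  shows "(\<integral>x. f x \<partial>lborel) = (\<integral>x. g x \<partial>lborel :: real)"
  using assms by (intro Bochner_Integration.integral_cong) (auto, metis)

lemma d_r_zero: "(\<And>x. x \<notin> K \<Longrightarrow> f x = 0) \<Longrightarrow> x \<notin> K \<Longrightarrow> d_r f x = 0"
  unfolding d_r_def by (intro sum.neutral ballI) (use pd_zero_K in auto)

lemma C1c_d_r_zero: "C1c f \<Longrightarrow> x \<notin> K \<Longrightarrow> d_r f x = 0"
  using d_r_zero C1c_zero by blast

lemma C1c_d_r: "C1c f \<Longrightarrow> C0c (d_r f)"
  unfolding d_r_def by (intro C0c_sum C0c_mult continuous_intros C1c_pd) auto

lemma integral_divergence:
  assumes "\<And>i. C1c (V i)"
  shows "(\<integral>x. (\<Sum>i\<in>UNIV. pd i (V i) x) \<partial>lborel) = 0"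
proof -
  have "(\<integral>x. pd i (V i) x \<partial>lborel) = 0" for i
    using integral_pd_eq_0[OF C1c_global[OF assms] compact_K] C1c_zero[OF assms] by blast
  then show ?thesis
    by (subst Bochner_Integration.integral_sum) (auto intro: C0c_integrable C1c_pd assms)
qed

text \<open>This is \<open>integral_pd_swap\<close> for \<open>p * f\<close> and \<open>g\<close>,
  expanded by the product rule. The weight may be singular at the origin and on the unit sphere,
  since \<open>p * f\<close> is supported in \<open>K\<close>.\<close>

lemma integral_pd_swap_weighted:
  assumes f: "C1c f" and g: "C1c g" and p: "C1_on pball p"
  shows "(\<integral>x. p x * (pd i f x * pd j g x - pd j f x * pd i g x)
            + f x * (pd i p x * pd j g x - pd j p x * pd i g x) \<partial>lborel) = 0" (is "?I = 0")
proof -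
  have pf: "C1c (\<lambda>x. p x * f x)" using C1c_mult p f by blast
  have "?I = (\<integral>x. pd i (\<lambda>x. p x * f x) x * pd j g x - pd j (\<lambda>x. p x * f x) x * pd i g x \<partial>lborel)"
  proof (rule integral_cong_K)
    fix x assume "x \<in> K"
    then have "p differentiable (at x)" "f differentiable (at x)"
      using K_sub p C1c_C1[OF f] by (auto simp: C1_on_def)
    then show "p x * (pd i f x * pd j g x - pd j f x * pd i g x)
            + f x * (pd i p x * pd j g x - pd j p x * pd i g x) =
          pd i (\<lambda>x. p x * f x) x * pd j g x - pd j (\<lambda>x. p x * f x) x * pd i g x"
      by (simp add: pd_mult algebra_simps)
  qed (simp_all add: C1c_pd_zero f g C1c_zero)
  also have "\<dots> = (\<integral>x. pd i (\<lambda>x. p x * f x) x * pd j g x \<partial>lborel) - (\<integral>x. pd j (\<lambda>x. p x * f x) x * pd i g x \<partial>lborel)"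
    by (intro Bochner_Integration.integral_diff C0c_integrable C0c_mult2 C1c_pd pf g)
  also have "\<dots> = 0"
    using integral_pd_swap[OF C1c_global[OF pf] C1c_global[OF g] compact_K C1c_zero[OF pf] C1c_zero[OF g]]
    by simp
  finally show ?thesis .
qed

text \<open>The integrand is the divergence of the radial field of length \<open>g * f\<close>. In
  polar coordinates it is the radial derivative of r^(n-1) * g * f, divided by r^(n-1).\<close>

lemma integral_radial_parts:
  assumes f: "C1c f" and g: "radial_C1 g g'"
  shows "(\<integral>x. g (norm x) * d_r f x + (g' (norm x) + (real CARD('n) - 1) * g (norm x) / norm x) * f x \<partial>lborel) = 0"
    (is "?I = 0")
proof -
  let ?G = "\<lambda>r. g r / r"
  have G: "radial_C1 ?G (\<lambda>r. g' r / r - g r / r\<^sup>2)" by (rule radial_C1_divide_r[OF g])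
  have c1: "C1_on pball (\<lambda>x. ?G (norm x) * x $ i)" for i
    using C1_on_mult[OF radial_C1_on[OF G] C1_on_coord] .
  let ?V = "\<lambda>i x. (?G (norm x) * x $ i) * f x"
  have V: "C1c (?V i)" for i using C1c_mult[OF c1 f] .
  have "?I = (\<integral>x. (\<Sum>i\<in>UNIV. pd i (?V i) x) \<partial>lborel)"
  proof (rule integral_cong_K)
    fix x assume "x \<in> K"
    then have x: "x \<in> pball" using K_sub by auto
    then have r: "0 < norm x" by auto
    have "(\<Sum>i\<in>UNIV. pd i (?V i) x) = (\<Sum>i\<in>UNIV. (?G (norm x) * (x $ i * pd i f x)) + pd i (\<lambda>x. ?G (norm x) * x $ i) x * f x)"
      by (intro sum.cong refl, subst pd_mult[OF C1_on_D(1)[OF c1 x] C1c_diff_at[OF f x]]) simp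
    also have "\<dots> = ?G (norm x) * (\<Sum>i\<in>UNIV. x $ i * pd i f x) + (\<Sum>i\<in>UNIV. pd i (\<lambda>x. ?G (norm x) * x $ i) x) * f x"
      by (simp add: sum.distrib sum_distrib_left sum_distrib_right)
    also have "\<dots> = g (norm x) * d_r f x + ((g' (norm x) / norm x - g (norm x) / (norm x)\<^sup>2) * norm x
         + real CARD('n) * (g (norm x) / norm x)) * f x"
      by (simp only: div_radial_coord[OF G x] d_r_eq) simp
    also have "(g' (norm x) / norm x - g (norm x) / (norm x)\<^sup>2) * norm x + real CARD('n) * (g (norm x) / norm x)
      = g' (norm x) + (real CARD('n) - 1) * g (norm x) / norm x"
      using r by (simp add: field_simps power2_eq_square)
    finally show "g (norm x) * d_r f x + (g' (norm x) + (real CARD('n) - 1) * g (norm x) / norm x) * f x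
      = (\<Sum>i\<in>UNIV. pd i (?V i) x)" by simp
  next
    fix x assume "x \<notin> K"
    then show "(\<Sum>i\<in>UNIV. pd i (?V i) x) = 0" using C1c_pd_zero[OF V] by (intro sum.neutral) auto
  qed (simp add: C1c_zero[OF f] C1c_d_r_zero[OF f])
  then show ?thesis using integral_divergence[OF V] by simp
qed

end

section \<open>Vector fields tangent to the spheres around the origin\<close>

locale tangential_field = punctured_support K for K :: "(real^'n::finite) set" +
  fixes w :: "'n \<Rightarrow> real^'n \<Rightarrow> real"
  assumes C1w: "C1c (w j)" and tang: "(\<Sum>j\<in>UNIV. x $ j * w j x) = 0"
begin

text \<open>The Euclidean divergence of \<open>w\<close> is also its divergence along the spheres,
  because by \<open>tang_pd2\<close> the radial derivative of \<open>w\<close> has no radial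
  component.\<close>

definition "dw x = (\<Sum>j\<in>UNIV. pd j (w j) x)"

lemma dw_zero: "x \<notin> K \<Longrightarrow> dw x = 0"
  using C1c_pd_zero[OF C1w] by (auto simp: dw_def)

lemma C0c_dw: "C0c dw"
  unfolding dw_def[abs_def] by (intro C0c_sum C1c_pd C1w)

text \<open>Differentiating \<open>tang\<close> along \<open>i\<close> gives this; the right-hand
  side comes from the derivative of the coordinate. It carries the curvature of the spheres into the
  later identities.\<close>

lemma tang_pd:
  assumes "x \<in> pball"
  shows "(\<Sum>j\<in>UNIV. x $ j * pd i (w j) x) = - w i x"
proof -
  have "0 = pd i (\<lambda>x. \<Sum>j\<in>UNIV. x $ j * w j x) x" by (simp add: tang)
  also have "\<dots> = (\<Sum>j\<in>UNIV. pd i (\<lambda>x. x $ j * w j x) x)"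
    by (intro pd_sum differentiable_mult differentiable_coord C1c_diff_at[OF C1w assms]) auto
  also have "\<dots> = (\<Sum>j\<in>UNIV. x $ j * pd i (w j) x + (if i = j then w j x else 0))"
    by (intro sum.cong refl)
      (subst pd_mult; auto simp: differentiable_coord C1c_diff_at[OF C1w assms] pd_coord)
  also have "\<dots> = (\<Sum>j\<in>UNIV. x $ j * pd i (w j) x) + w i x" by (simp add: sum.distrib)
  finally show ?thesis by simp
qed

lemma tang_pd2:
  assumes "x \<in> pball"
  shows "(\<Sum>i\<in>UNIV. \<Sum>j\<in>UNIV. x $ i * x $ j * pd i (w j) x) = 0"
proof -
  have "(\<Sum>i\<in>UNIV. \<Sum>j\<in>UNIV. x $ i * x $ j * pd i (w j) x) = (\<Sum>i\<in>UNIV. x $ i * (\<Sum>j\<in>UNIV. x $ j * pd i (w j) x))"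
    by (simp add: sum_distrib_left mult.assoc)
  also have "\<dots> = 0" using tang[of x] by (simp add: tang_pd[OF assms] sum_negf)
  finally show ?thesis .
qed

text \<open>The integrand is the divergence of \<open>g * z * w\<close>. The gradient of the radial
  weight is orthogonal to \<open>w\<close>, so \<open>g'\<close> drops out.\<close>

lemma integral_tangential_parts:
  assumes z: "C1_on pball z" and g: "radial_C1 g g'"
  shows "(\<integral>x. g (norm x) * (z x * dw x + (\<Sum>j\<in>UNIV. w j x * pd j z x)) \<partial>lborel) = 0" (is "?I = 0")
proof -
  have gz: "C1_on pball (\<lambda>x. g (norm x) * z x)" using C1_on_mult[OF radial_C1_on[OF g] z] .
  let ?V = "\<lambda>i x. (g (norm x) * z x) * w i x"
  have V: "C1c (?V i)" for i using C1c_mult[OF gz C1w] .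
  have "?I = (\<integral>x. (\<Sum>i\<in>UNIV. pd i (?V i) x) \<partial>lborel)"
  proof (rule integral_cong_K)
    fix x assume "x \<in> K"
    then have x: "x \<in> pball" using K_sub by auto
    have gd: "(\<lambda>x. g (norm x)) differentiable (at x)" using radial_C1_on[OF g] x by (auto simp: C1_on_def)
    have zd: "z differentiable (at x)" using z x by (auto simp: C1_on_def)
    have "pd i (?V i) x = g (norm x) * (z x * pd i (w i) x + w i x * pd i z x)
       + g' (norm x) * z x / norm x * (x $ i * w i x)" for i
      by (simp add: pd_mult differentiable_mult gd zd C1c_diff_at[OF C1w x] radial_pd[OF g x] algebra_simps)
    then have "(\<Sum>i\<in>UNIV. pd i (?V i) x) = g (norm x) * (\<Sum>i\<in>UNIV. (z x * pd i (w i) x + w i x * pd i z x))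
       + g' (norm x) * z x / norm x * (\<Sum>i\<in>UNIV. x $ i * w i x)"
      by (simp only: sum.distrib sum_distrib_left distrib_left)
    also have "\<dots> = g (norm x) * (z x * dw x + (\<Sum>j\<in>UNIV. w j x * pd j z x))"
      by (simp add: tang dw_def sum.distrib sum_distrib_left)
    finally show "g (norm x) * (z x * dw x + (\<Sum>j\<in>UNIV. w j x * pd j z x)) = (\<Sum>i\<in>UNIV. pd i (?V i) x)" by simp
  next
    fix x assume "x \<notin> K"
    then show "(\<Sum>i\<in>UNIV. pd i (?V i) x) = 0" using C1c_pd_zero[OF V] by (intro sum.neutral) auto
  qed (simp add: C1c_zero[OF C1w] dw_zero)
  then show ?thesis using integral_divergence[OF V] by simp
qed

text \<open>This sums \<open>integral_pd_swap_weighted\<close> over all \<open>i\<close> and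
  \<open>j\<close>, applied to \<open>z\<close> and \<open>w j\<close> with the \<open>i\<close>-th
  component of the radial field of length \<open>g\<close> as weight. The divergence of that field
  is \<open>g' + (n - 1) * g / r\<close>, and the opposite term takes away one more
  \<open>g / r\<close>; hence the factor n - 2.\<close>

lemma integral_radial_swap:
  assumes z: "C1c z" and g: "radial_C1 g g'"
  shows "(\<integral>x. g (norm x) * (d_r z x * dw x - (\<Sum>j\<in>UNIV. pd j z x * d_r (w j) x))
            + z x * dw x * (g' (norm x) + (real CARD('n) - 2) * g (norm x) / norm x) \<partial>lborel) = 0" (is "?I = 0")
proof -
  let ?G = "\<lambda>r. g r / r"
  define G' where "G' = (\<lambda>r. g' r / r - g r / r\<^sup>2)"
  have G: "radial_C1 ?G G'" unfolding G'_def by (rule radial_C1_divide_r[OF g])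
  let ?p = "\<lambda>i x. ?G (norm x) * x $ i"
  have c1: "C1_on pball (?p i)" for i
    using C1_on_mult[OF radial_C1_on[OF G] C1_on_coord] .
  let ?E = "\<lambda>i j x. ?p i x * (pd i z x * pd j (w j) x - pd j z x * pd i (w j) x)
            + z x * (pd i (?p i) x * pd j (w j) x - pd j (?p i) x * pd i (w j) x)"
  have "?I = (\<integral>x. (\<Sum>i\<in>UNIV. \<Sum>j\<in>UNIV. ?E i j x) \<partial>lborel)"
  proof (rule integral_cong_K)
    fix x assume "x \<in> K"
    then have x: "x \<in> pball" using K_sub by auto
    then have r: "0 < norm x" by auto
    let ?g = "g (norm x)" and ?r = "norm x"
    have 1: "(\<Sum>i\<in>UNIV. \<Sum>j\<in>UNIV. ?p i x * (pd i z x * pd j (w j) x)) = ?g * d_r z x * dw x"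
      unfolding d_r_eq dw_def
      by (simp add: sum_product sum_distrib_left sum_distrib_right sum_divide_distrib algebra_simps)
    have 2: "(\<Sum>i\<in>UNIV. \<Sum>j\<in>UNIV. ?p i x * (pd j z x * pd i (w j) x)) = ?g * (\<Sum>j\<in>UNIV. pd j z x * d_r (w j) x)"
      unfolding d_r_eq
      by (subst sum.swap) (simp add: sum_distrib_left sum_distrib_right sum_divide_distrib algebra_simps)
    have 3: "(\<Sum>i\<in>UNIV. \<Sum>j\<in>UNIV. pd i (?p i) x * pd j (w j) x) = (G' ?r * ?r + real CARD('n) * ?G ?r) * dw x"
      unfolding div_radial_coord[OF G x, symmetric] dw_def by (simp add: sum_product)
    \<comment> \<open>The derivative of the weight consists of a multiple of
      \<open>x $ i * x $ j\<close>, which \<open>tang_pd2\<close> annihilates, and of a diagonal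
      part, which leaves \<open>dw\<close>.\<close>
    have 4: "(\<Sum>i\<in>UNIV. \<Sum>j\<in>UNIV. pd j (?p i) x * pd i (w j) x) = ?G ?r * dw x"
    proof -
      have "(\<Sum>i\<in>UNIV. \<Sum>j\<in>UNIV. pd j (?p i) x * pd i (w j) x) =
        (\<Sum>i\<in>UNIV. \<Sum>j\<in>UNIV. G' ?r / ?r * (x $ i * x $ j * pd i (w j) x) + (if i = j then ?G ?r * pd i (w j) x else 0))"
        unfolding pd_radial_coord[OF G x]
        by (intro sum.cong refl) (auto simp: algebra_simps)
      also have "\<dots> = G' ?r / ?r * (\<Sum>i\<in>UNIV. \<Sum>j\<in>UNIV. x $ i * x $ j * pd i (w j) x) + ?G ?r * dw x"
        by (simp add: sum.distrib sum_distrib_left dw_def)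
      finally show ?thesis by (simp add: tang_pd2[OF x])
    qed
    have "(\<Sum>i\<in>UNIV. \<Sum>j\<in>UNIV. ?E i j x) =
      ((\<Sum>i\<in>UNIV. \<Sum>j\<in>UNIV. ?p i x * (pd i z x * pd j (w j) x)) - (\<Sum>i\<in>UNIV. \<Sum>j\<in>UNIV. ?p i x * (pd j z x * pd i (w j) x)))
      + z x * ((\<Sum>i\<in>UNIV. \<Sum>j\<in>UNIV. pd i (?p i) x * pd j (w j) x) - (\<Sum>i\<in>UNIV. \<Sum>j\<in>UNIV. pd j (?p i) x * pd i (w j) x))"
      by (simp only: sum.distrib sum_subtractf sum_distrib_left right_diff_distrib)
    also have "\<dots> = ?g * d_r z x * dw x - ?g * (\<Sum>j\<in>UNIV. pd j z x * d_r (w j) x) + z x *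
       ((G' ?r * ?r + real CARD('n) * ?G ?r) * dw x - ?G ?r * dw x)" unfolding 1 2 3 4 ..
    also have "\<dots> = ?g * (d_r z x * dw x - (\<Sum>j\<in>UNIV. pd j z x * d_r (w j) x))
            + z x * dw x * (g' ?r + (real CARD('n) - 2) * ?g / ?r)"
    proof -
      have "(G' ?r * ?r + real CARD('n) * ?G ?r) - ?G ?r = g' ?r + (real CARD('n) - 2) * ?g / ?r"
        using r by (simp add: G'_def field_simps power2_eq_square)
      then show ?thesis by algebra
    qed
    finally show "?g * (d_r z x * dw x - (\<Sum>j\<in>UNIV. pd j z x * d_r (w j) x))
            + z x * dw x * (g' ?r + (real CARD('n) - 2) * ?g / ?r) = (\<Sum>i\<in>UNIV. \<Sum>j\<in>UNIV. ?E i j x)" by simp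
  qed (simp_all add: C1c_zero[OF z] C1c_pd_zero[OF z] dw_zero)
  also have "\<dots> = (\<Sum>i\<in>UNIV. \<Sum>j\<in>UNIV. (\<integral>x. ?E i j x \<partial>lborel))"
  proof -
    have "C0c (?E i j)" for i j
      by (intro C0c_add C0c_mult C0c_mult2 C0c_diff C1c_pd z C1w C1_on_continuous[OF c1]
            C1c_C0c C0c_mult[OF C1_on_D(2)[OF c1]])
    then show ?thesis
      by (simp add: Bochner_Integration.integral_sum Bochner_Integration.integrable_sum C0c_integrable)
  qed
  also have "\<dots> = 0" by (simp only: integral_pd_swap_weighted[OF z C1w c1] sum.neutral_const)
  finally show ?thesis .
qed

text \<open>The integrated Bochner formula in Euclidean form:
  \<open>integral_pd_swap_weighted\<close> for \<open>w i\<close> and \<open>w j\<close> with a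
  radial weight. Of the two terms with the gradient of the weight one vanishes by
  \<open>tang\<close>, and \<open>tang_pd\<close> turns the other into the sum of the squares of the
  \<open>w j\<close>.\<close>

lemma integral_bochner:
  assumes g: "radial_C1 g g'"
  shows "(\<integral>x. g (norm x) * ((dw x)\<^sup>2 - (\<Sum>i\<in>UNIV. \<Sum>j\<in>UNIV. pd i (w j) x * pd j (w i) x))
            + g' (norm x) / norm x * (\<Sum>j\<in>UNIV. (w j x)\<^sup>2) \<partial>lborel) = 0" (is "?I = 0")
proof -
  let ?p = "\<lambda>x. g (norm x)"
  have c1: "C1_on pball ?p" using radial_C1_on[OF g] .
  let ?E = "\<lambda>i j x. ?p x * (pd i (w i) x * pd j (w j) x - pd j (w i) x * pd i (w j) x)
            + w i x * (pd i ?p x * pd j (w j) x - pd j ?p x * pd i (w j) x)"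
  have "?I = (\<integral>x. (\<Sum>i\<in>UNIV. \<Sum>j\<in>UNIV. ?E i j x) \<partial>lborel)"
  proof (rule integral_cong_K)
    fix x assume "x \<in> K"
    then have x: "x \<in> pball" using K_sub by auto
    let ?g = "g (norm x)" and ?r = "norm x"
    have 1: "(\<Sum>i\<in>UNIV. \<Sum>j\<in>UNIV. pd i (w i) x * pd j (w j) x) = (dw x)\<^sup>2"
      unfolding dw_def power2_eq_square by (simp add: sum_product)
    have 3: "(\<Sum>i\<in>UNIV. \<Sum>j\<in>UNIV. w i x * (pd i ?p x * pd j (w j) x)) = 0"
    proof -
      have "(\<Sum>i\<in>UNIV. \<Sum>j\<in>UNIV. w i x * (pd i ?p x * pd j (w j) x)) = g' ?r / ?r * ((\<Sum>i\<in>UNIV. x $ i * w i x) * dw x)"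
        unfolding radial_pd[OF g x] dw_def sum_product by (simp add: sum_distrib_left algebra_simps)
      then show ?thesis by (simp add: tang)
    qed
    have 4: "(\<Sum>i\<in>UNIV. \<Sum>j\<in>UNIV. w i x * (pd j ?p x * pd i (w j) x)) = - (g' ?r / ?r * (\<Sum>j\<in>UNIV. (w j x)\<^sup>2))"
    proof -
      have "(\<Sum>i\<in>UNIV. \<Sum>j\<in>UNIV. w i x * (pd j ?p x * pd i (w j) x)) =
        (\<Sum>i\<in>UNIV. g' ?r / ?r * (w i x * (\<Sum>j\<in>UNIV. x $ j * pd i (w j) x)))"
        unfolding radial_pd[OF g x] by (simp add: sum_distrib_left algebra_simps)
      also have "\<dots> = - (g' ?r / ?r * (\<Sum>j\<in>UNIV. (w j x)\<^sup>2))"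
        by (simp add: tang_pd[OF x] sum_distrib_left sum_negf power2_eq_square)
      finally show ?thesis .
    qed
    have "(\<Sum>i\<in>UNIV. \<Sum>j\<in>UNIV. ?E i j x) =
      ?g * ((\<Sum>i\<in>UNIV. \<Sum>j\<in>UNIV. pd i (w i) x * pd j (w j) x) - (\<Sum>i\<in>UNIV. \<Sum>j\<in>UNIV. pd j (w i) x * pd i (w j) x))
      + ((\<Sum>i\<in>UNIV. \<Sum>j\<in>UNIV. w i x * (pd i ?p x * pd j (w j) x)) - (\<Sum>i\<in>UNIV. \<Sum>j\<in>UNIV. w i x * (pd j ?p x * pd i (w j) x)))"
      by (simp only: sum.distrib sum_subtractf sum_distrib_left right_diff_distrib)
    also have "\<dots> = ?g * ((dw x)\<^sup>2 - (\<Sum>i\<in>UNIV. \<Sum>j\<in>UNIV. pd i (w j) x * pd j (w i) x))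
            + g' ?r / ?r * (\<Sum>j\<in>UNIV. (w j x)\<^sup>2)"
      unfolding 1 3 4 by (simp add: mult.commute)
    finally show "?g * ((dw x)\<^sup>2 - (\<Sum>i\<in>UNIV. \<Sum>j\<in>UNIV. pd i (w j) x * pd j (w i) x))
            + g' ?r / ?r * (\<Sum>j\<in>UNIV. (w j x)\<^sup>2) = (\<Sum>i\<in>UNIV. \<Sum>j\<in>UNIV. ?E i j x)" by simp
  qed (simp_all add: C1c_zero[OF C1w] C1c_pd_zero[OF C1w] dw_zero)
  also have "\<dots> = (\<Sum>i\<in>UNIV. \<Sum>j\<in>UNIV. (\<integral>x. ?E i j x \<partial>lborel))"
  proof -
    have "C0c (?E i j)" for i j
      by (intro C0c_add C0c_mult C0c_mult2 C0c_diff C1c_pd C1w C1_on_continuous[OF c1]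
            C1c_C0c C0c_mult[OF C1_on_D(2)[OF c1]])
    then show ?thesis
      by (simp add: Bochner_Integration.integral_sum Bochner_Integration.integrable_sum C0c_integrable)
  qed
  also have "\<dots> = 0" by (simp only: integral_pd_swap_weighted[OF C1w C1w c1] sum.neutral_const)
  finally show ?thesis .
qed

end

section \<open>Radial weights and the Hardy inequality\<close>

text \<open>The hyperbolic metric is the Euclidean one divided by the square of \<open>kap\<close>,
  so multiplication by \<open>kap\<close> turns a Euclidean derivative along a unit vector into a
  hyperbolic one.\<close>

definition kap :: "real \<Rightarrow> real" where "kap r = (1 - r\<^sup>2) / 2"

lemma kap_pos: "0 < r \<Longrightarrow> r < 1 \<Longrightarrow> 0 < kap r"
  by (simp add: kap_def abs_square_less_1)

lemma kap_norm_pos: "x \<in> pball \<Longrightarrow> 0 < kap (norm x)"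
  using kap_pos norm_pball by blast

lemma radial_C1_cong:
  assumes "radial_C1 f f'" "\<And>r. 0 < r \<Longrightarrow> r < 1 \<Longrightarrow> f' r = g' r"
  shows "radial_C1 f g'"
proof -
  have "continuous_on {0<..<1} f' \<longleftrightarrow> continuous_on {0<..<1} g'"
    by (rule continuous_on_cong) (auto simp: assms(2))
  then show ?thesis using assms by (auto simp: radial_C1_def)
qed

lemma radial_C1_kap: "radial_C1 kap (\<lambda>r. - r)"
  unfolding radial_C1_def kap_def by (auto intro!: derivative_eq_intros continuous_intros)

lemma radial_C1_id: "radial_C1 (\<lambda>r. r) (\<lambda>r. 1)"
  by (auto simp: radial_C1_def)

lemma radial_C1_add:
  assumes "radial_C1 f f'" "radial_C1 g g'"
  shows "radial_C1 (\<lambda>r. f r + g r) (\<lambda>r. f' r + g' r)"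
  using assms unfolding radial_C1_def by (auto intro!: continuous_intros derivative_eq_intros)

lemma radial_C1_continuous: "radial_C1 g g' \<Longrightarrow> continuous_on pball (\<lambda>x. g (norm x))"
  by (rule C1_on_continuous[OF radial_C1_on])

lemma radial_C1_continuous':
  assumes "radial_C1 g g'" shows "continuous_on pball (\<lambda>x. g' (norm x))"
proof (rule continuous_on_compose2[of "{0<..<1}" g'])
  show "continuous_on {0<..<1} g'" using assms by (simp add: radial_C1_def)
qed (auto intro: continuous_on_norm_id)

lemma d_r_radial_mult:
  fixes x :: "real^'n"
  assumes g: "radial_C1 g g'" and x: "x \<in> pball" and f: "f differentiable (at x)"
  shows "d_r (\<lambda>x. g (norm x) * f x) x = g (norm x) * d_r f x + g' (norm x) * f x"
proof -
  have gd: "(\<lambda>x. g (norm x)) differentiable (at x)" using radial_C1_on[OF g] x by (auto simp: C1_on_def)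
  have r: "0 < norm x" using x by auto
  have "(\<Sum>i\<in>UNIV. x $ i * pd i (\<lambda>x. g (norm x) * f x) x) =
    g (norm x) * (\<Sum>i\<in>UNIV. x $ i * pd i f x) + (\<Sum>i\<in>UNIV. (g' (norm x) * f x / norm x) * (x $ i * x $ i))"
    unfolding pd_mult[OF gd f] radial_pd[OF g x]
    by (simp add: sum_distrib_left sum.distrib algebra_simps)
  also have "\<dots> = g (norm x) * (\<Sum>i\<in>UNIV. x $ i * pd i f x) + norm x * (g' (norm x) * f x)"
    using r by (simp only: sum_distrib_left[symmetric] norm_sum_squares) (simp add: power2_eq_square)
  finally show ?thesis using r by (simp add: d_r_eq field_simps)
qed

lemma d_r_mult:
  assumes "f differentiable (at x)" "g differentiable (at x)"
  shows "d_r (\<lambda>x. f x * g x) x = f x * d_r g x + d_r f x * g x"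
  by (simp add: d_r_def pd_mult[OF assms] sum.distrib sum_distrib_left sum_distrib_right algebra_simps)

section \<open>Hyperbolic functions of the distance, as functions of the Euclidean radius\<close>

definition rho :: "real \<Rightarrow> real" where "rho r = ln ((1 + r) / (1 - r))"

text \<open>The hyperbolic cotangent of the distance in rational form, see
  \<open>coth_hrho\<close>.\<close>

definition coth_rho :: "real \<Rightarrow> real" where "coth_rho r = (1 + r\<^sup>2) / (2 * r)"

lemma hrho_eq: "hrho x = rho (norm x)"
  by (simp add: hrho_def rho_def)

lemma rho_pos: "0 < r \<Longrightarrow> r < 1 \<Longrightarrow> 0 < rho r"
  by (simp add: rho_def)

lemma sinh_cosh_rho:
  assumes "0 < r" "r < 1"
  shows "sinh (rho r) = r / kap r" "cosh (rho r) = (1 + r\<^sup>2) / (2 * kap r)"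
proof -
  have k: "kap r = (1 - r) * (1 + r) / 2" by (simp add: kap_def power2_eq_square algebra_simps)
  have nz: "1 - r \<noteq> 0" "1 + r \<noteq> 0" and pos: "0 < (1 + r) / (1 - r)" using assms by auto
  show "sinh (rho r) = r / kap r" unfolding rho_def sinh_ln_real[OF pos] k
    using nz by (simp add: divide_simps) (simp add: algebra_simps)
  show "cosh (rho r) = (1 + r\<^sup>2) / (2 * kap r)" unfolding rho_def cosh_ln_real[OF pos] k
    using nz by (simp add: divide_simps) (simp add: power2_eq_square algebra_simps)
qed

lemma sinh_hrho: "x \<in> pball \<Longrightarrow> sinh (hrho x) = norm x / kap (norm x)"
  unfolding hrho_eq using norm_pball by (intro sinh_cosh_rho) blast+

lemma coth_hrho:
  assumes "x \<in> pball" shows "cosh (hrho x) / sinh (hrho x) = coth_rho (norm x)"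
  using sinh_cosh_rho[of "norm x"] norm_pball[OF assms] kap_norm_pos[OF assms]
  by (simp add: hrho_eq coth_rho_def)

text \<open>Since \<open>kap r / r\<close> is the reciprocal of \<open>sinh (rho r)\<close>, this is
  coth^2 = 1 + 1 / sinh^2.\<close>

lemma coth_rho_squared: "0 < r \<Longrightarrow> (coth_rho r)\<^sup>2 = 1 + (kap r / r)\<^sup>2"
  by (simp add: coth_rho_def kap_def field_simps power2_eq_square)

lemma coth_rho_eq: "0 < r \<Longrightarrow> coth_rho r = r + kap r / r"
  by (simp add: coth_rho_def kap_def field_simps power2_eq_square)

lemma radial_C1_coth_rho: "radial_C1 coth_rho (\<lambda>r. - kap r / r\<^sup>2)"
  unfolding coth_rho_def[abs_def] kap_def radial_C1_def
  by (auto intro!: derivative_eq_intros continuous_intros simp: field_simps power2_eq_square)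

lemma radial_C1_inverse_rho: "radial_C1 (\<lambda>r. 1 / rho r) (\<lambda>r. - 1 / ((rho r)\<^sup>2 * kap r))"
proof -
  \<comment> \<open>That is, \<open>rho\<close> is the arc length of a ray in the metric with factor
    \<open>1 / kap\<close>.\<close>
  have d: "(rho has_real_derivative 1 / kap r) (at r)" if "0 < r" "r < 1" for r
  proof -
    have "((\<lambda>r. (1 + r) / (1 - r)) has_real_derivative 2 / ((1 - r) * (1 - r))) (at r)"
      using that by (auto intro!: derivative_eq_intros simp: field_simps)
    moreover have "0 < (1 + r) / (1 - r)" using that by simp
    ultimately have "((\<lambda>r. ln ((1 + r) / (1 - r))) has_real_derivative
        1 / ((1 + r) / (1 - r)) * (2 / ((1 - r) * (1 - r)))) (at r)"
      by (intro DERIV_chain2[OF DERIV_ln_divide])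
    moreover have "1 / ((1 + r) / (1 - r)) * (2 / ((1 - r) * (1 - r))) = 2 / ((1 - r) * (1 + r))"
      using that by (simp add: divide_simps)
    moreover have "(1 - r) * (1 + r) = 1 - r\<^sup>2" by (simp add: power2_eq_square algebra_simps)
    ultimately show ?thesis by (simp add: rho_def[abs_def] kap_def)
  qed
  have "continuous_on {0<..<1} rho"
    using DERIV_isCont[OF d] by (intro continuous_at_imp_continuous_on) auto
  moreover have "continuous_on {0<..<1} kap" unfolding kap_def[abs_def] by (intro continuous_intros) auto
  moreover have "rho r \<noteq> 0" "kap r \<noteq> 0" if "0 < r" "r < 1" for r using rho_pos kap_pos that by force+
  ultimately show ?thesis unfolding radial_C1_def
    by (auto intro!: continuous_intros derivative_eq_intros d simp: power2_eq_square)
qed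

text \<open>The density of the hyperbolic volume with respect to Lebesgue measure in dimension
  \<open>n\<close>.\<close>

definition W :: "nat \<Rightarrow> real \<Rightarrow> real" where "W n r = (2 / (1 - r\<^sup>2)) ^ n"

lemma W_eq: "W n r = (1 / kap r) ^ n" by (simp add: W_def kap_def)

lemma W_pos: "0 < r \<Longrightarrow> r < 1 \<Longrightarrow> 0 < W n r" using kap_pos by (simp add: W_eq)

context punctured_support
begin

lemma radial_C1_W: "radial_C1 (W CARD('n)) (\<lambda>r. real CARD('n) * W CARD('n) r * r / kap r)"
proof -
  have "(W CARD('n) has_real_derivative real CARD('n) * W CARD('n) r * r / kap r) (at r)" if r: "0 < r" "r < 1" for r
  proof -
    have k: "(kap has_real_derivative - r) (at r)" using radial_C1_kap r by (auto simp: radial_C1_def)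
    have k0: "kap r \<noteq> 0" using kap_pos[OF r] by simp
    have e: "(1 / kap r) ^ CARD('n) = (1 / kap r) ^ (CARD('n) - Suc 0) * (1 / kap r)"
      by (metis Suc_diff_1 One_nat_def power_Suc2 zero_less_card_finite)
    have "((\<lambda>r. 1 / kap r) has_real_derivative r / kap r * (1 / kap r)) (at r)"
      using k0 by (auto intro!: derivative_eq_intros k)
    from DERIV_power[OF this, of "CARD('n)"]
    have "((\<lambda>r. (1 / kap r) ^ CARD('n)) has_real_derivative real CARD('n) * (1 / kap r) ^ CARD('n) * r / kap r) (at r)"
      unfolding e by (simp add: mult_ac)
    then show ?thesis by (simp add: W_eq[abs_def])
  qed
  moreover have "continuous_on {0<..<1} (W CARD('n))"
    using DERIV_isCont[OF calculation] by (intro continuous_at_imp_continuous_on) auto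
  moreover have "continuous_on {0<..<1} kap" unfolding kap_def[abs_def] by (intro continuous_intros) auto
  moreover have "kap r \<noteq> 0" if "0 < r" "r < 1" for r using kap_pos that by force+
  ultimately show ?thesis unfolding radial_C1_def by (auto intro!: continuous_intros)
qed

text \<open>\<open>W\<close> is the power -n of \<open>kap\<close>, so each further factor
  \<open>kap\<close> lowers the coefficient by one. The Hardy inequality uses \<open>k = 1\<close>,
  the Laplacian \<open>k = 2\<close>, the cross term \<open>k = 3\<close> and \<open>k = 4\<close>,
  and the spectral gap \<open>k = 4\<close>.\<close>

lemma radial_C1_Wkap: "radial_C1 (\<lambda>r. W CARD('n) r * kap r ^ k) (\<lambda>r. (real CARD('n) - k) * W CARD('n) r * kap r ^ k * r / kap r)"
proof (induction k)
  case 0 then show ?case using radial_C1_W by simp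
next
  case (Suc k)
  have "radial_C1 (\<lambda>r. W CARD('n) r * kap r ^ Suc k) (\<lambda>r. ((real CARD('n) - k) * W CARD('n) r * kap r ^ k * r / kap r) * kap r + (W CARD('n) r * kap r ^ k) * - r)"
    using radial_C1_mult[OF Suc radial_C1_kap] by (simp add: mult_ac)
  then show ?case
  proof (rule radial_C1_cong)
    fix r :: real assume "0 < r" "r < 1"
    then have "kap r > 0" by (rule kap_pos)
    then show "((real CARD('n) - k) * W CARD('n) r * kap r ^ k * r / kap r) * kap r + (W CARD('n) r * kap r ^ k) * - r =
       (real CARD('n) - Suc k) * W CARD('n) r * kap r ^ Suc k * r / kap r"
      by (simp add: field_simps)
  qed
qed

text \<open>Off \<open>K\<close> the function vanishes, so the integral over the ball extends to the
  whole space and the sign of \<open>W\<close> outside the ball does not matter.\<close>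

lemma hnorm_squared:
  assumes "\<And>x. x \<notin> K \<Longrightarrow> f x = 0"
  shows "(hnorm f)\<^sup>2 = (\<integral>x. W CARD('n) (norm x) * (f x)\<^sup>2 \<partial>lborel)"
proof -
  have eq: "(LINT x : ball 0 1 | lborel. (f x)\<^sup>2 * (2 / (1 - (norm x)\<^sup>2)) ^ CARD('n)) = (\<integral>x. W CARD('n) (norm x) * (f x)\<^sup>2 \<partial>lborel)"
    unfolding set_lebesgue_integral_def
  proof (rule integral_cong_K)
    fix x assume "x \<in> K"
    then have "x \<in> ball 0 1" using K_sub by auto
    then show "indicator (ball 0 1) x *\<^sub>R ((f x)\<^sup>2 * (2 / (1 - (norm x)\<^sup>2)) ^ CARD('n)) = W CARD('n) (norm x) * (f x)\<^sup>2"
      by (simp add: W_def)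
  qed (simp_all add: assms)
  have "0 \<le> (\<integral>x. W CARD('n) (norm x) * (f x)\<^sup>2 \<partial>lborel)"
  proof (rule Bochner_Integration.integral_nonneg)
    fix x show "0 \<le> W CARD('n) (norm x) * (f x)\<^sup>2"
    proof (cases "x \<in> K")
      case True
      then have "x \<in> pball" using K_sub by auto
      then have "0 < W CARD('n) (norm x)" using W_pos norm_pball by blast
      then show ?thesis by simp
    qed (simp add: assms)
  qed
  then show ?thesis by (simp add: hnorm_def eq)
qed

text \<open>The weighted integral of the square of \<open>d_rho f - a * f\<close> is nonnegative.
  Its mixed term contains the radial derivative of \<open>f * f\<close> and is integrated by
  \<open>integral_radial_parts\<close>, which leaves a weight built from \<open>a\<close>, its
  derivative and its square.\<close>

lemma hardy:
  assumes f: "C1c f"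
  shows "(\<integral>x. W CARD('n) (norm x) * ((1 / (4 * (rho (norm x))\<^sup>2) + (real CARD('n) - 1)\<^sup>2 / 4 * (coth_rho (norm x))\<^sup>2
             - (real CARD('n) - 1) / 2 * (kap (norm x) / norm x)\<^sup>2) * (f x)\<^sup>2) \<partial>lborel)
        \<le> (\<integral>x. W CARD('n) (norm x) * (d_rho f x)\<^sup>2 \<partial>lborel)" (is "?L \<le> ?R")
proof -
  define a where "a r = 1 / rho r * (1 / 2) + coth_rho r * (- (real CARD('n) - 1) / 2)" for r
  define a' where "a' r = - 1 / ((rho r)\<^sup>2 * kap r) * (1 / 2) + - kap r / r\<^sup>2 * (- (real CARD('n) - 1) / 2)" for r
  have a: "radial_C1 a a'"
    using radial_C1_add[OF radial_C1_mult[OF radial_C1_inverse_rho radial_C1_const[of "1 / 2"]]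
        radial_C1_mult[OF radial_C1_coth_rho radial_C1_const[of "- (real CARD('n) - 1) / 2"]]]
    unfolding a_def[abs_def] a'_def[abs_def] by simp
  define g where "g r = (W CARD('n) r * kap r ^ 1) * a r" for r
  define g' where "g' r = ((real CARD('n) - 1) * W CARD('n) r * kap r ^ 1 * r / kap r) * a r + (W CARD('n) r * kap r ^ 1) * a' r" for r
  have g: "radial_C1 g g'"
    using radial_C1_mult[OF radial_C1_Wkap[of 1] a] unfolding g_def[abs_def] g'_def[abs_def] by simp
  have ff: "C1c (\<lambda>x. f x * f x)" using C1c_mult[OF C1c_C1[OF f] f] .
  note E = integral_radial_parts[OF ff g]
  let ?E = "\<lambda>x. g (norm x) * d_r (\<lambda>x. f x * f x) x + (g' (norm x) + (real CARD('n) - 1) * g (norm x) / norm x) * (f x * f x)"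
  let ?Lx = "\<lambda>x. W CARD('n) (norm x) * ((1 / (4 * (rho (norm x))\<^sup>2) + (real CARD('n) - 1)\<^sup>2 / 4 * (coth_rho (norm x))\<^sup>2
             - (real CARD('n) - 1) / 2 * (kap (norm x) / norm x)\<^sup>2) * (f x)\<^sup>2)"
  let ?Rx = "\<lambda>x. W CARD('n) (norm x) * (d_rho f x)\<^sup>2"
  let ?Q = "\<lambda>x. W CARD('n) (norm x) * (kap (norm x) * d_r f x - a (norm x) * f x)\<^sup>2"
  have dr: "d_rho f = (\<lambda>x. kap (norm x) * d_r f x)" by (auto simp: d_rho_def kap_def)
  note cont = radial_C1_continuous[OF radial_C1_W] radial_C1_continuous[OF radial_C1_kap]
     radial_C1_continuous[OF a] radial_C1_continuous[OF radial_C1_coth_rho]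
     radial_C1_continuous[OF g]
  have CR: "C0c ?Rx" unfolding dr by (intro C0c_mult C0c_power2 cont C1c_d_r f)
  have CQ: "C0c ?Q" by (intro C0c_mult C0c_power2 C0c_diff cont C1c_d_r C1c_C0c f)
  have pw: "?Q x = ?Rx x - ?E x - ?Lx x" for x
  proof (cases "x \<in> K")
    case True
    then have x: "x \<in> pball" using K_sub by auto
    define r where "r = norm x"
    have r: "0 < r" "r < 1" "0 < kap r" "0 < rho r" using norm_pball[OF x] kap_pos rho_pos by (auto simp: r_def)
    have df: "f differentiable (at x)" using C1c_diff_at[OF f x] .
    \<comment> \<open>The derivative of \<open>W * kap\<close> contributes \<open>r\<close> and the
      Euclidean divergence \<open>kap r / r\<close>, both with the factor n - 1; by
      \<open>coth_rho_eq\<close> they add up to \<open>coth_rho r\<close>.\<close>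
    have ga: "g' r + (real CARD('n) - 1) * g r / r = W CARD('n) r * ((real CARD('n) - 1) * a r * coth_rho r + kap r * a' r)"
      unfolding g'_def g_def coth_rho_eq[OF r(1)] using r by (simp add: field_simps)
    \<comment> \<open>\<open>kap\<close> times the radial derivative is the derivative in the
      distance; that of coth is -1 / sinh^2, which is the source of the negative term in the
      bound.\<close>
    have ka: "kap r * a' r = - 1 / (2 * (rho r)\<^sup>2) + (real CARD('n) - 1) / 2 * (kap r / r)\<^sup>2"
      unfolding a'_def using r by (simp add: field_simps power2_eq_square)
    \<comment> \<open>\<open>a\<close> is chosen so that \<open>a + (n - 1) / 2 * coth_rho\<close>
      equals \<open>1 / (2 * rho)\<close>. Completing the square then leaves no mixed product of
      \<open>1 / rho\<close> and \<open>coth_rho\<close>.\<close>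
    have aa: "(real CARD('n) - 1) * a r * coth_rho r + (a r)\<^sup>2 = 1 / (4 * (rho r)\<^sup>2) - (real CARD('n) - 1)\<^sup>2 / 4 * (coth_rho r)\<^sup>2"
    proof -
      define c where "c = coth_rho r"
      define p where "p = 1 / rho r"
      have "1 / (4 * (rho r)\<^sup>2) = p\<^sup>2 / 4" by (simp add: p_def power_divide)
      moreover have "a r = p / 2 - (real CARD('n) - 1) * c / 2" by (simp add: a_def p_def c_def field_simps)
      moreover have "(N - 1) * (p / 2 - (N - 1) * c / 2) * c + (p / 2 - (N - 1) * c / 2)\<^sup>2
        = p\<^sup>2 / 4 - (N - 1)\<^sup>2 / 4 * c\<^sup>2" for N by (simp add: power2_eq_square field_simps)
      ultimately show ?thesis unfolding c_def[symmetric] by simp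
    qed
    have aa': "(real CARD('n) - 1) * a r * coth_rho r + kap r * a' r = - (1 / (4 * (rho r)\<^sup>2)) - (real CARD('n) - 1)\<^sup>2 / 4 * (coth_rho r)\<^sup>2
       + (real CARD('n) - 1) / 2 * (kap r / r)\<^sup>2 - (a r)\<^sup>2"
      using aa unfolding ka by (simp add: field_simps)
    have E: "?E x = 2 * W CARD('n) r * kap r * a r * f x * d_r f x + W CARD('n) r * (- (1 / (4 * (rho r)\<^sup>2)) - (real CARD('n) - 1)\<^sup>2 / 4 * (coth_rho r)\<^sup>2
       + (real CARD('n) - 1) / 2 * (kap r / r)\<^sup>2 - (a r)\<^sup>2) * (f x)\<^sup>2"
      unfolding d_r_mult[OF df df] r_def[symmetric] ga aa' by (simp add: g_def power2_eq_square algebra_simps)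
    have gen: "w * (k * d - b * f)\<^sup>2 = w * (k * d)\<^sup>2 - (2 * w * k * b * f * d + w * (- A - B + C - b\<^sup>2) * f\<^sup>2)
        - w * ((A + B - C) * f\<^sup>2)" for w k d b f A B C :: real
      by (simp add: power2_eq_square algebra_simps)
    show ?thesis unfolding E unfolding dr r_def[symmetric] by (rule gen)
  next
    case False
    have "d_r (\<lambda>x. f x * f x) x = 0" using C1c_d_r_zero[OF ff False] .
    moreover have "f x = 0" "d_rho f x = 0" "d_r f x = 0"
      using C1c_zero[OF f False] C1c_d_r_zero[OF f False] by (simp_all add: dr)
    ultimately show ?thesis by (simp only:) simp
  qed
  have E_int: "integrable lborel ?E"
  proof (rule C0c_integrable, intro C0c_add)
    show "C0c (\<lambda>x. g (norm x) * d_r (\<lambda>x. f x * f x) x)" by (intro C0c_mult cont C1c_d_r ff)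
    have "continuous_on pball (\<lambda>x. g' (norm x))"
      by (rule radial_C1_continuous'[OF g])
    then show "C0c (\<lambda>x. (g' (norm x) + (real CARD('n) - 1) * g (norm x) / norm x) * (f x * f x))"
      by (intro C0c_mult C1c_C0c ff continuous_intros cont) auto
  qed
  have Lx: "?Lx = (\<lambda>x. ?Rx x - ?E x - ?Q x)" using pw by (auto simp: fun_eq_iff)
  have "?L = ?R - (\<integral>x. ?E x \<partial>lborel) - (\<integral>x. ?Q x \<partial>lborel)"
    unfolding Lx using C0c_integrable[OF CR] C0c_integrable[OF CQ] E_int by simp
  moreover have "0 \<le> (\<integral>x. ?Q x \<partial>lborel)"
  proof (rule Bochner_Integration.integral_nonneg)
    fix x show "0 \<le> ?Q x"
    proof (cases "x \<in> K")
      case True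
      then have "x \<in> pball" using K_sub by auto
      then have "0 < W CARD('n) (norm x)" using W_pos norm_pball by blast
      then show ?thesis by simp
    qed (simp add: C1c_zero[OF f] C1c_d_r_zero[OF f])
  qed
  ultimately show ?thesis using E by simp
qed

end

section \<open>The cross term\<close>

lemma C1_on_unit_coord: "C1_on pball (\<lambda>x. x $ i / norm x)"
  using C1_on_mult[OF radial_C1_on[OF radial_C1_inverse] C1_on_coord[of _ i]] by simp

lemma pd_unit_coord:
  fixes x :: "real^'n"
  assumes "x \<in> pball"
  shows "pd j (\<lambda>x. x $ i / norm x) x = ((if i = j then 1 else 0) - x $ i * x $ j / (norm x)\<^sup>2) / norm x"
proof -
  have "pd j (\<lambda>x. x $ i / norm x) x
      = - 1 / (norm x)\<^sup>2 / norm x * (x $ i * x $ j) + (if i = j then 1 / norm x else 0)"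
    using pd_radial_coord[OF radial_C1_inverse assms, of j i] by simp
  then show ?thesis by (simp add: diff_divide_distrib)
qed

section \<open>Radial and tangential derivatives of a C2 function\<close>

locale punctured_C2 = punctured_support K for K :: "(real^'n::finite) set" +
  fixes u :: "real^'n \<Rightarrow> real"
  assumes C1u: "C1c u" and C1pdu: "C1c (pd i u)"
begin

definition "ur = d_r u"
definition "w j x = pd j u x - x $ j / norm x * ur x"

lemma pdpd_commute: "pd j (pd i u) x = pd i (pd j u) x"
  by (rule pd_commute; use C1c_global[OF C1u] C1c_global[OF C1pdu] in \<open>auto simp: C1_on_def\<close>)

lemma C1ur: "C1c ur"
  unfolding ur_def d_r_def[abs_def] by (intro C1c_sum C1c_mult C1_on_unit_coord C1pdu) auto

lemma w_tangential: "(\<Sum>j\<in>UNIV. x $ j * w j x) = 0"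
proof (cases "x = 0")
  case False
  then have r: "norm x > 0" by simp
  have "(\<Sum>j\<in>UNIV. x $ j * w j x) = (\<Sum>j\<in>UNIV. x $ j * pd j u x) - (\<Sum>j\<in>UNIV. x $ j * x $ j) * (ur x / norm x)"
    by (simp add: w_def algebra_simps sum_subtractf sum_distrib_left sum_distrib_right)
  also have "\<dots> = 0" using r unfolding norm_sum_squares ur_def d_r_eq by (simp add: power2_eq_square)
  finally show ?thesis .
qed simp

sublocale tangential_field K w
proof
  show "C1c (w j)" for j unfolding w_def[abs_def] by (intro C1c_diff C1pdu C1c_mult C1_on_unit_coord C1ur)
qed (rule w_tangential)

lemma ur_diff: "x \<in> pball \<Longrightarrow> ur differentiable (at x)" using C1c_diff_at[OF C1ur] .
lemma w_diff: "x \<in> pball \<Longrightarrow> w j differentiable (at x)" using C1c_diff_at[OF C1w] .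
lemma unit_diff: "x \<in> pball \<Longrightarrow> (\<lambda>x. x $ i / norm x) differentiable (at x)"
  using C1_on_D(1)[OF C1_on_unit_coord] .

lemma pd_w:
  assumes x: "x \<in> pball"
  shows "pd i (w j) x = pd i (pd j u) x - (((if j = i then 1 else 0) - x $ j * x $ i / (norm x)\<^sup>2) / norm x * ur x
            + x $ j / norm x * pd i ur x)"
  unfolding w_def[abs_def]
  by (subst pd_diff[OF C1c_diff_at[OF C1pdu x] differentiable_mult[OF unit_diff[OF x] ur_diff[OF x]]],
      subst pd_mult[OF unit_diff[OF x] ur_diff[OF x]], subst pd_unit_coord[OF x]) simp

lemma unit_coord_sum:
  assumes x: "x \<in> pball"
  shows "(\<Sum>k\<in>UNIV. x $ k * ((if j = k then 1 else 0) - x $ j * x $ k / (norm x)\<^sup>2)) = 0"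
proof -
  have "(\<Sum>k\<in>UNIV. x $ k * ((if j = k then 1 else 0) - x $ j * x $ k / (norm x)\<^sup>2)) =
    (\<Sum>k\<in>UNIV. (if j = k then x $ k else 0)) - x $ j / (norm x)\<^sup>2 * (\<Sum>k\<in>UNIV. x $ k * x $ k)"
    unfolding sum_distrib_left sum_subtractf[symmetric] by (intro sum.cong) (auto simp: algebra_simps)
  then show ?thesis using x unfolding norm_sum_squares by simp
qed

text \<open>The coordinates \<open>x $ j / norm x\<close> are constant along rays, so the radial
  derivative falls on \<open>pd j u\<close> and \<open>ur\<close> alone;
  \<open>unit_coord_sum\<close> expresses this constancy.\<close>

lemma d_r_w:
  assumes x: "x \<in> pball"
  shows "d_r (w j) x = d_r (pd j u) x - x $ j / norm x * d_r ur x"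
proof -
  let ?\<delta> = "\<lambda>k. (if j = k then 1 else 0) - x $ j * x $ k / (norm x)\<^sup>2"
  have "d_r (w j) x = d_r (pd j u) x - (\<Sum>k\<in>UNIV. x $ k * ?\<delta> k) * (ur x / (norm x)\<^sup>2) - x $ j / norm x * d_r ur x"
  proof -
    have gen: "a / r * (U - (D / r * ur + b / r * Z)) = a / r * U - a * D * (ur / r\<^sup>2) - b / r * (a / r * Z)"
      for a r U D ur b Z :: real by (simp add: power2_eq_square algebra_simps)
    show ?thesis
      unfolding d_r_def pd_w[OF x] sum_distrib_left sum_distrib_right sum_subtractf[symmetric]
      by (intro sum.cong refl gen)
  qed
  then show ?thesis unfolding unit_coord_sum[OF x] by simp
qed

text \<open>The gradient of \<open>ur\<close> split into tangential and radial parts. The term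
  \<open>w j x / norm x\<close> is the commutator of radial and tangential differentiation; the
  second derivatives themselves are exchanged by \<open>pdpd_commute\<close>.\<close>

lemma pd_ur:
  assumes x: "x \<in> pball"
  shows "pd j ur x = d_r (w j) x + w j x / norm x + x $ j / norm x * d_r ur x"
proof -
  let ?\<delta> = "\<lambda>k. (if k = j then 1 else 0) - x $ k * x $ j / (norm x)\<^sup>2"
  have r: "norm x > 0" using x by simp
  have "pd j ur x = (\<Sum>k\<in>UNIV. pd j (\<lambda>x. x $ k / norm x * pd k u x) x)"
    unfolding ur_def d_r_def[abs_def]
    by (intro pd_sum differentiable_mult unit_diff x C1c_diff_at[OF C1pdu]) auto
  also have "\<dots> = (\<Sum>k\<in>UNIV. x $ k / norm x * pd k (pd j u) x + ?\<delta> k / norm x * pd k u x)"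
    by (simp only: pd_mult[OF unit_diff[OF x] C1c_diff_at[OF C1pdu x]] pd_unit_coord[OF x] pdpd_commute[of j])
  also have "\<dots> = d_r (pd j u) x + (\<Sum>k\<in>UNIV. ?\<delta> k * pd k u x) / norm x"
    by (simp add: d_r_def sum.distrib sum_divide_distrib)
  also have "(\<Sum>k\<in>UNIV. ?\<delta> k * pd k u x) = (\<Sum>k\<in>UNIV. (if k = j then pd k u x else 0)) -
     x $ j / (norm x)\<^sup>2 * (\<Sum>k\<in>UNIV. x $ k * pd k u x)"
    unfolding sum_distrib_left sum_subtractf[symmetric] by (intro sum.cong) (auto simp: algebra_simps)
  also have "\<dots> = w j x" using r by (simp add: w_def ur_def d_r_eq power2_eq_square)
  finally show ?thesis unfolding d_r_w[OF x] by simp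
qed

lemma d_r_w_orth:
  assumes x: "x \<in> pball"
  shows "(\<Sum>j\<in>UNIV. x $ j * d_r (w j) x) = 0"
proof -
  have "(\<Sum>j\<in>UNIV. x $ j * d_r (w j) x) = (\<Sum>j\<in>UNIV. \<Sum>i\<in>UNIV. x $ i * x $ j * pd i (w j) x) / norm x"
    by (simp add: d_r_eq sum_distrib_left sum_divide_distrib algebra_simps)
  also have "\<dots> = 0" using tang_pd2[OF x] by (subst sum.swap) simp
  finally show ?thesis .
qed

definition "drw_sq x = (\<Sum>j\<in>UNIV. (d_r (w j) x)\<^sup>2)"
definition "w_drw x = (\<Sum>j\<in>UNIV. w j x * d_r (w j) x)"
definition "w_sq x = (\<Sum>j\<in>UNIV. (w j x)\<^sup>2)"

lemma sum_pd_ur_w: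
  assumes x: "x \<in> pball"
  shows "(\<Sum>j\<in>UNIV. w j x * pd j ur x) = w_drw x + w_sq x / norm x"
proof -
  have "(\<Sum>j\<in>UNIV. w j x * pd j ur x) = w_drw x + w_sq x / norm x + (\<Sum>j\<in>UNIV. x $ j * w j x) * (d_r ur x / norm x)"
    unfolding pd_ur[OF x] w_drw_def w_sq_def sum_divide_distrib sum_distrib_right sum.distrib[symmetric]
    by (intro sum.cong refl) (simp add: algebra_simps power2_eq_square)
  then show ?thesis by (simp add: tang)
qed

lemma sum_pd_ur_d_r_w:
  assumes x: "x \<in> pball"
  shows "(\<Sum>j\<in>UNIV. pd j ur x * d_r (w j) x) = drw_sq x + w_drw x / norm x"
proof -
  have "(\<Sum>j\<in>UNIV. pd j ur x * d_r (w j) x) = drw_sq x + w_drw x / norm x + (\<Sum>j\<in>UNIV. x $ j * d_r (w j) x) * (d_r ur x / norm x)"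
    unfolding pd_ur[OF x] drw_sq_def w_drw_def sum_divide_distrib sum_distrib_right sum.distrib[symmetric]
    by (intro sum.cong refl) (simp add: algebra_simps power2_eq_square)
  then show ?thesis by (simp add: d_r_w_orth[OF x])
qed

lemma laplace_split:
  assumes x: "x \<in> pball"
  shows "(\<Sum>i\<in>UNIV. pd i (pd i u) x) = dw x + d_r ur x + (real CARD('n) - 1) / norm x * ur x"
proof -
  have r: "norm x > 0" using x by simp
  have "pd i (pd i u) x = pd i (w i) x + ((1 - x $ i * x $ i / (norm x)\<^sup>2) / norm x * ur x + x $ i / norm x * pd i ur x)" for i
    using pd_w[OF x, of i i] by simp
  then have "(\<Sum>i\<in>UNIV. pd i (pd i u) x) = dw x + (\<Sum>i\<in>UNIV. 1 - x $ i * x $ i / (norm x)\<^sup>2) * (ur x / norm x) + d_r ur x"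
    unfolding d_r_def dw_def sum_distrib_right sum.distrib[symmetric] by (intro sum.cong refl) simp
  also have "(\<Sum>i\<in>UNIV. 1 - x $ i * x $ i / (norm x)\<^sup>2) = real CARD('n) - 1"
    using r by (simp add: sum_subtractf sum_divide_distrib[symmetric] norm_sum_squares)
  finally show ?thesis by simp
qed

text \<open>The first-order term is the derivative of \<open>W * kap\<^sup>2\<close>, a power of
  \<open>kap\<close> with exponent 2 - n; it reflects the conformal change of the Laplacian.\<close>

lemma lap_H_eq:
  assumes x: "x \<in> pball"
  shows "lap_H u x = (kap (norm x))\<^sup>2 * (\<Sum>i\<in>UNIV. pd i (pd i u) x) + (real CARD('n) - 2) * kap (norm x) * norm x * ur x"
proof -
  let ?r = "norm x"
  have k: "kap ?r > 0" using kap_norm_pos[OF x] .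
  let ?g = "\<lambda>r. W CARD('n) r * kap r ^ 2" and ?g' = "\<lambda>r. (real CARD('n) - 2) * W CARD('n) r * kap r ^ 2 * r / kap r"
  have g: "radial_C1 ?g ?g'" using radial_C1_Wkap[of 2] by simp
  have gd: "(\<lambda>x. ?g (norm x)) differentiable (at x)" using C1_on_D(1)[OF radial_C1_on[OF g] x] .
  have Wk: "kap ?r ^ CARD('n) * W CARD('n) ?r = 1"
    using k by (simp add: W_eq power_one_over)
  have "lap_H u x = kap ?r ^ CARD('n) * (\<Sum>i\<in>UNIV. pd i (\<lambda>y. ?g (norm y) * pd i u y) x)"
    by (simp add: lap_H_def kap_def W_def)
  also have "(\<Sum>i\<in>UNIV. pd i (\<lambda>y. ?g (norm y) * pd i u y) x) =
     (\<Sum>i\<in>UNIV. ?g ?r * pd i (pd i u) x + ?g' ?r * (x $ i / ?r * pd i u x))"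
    unfolding pd_mult[OF gd C1c_diff_at[OF C1pdu x]] radial_pd[OF g x] by (simp only: mult.assoc)
  also have "\<dots> = ?g ?r * (\<Sum>i\<in>UNIV. pd i (pd i u) x) + ?g' ?r * ur x"
    unfolding ur_def d_r_def by (simp only: sum.distrib sum_distrib_left)
  also have "kap ?r ^ CARD('n) * \<dots> = (kap ?r ^ CARD('n) * W CARD('n) ?r) *
     ((kap ?r)\<^sup>2 * (\<Sum>i\<in>UNIV. pd i (pd i u) x) + (real CARD('n) - 2) * kap ?r * ?r * ur x)"
  proof -
    have "K * (Wt * k ^ 2 * S + n * Wt * k ^ 2 * r / k * ur) = K * Wt * (k\<^sup>2 * S + n * k * r * ur)"
      if "k > 0" for K Wt k S n r ur :: real using that by (simp add: power2_eq_square algebra_simps)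
    from this[OF k] show ?thesis .
  qed
  finally show ?thesis unfolding Wk by simp
qed

lemma d_rho_eq: "d_rho f = (\<lambda>x. kap (norm x) * d_r f x)" by (auto simp: d_rho_def kap_def)

lemma lap_rho_eq:
  assumes x: "x \<in> pball"
  shows "lap_rho u x = (kap (norm x))\<^sup>2 * d_r ur x - kap (norm x) * norm x * ur x
     + (real CARD('n) - 1) * coth_rho (norm x) * (kap (norm x) * ur x)"
proof -
  have "d_rho (d_rho u) x = kap (norm x) * (kap (norm x) * d_r ur x - norm x * ur x)"
    unfolding d_rho_eq ur_def[symmetric] d_r_radial_mult[OF radial_C1_kap x ur_diff[OF x]] by simp
  then show ?thesis unfolding lap_rho_def coth_hrho[OF x]
    by (simp add: d_rho_eq ur_def power2_eq_square algebra_simps)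
qed

text \<open>The terms in \<open>d_r ur\<close> agree, and those in \<open>ur\<close> cancel:
  \<open>(n - 1) * kap\<^sup>2 / r + (n - 2) * kap * r\<close> equals
  \<open>(n - 1) * coth_rho * kap - kap * r\<close> by \<open>coth_rho_eq\<close>.\<close>

lemma lap_diff_eq:
  assumes x: "x \<in> pball"
  shows "lap_H u x - lap_rho u x = (kap (norm x))\<^sup>2 * dw x"
proof -
  have r: "norm x > 0" using x by simp
  define q where "q = kap (norm x) / norm x"
  have k: "kap (norm x) = q * norm x" using r by (simp add: q_def)
  have c: "coth_rho (norm x) = norm x + q" using coth_rho_eq[OF r] by (simp add: q_def)
  have "(kap (norm x))\<^sup>2 * ((real CARD('n) - 1) / norm x * ur x) = (real CARD('n) - 1) * q * kap (norm x) * ur x"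
    using r by (simp add: q_def power2_eq_square)
  then show ?thesis unfolding lap_H_eq[OF x] lap_rho_eq[OF x] laplace_split[OF x] c
    by (simp add: distrib_left) (simp add: algebra_simps)
qed

lemma Lj_eq: "Lj j u = (\<lambda>x. kap (norm x) * w j x)"
  by (auto simp: Lj_def kap_def w_def ur_def)

lemma d_rho_Lj:
  assumes x: "x \<in> pball"
  shows "d_rho (Lj j u) x = kap (norm x) * (kap (norm x) * d_r (w j) x - norm x * w j x)"
  unfolding d_rho_eq Lj_eq d_r_radial_mult[OF radial_C1_kap x w_diff[OF x]] by simp

lemma C1c_Lj: "C1c (Lj j u)"
  unfolding Lj_eq by (intro C1c_mult radial_C1_on[OF radial_C1_kap] C1w)

lemma lap_rho_zero: "x \<notin> K \<Longrightarrow> lap_rho u x = 0"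
  using d_r_zero[of "d_rho u" x] C1c_d_r_zero[OF C1u]
  by (simp add: lap_rho_def d_rho_eq)

lemma lap_H_zero: "x \<notin> K \<Longrightarrow> lap_H u x = 0"
proof -
  assume x: "x \<notin> K"
  have "pd i (\<lambda>y. c y * pd i u y) x = 0" for i and c :: "real^'n \<Rightarrow> real"
    by (rule pd_zero_K[OF _ x]) (simp add: C1c_zero[OF C1pdu])
  then show ?thesis by (simp add: lap_H_def)
qed

lemma sum_d_rho_Lj:
  assumes x: "x \<in> pball"
  shows "(\<Sum>j\<in>UNIV. (d_rho (Lj j u) x)\<^sup>2)
    = (kap (norm x))\<^sup>2 * ((kap (norm x))\<^sup>2 * drw_sq x - 2 * kap (norm x) * norm x * w_drw x + (norm x)\<^sup>2 * w_sq x)"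
  unfolding d_rho_Lj[OF x] drw_sq_def w_drw_def w_sq_def
  by (simp add: power2_eq_square algebra_simps sum.distrib sum_subtractf sum_distrib_left)

lemma sum_Lj: "(\<Sum>j\<in>UNIV. (Lj j u x)\<^sup>2) = (kap (norm x))\<^sup>2 * w_sq x"
  by (simp add: Lj_eq w_sq_def sum_distrib_left power_mult_distrib)

lemma C0c_w_sums: "C0c drw_sq" "C0c w_drw" "C0c w_sq"
  unfolding drw_sq_def[abs_def] w_drw_def[abs_def] w_sq_def[abs_def]
  by (intro C0c_sum C0c_power2 C0c_mult2 C1c_d_r C1w C1c_C0c)+

lemma w_sums_zero: "x \<notin> K \<Longrightarrow> drw_sq x = 0" "x \<notin> K \<Longrightarrow> w_drw x = 0" "x \<notin> K \<Longrightarrow> w_sq x = 0"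
  using C0c_w_sums C0c_zero by blast+

lemma C0c_cong:
  assumes "C0c f" "\<And>x. x \<in> K \<Longrightarrow> g x = f x" "\<And>x. x \<notin> K \<Longrightarrow> g x = 0"
  shows "C0c g"
proof -
  have "g = f" using assms C0c_zero by (metis ext)
  then show ?thesis using assms by simp
qed

lemmas rcont = radial_C1_continuous[OF radial_C1_W] radial_C1_continuous[OF radial_C1_kap]
     radial_C1_continuous[OF radial_C1_coth_rho] radial_C1_continuous[OF radial_C1_inverse_rho]
     radial_C1_continuous[OF radial_C1_id]

lemma C0c_lap_rho: "C0c (lap_rho u)"
proof (rule C0c_cong)
  show "C0c (\<lambda>x. (kap (norm x))\<^sup>2 * d_r ur x - kap (norm x) * norm x * ur x
     + (real CARD('n) - 1) * coth_rho (norm x) * (kap (norm x) * ur x))"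
    by (intro C0c_add C0c_diff C0c_mult continuous_intros rcont C1c_d_r C1ur C1c_C0c)
  show "lap_rho u x = (kap (norm x))\<^sup>2 * d_r ur x - kap (norm x) * norm x * ur x
     + (real CARD('n) - 1) * coth_rho (norm x) * (kap (norm x) * ur x)" if "x \<in> K" for x
    using lap_rho_eq K_sub that by blast
qed (rule lap_rho_zero)

lemma C0c_lap_diff: "C0c (\<lambda>x. (kap (norm x))\<^sup>2 * dw x)"
  by (intro C0c_mult continuous_intros rcont C0c_dw)

text \<open>The function \<open>(W r * kap r ^ 3) * (kap r / r + 2 * r)\<close> is what remains of the coefficient of
  \<open>ur x * dw x\<close> after the second radial derivative has been exchanged with the tangential one.\<close>

lemma cross_term:
  "(\<integral>x. W CARD('n) (norm x) * (lap_rho u x * ((kap (norm x))\<^sup>2 * dw x) - (\<Sum>j\<in>UNIV. (d_rho (Lj j u) x)\<^sup>2)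
       + (coth_rho (norm x))\<^sup>2 * (\<Sum>j\<in>UNIV. (Lj j u x)\<^sup>2)) \<partial>lborel) = 0" (is "?I = 0")
proof -
  let ?g = "\<lambda>r. W CARD('n) r * kap r ^ 4" and ?g' = "\<lambda>r. (real CARD('n) - 4) * W CARD('n) r * kap r ^ 4 * r / kap r"
  have g: "radial_C1 ?g ?g'" using radial_C1_Wkap[of 4] by simp
  define h where "h r = (W CARD('n) r * kap r ^ 3) * (kap r * (1 / r) + 2 * r)" for r
  obtain h' where h: "radial_C1 h h'"
    unfolding h_def using radial_C1_mult[OF radial_C1_Wkap[of 3] radial_C1_add[OF radial_C1_mult[OF radial_C1_kap
      radial_C1_inverse] radial_C1_mult[OF radial_C1_const[of 2] radial_C1_id]]] by blast
  let ?E3 = "\<lambda>x. ?g (norm x) * (d_r ur x * dw x - (\<Sum>j\<in>UNIV. pd j ur x * d_r (w j) x))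
            + ur x * dw x * (?g' (norm x) + (real CARD('n) - 2) * ?g (norm x) / norm x)"
  let ?E2 = "\<lambda>x. h (norm x) * (ur x * dw x + (\<Sum>j\<in>UNIV. w j x * pd j ur x))"
  have "?I = (\<integral>x. ?E3 x + ?E2 x \<partial>lborel)"
  proof (rule integral_cong_K)
    fix x assume "x \<in> K"
    then have x: "x \<in> pball" using K_sub by auto
    define r where "r = norm x"
    \<comment> \<open>With \<open>q\<close>, the value 1 / sinh, both \<open>kap r = q * r\<close>
      and \<open>coth_rho r = r + q\<close> are polynomial. The pointwise claim becomes a polynomial
      identity modulo \<open>p * r = 1\<close>, where \<open>p\<close> stands for
      \<open>1 / r\<close>.\<close>
    define q where "q = kap r / r"
    have r: "r > 0" using x by (simp add: r_def)
    have k0: "kap r > 0" using kap_norm_pos[OF x] by (simp add: r_def)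
    have k: "kap r = q * r" using r by (simp add: q_def)
    have c: "coth_rho r = r + q" using coth_rho_eq[OF r] by (simp add: q_def)
    \<comment> \<open>In units of \<open>W * kap ^ 3\<close>, the product of
      \<open>lap_rho u\<close> with \<open>kap\<^sup>2 * dw\<close> has the coefficient
      \<open>(n - 2) * r + (n - 1) * q\<close> for \<open>ur * dw\<close>. Subtracting the
      coefficient found here leaves \<open>q + 2 * r\<close>, the factor in
      \<open>h\<close>.\<close>
    have e: "?g' r + (real CARD('n) - 2) * ?g r / r = W CARD('n) r * (kap r ^ 3) * ((real CARD('n) - 4) * r + (real CARD('n) - 2) * q)"
    proof -
      have "?g' r = W CARD('n) r * (kap r ^ 3) * ((real CARD('n) - 4) * r)"
        using k0 by (simp add: power4_eq_xxxx power3_eq_cube)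
      moreover have "(real CARD('n) - 2) * ?g r / r = W CARD('n) r * (kap r ^ 3) * ((real CARD('n) - 2) * q)"
        by (simp add: power4_eq_xxxx power3_eq_cube q_def)
      ultimately show ?thesis by (simp only: distrib_left)
    qed
    have h: "h r = W CARD('n) r * kap r ^ 3 * (q + 2 * r)" by (simp add: h_def q_def)
    have gen: "wt * ((k\<^sup>2 * zr - k * r * ur + (n - 1) * (r + q) * (k * ur)) * (k\<^sup>2 * d) - k\<^sup>2 * (k\<^sup>2 * a - 2 * k * r * b + r\<^sup>2 * c)
          + (r + q)\<^sup>2 * (k\<^sup>2 * c))
      = wt * k ^ 4 * (zr * d - (a + b / r)) + ur * d * (wt * k ^ 3 * ((n - 4) * r + (n - 2) * q)) + wt * k ^ 3 * (q + 2 * r) * (ur * d + (b + c / r))"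
      if "r > 0" "k = q * r" for wt k zr r ur n q d a b c :: real
    proof -
      define p where "p = 1 / r"
      have pr: "p * r = 1" using that by (simp add: p_def)
      have bc: "b / r = p * b" "c / r = p * c" by (simp_all add: p_def)
      show ?thesis unfolding bc that(2) using pr by algebra
    qed
    show "W CARD('n) (norm x) * (lap_rho u x * ((kap (norm x))\<^sup>2 * dw x) - (\<Sum>j\<in>UNIV. (d_rho (Lj j u) x)\<^sup>2)
       + (coth_rho (norm x))\<^sup>2 * (\<Sum>j\<in>UNIV. (Lj j u x)\<^sup>2)) = ?E3 x + ?E2 x"
      unfolding sum_pd_ur_w[OF x] sum_pd_ur_d_r_w[OF x] sum_d_rho_Lj[OF x] sum_Lj lap_rho_eq[OF x]
      unfolding r_def[symmetric] e h c
      by (rule gen[OF r k])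
  next
    fix x assume "x \<notin> K"
    then show "W CARD('n) (norm x) * (lap_rho u x * ((kap (norm x))\<^sup>2 * dw x) - (\<Sum>j\<in>UNIV. (d_rho (Lj j u) x)\<^sup>2)
       + (coth_rho (norm x))\<^sup>2 * (\<Sum>j\<in>UNIV. (Lj j u x)\<^sup>2)) = 0"
      using C1c_zero[OF C1c_Lj] C1c_d_r_zero[OF C1c_Lj] by (simp add: dw_zero d_rho_eq)
  qed (simp add: dw_zero C1c_pd_zero[OF C1ur] C1c_zero[OF C1w])
  also have "\<dots> = (\<integral>x. ?E3 x \<partial>lborel) + (\<integral>x. ?E2 x \<partial>lborel)"
  proof (rule Bochner_Integration.integral_add; rule C0c_integrable)
    have "continuous_on pball (\<lambda>x. ?g' (norm x) + (real CARD('n) - 2) * ?g (norm x) / norm x)"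
      by (rule continuous_on_add[OF radial_C1_continuous'[OF g] continuous_on_divide[OF
            continuous_on_mult[OF continuous_on_const radial_C1_continuous[OF g]] continuous_on_norm_id]]) auto
    then show "C0c ?E3"
      by (intro C0c_add C0c_mult C0c_mult_right C0c_diff C0c_mult2 C0c_sum radial_C1_continuous[OF g]
            C1c_d_r C1ur C0c_dw C1c_pd C1w C1c_C0c)
    show "C0c ?E2"
      by (intro C0c_add C0c_mult C0c_mult2 C0c_sum radial_C1_continuous[OF h] C1ur C0c_dw C1c_pd C1w C1c_C0c)
  qed
  also have "\<dots> = 0"
    using integral_radial_swap[OF C1ur g] integral_tangential_parts[OF C1c_C1[OF C1ur] h] by simp
  finally show ?thesis .
qed

end

section \<open>Spectral gap in dimension at least three\<close>

text \<open>Here \<open>N\<close> is the Jacobian of the tangential gradient in the frame with radial direction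
  \<open>y\<close>, and \<open>M\<close> is the spherical Hessian, that is \<open>N\<close> without its radial row and column.\<close>

lemma trace_square_bound:
  fixes N :: "'n::finite \<Rightarrow> 'n \<Rightarrow> real" and y v D :: "'n \<Rightarrow> real"
  assumes y: "(\<Sum>i\<in>UNIV. y i * y i) = 1" and yv: "(\<Sum>i\<in>UNIV. y i * v i) = 0" and yD: "(\<Sum>i\<in>UNIV. y i * D i) = 0"
    and Nr: "\<And>i. (\<Sum>j\<in>UNIV. y j * N i j) = - v i" and Nl: "\<And>j. (\<Sum>i\<in>UNIV. y i * N i j) = D j"
    and sym: "\<And>i j. N i j + v i * y j - y i * D j = N j i + v j * y i - y j * D i"
    and n: "CARD('n) \<ge> 2"
  shows "(\<Sum>i\<in>UNIV. N i i)\<^sup>2 / (real CARD('n) - 1) - 2 * (\<Sum>i\<in>UNIV. v i * D i)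
    \<le> (\<Sum>i\<in>UNIV. \<Sum>j\<in>UNIV. N i j * N j i)"
proof -
  define M where "M i j = N i j + v i * y j - y i * D j" for i j
  define b where "b = (\<Sum>i\<in>UNIV. v i * D i)"
  define \<tau> where "\<tau> = (\<Sum>i\<in>UNIV. N i i)"
  \<comment> \<open>The orthogonal projection onto the tangent space. Its rank n - 1, computed in
    \<open>PP\<close>, is the denominator of the trace bound.\<close>
  define P where "P i j = (if i = j then 1 else 0) - y i * y j" for i j
  have sM: "M i j = M j i" for i j using sym by (simp add: M_def)
  have 1: "(\<Sum>i\<in>UNIV. \<Sum>j\<in>UNIV. N i j * (v j * y i)) = b"
  proof -
    have "(\<Sum>i\<in>UNIV. \<Sum>j\<in>UNIV. N i j * (v j * y i)) = (\<Sum>j\<in>UNIV. v j * (\<Sum>i\<in>UNIV. y i * N i j))"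
      by (subst sum.swap) (simp add: sum_distrib_left mult_ac)
    then show ?thesis by (simp add: Nl b_def)
  qed
  have 2: "(\<Sum>i\<in>UNIV. \<Sum>j\<in>UNIV. N i j * (y j * D i)) = - b"
  proof -
    have "(\<Sum>i\<in>UNIV. \<Sum>j\<in>UNIV. N i j * (y j * D i)) = (\<Sum>i\<in>UNIV. D i * (\<Sum>j\<in>UNIV. y j * N i j))"
      by (simp add: sum_distrib_left mult_ac)
    then show ?thesis by (simp add: Nr b_def sum_negf mult.commute)
  qed
  have 3: "(\<Sum>i\<in>UNIV. \<Sum>j\<in>UNIV. (v i * y j) * N j i) = b"
    using 1 by (subst sum.swap) (simp add: mult_ac)
  have 4: "(\<Sum>i\<in>UNIV. \<Sum>j\<in>UNIV. (y i * D j) * N j i) = - b"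
    using 2 by (subst sum.swap) (simp add: mult_ac)
  have 5: "(\<Sum>i\<in>UNIV. \<Sum>j\<in>UNIV. (v i * y j) * (v j * y i)) = 0"
  proof -
    have "(\<Sum>i\<in>UNIV. \<Sum>j\<in>UNIV. (v i * y j) * (v j * y i)) = (\<Sum>i\<in>UNIV. y i * v i) * (\<Sum>j\<in>UNIV. y j * v j)"
      by (simp add: sum_product mult_ac)
    then show ?thesis by (simp add: yv)
  qed
  have 6: "(\<Sum>i\<in>UNIV. \<Sum>j\<in>UNIV. (v i * y j) * (y j * D i)) = b"
  proof -
    have "(\<Sum>i\<in>UNIV. \<Sum>j\<in>UNIV. (v i * y j) * (y j * D i)) = (\<Sum>i\<in>UNIV. v i * D i) * (\<Sum>j\<in>UNIV. y j * y j)"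
      by (simp add: sum_product mult_ac)
    then show ?thesis by (simp add: y b_def)
  qed
  have 7: "(\<Sum>i\<in>UNIV. \<Sum>j\<in>UNIV. (y i * D j) * (v j * y i)) = b"
    using 6 by (subst sum.swap) (simp add: mult_ac)
  have 8: "(\<Sum>i\<in>UNIV. \<Sum>j\<in>UNIV. (y i * D j) * (y j * D i)) = 0"
  proof -
    have "(\<Sum>i\<in>UNIV. \<Sum>j\<in>UNIV. (y i * D j) * (y j * D i)) = (\<Sum>i\<in>UNIV. y i * D i) * (\<Sum>j\<in>UNIV. y j * D j)"
      by (simp add: sum_product mult_ac)
    then show ?thesis by (simp add: yD)
  qed
  \<comment> \<open>By symmetry of \<open>M\<close> one factor may be transposed, so that the
    expansion produces the products \<open>N i j * N j i\<close>. The mixed sums collapse because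
    \<open>y\<close>, \<open>v\<close> and \<open>D\<close> are contracted with each other or with a
    side of \<open>N\<close>.\<close>
  have MM: "(\<Sum>i\<in>UNIV. \<Sum>j\<in>UNIV. M i j * M i j) = (\<Sum>i\<in>UNIV. \<Sum>j\<in>UNIV. N i j * N j i) + 2 * b"
  proof -
    have "(\<Sum>i\<in>UNIV. \<Sum>j\<in>UNIV. M i j * M i j) = (\<Sum>i\<in>UNIV. \<Sum>j\<in>UNIV. M i j * M j i)" by (simp only: sM[symmetric])
    also have "\<dots> = (\<Sum>i\<in>UNIV. \<Sum>j\<in>UNIV. N i j * N j i + N i j * (v j * y i) - N i j * (y j * D i)
       + (v i * y j) * N j i + (v i * y j) * (v j * y i) - (v i * y j) * (y j * D i)
       - (y i * D j) * N j i - (y i * D j) * (v j * y i) + (y i * D j) * (y j * D i))"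
      by (intro sum.cong refl) (simp add: M_def algebra_simps)
    also have "\<dots> = (\<Sum>i\<in>UNIV. \<Sum>j\<in>UNIV. N i j * N j i) + b - (- b) + b + 0 - b - (- b) - b + 0"
      by (simp only: sum.distrib sum_subtractf 1 2 3 4 5 6 7 8)
    finally show ?thesis by simp
  qed
  have My: "(\<Sum>j\<in>UNIV. M i j * y j) = 0" for i
  proof -
    have "(\<Sum>j\<in>UNIV. M i j * y j) = (\<Sum>j\<in>UNIV. y j * N i j) + v i * (\<Sum>j\<in>UNIV. y j * y j) - y i * (\<Sum>j\<in>UNIV. y j * D j)"
      unfolding M_def sum_distrib_left sum.distrib[symmetric] sum_subtractf[symmetric]
      by (intro sum.cong refl) (simp add: algebra_simps)
    then show ?thesis by (simp add: Nr y yD)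
  qed
  have MP: "(\<Sum>i\<in>UNIV. \<Sum>j\<in>UNIV. M i j * P i j) = \<tau>"
  proof -
    have "(\<Sum>i\<in>UNIV. \<Sum>j\<in>UNIV. M i j * P i j) = (\<Sum>i\<in>UNIV. \<Sum>j\<in>UNIV. (if i = j then M i j else 0) - y i * (M i j * y j))"
      by (intro sum.cong refl) (simp add: P_def algebra_simps)
    also have "\<dots> = (\<Sum>i\<in>UNIV. M i i) - (\<Sum>i\<in>UNIV. y i * (\<Sum>j\<in>UNIV. M i j * y j))"
      by (simp add: sum_subtractf sum_distrib_left)
    also have "\<dots> = (\<Sum>i\<in>UNIV. N i i + y i * v i - y i * D i)"
      unfolding My by (simp add: M_def mult.commute)
    finally show ?thesis by (simp add: sum.distrib sum_subtractf yv yD \<tau>_def)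
  qed
  have PP: "(\<Sum>i\<in>UNIV. \<Sum>j\<in>UNIV. P i j * P i j) = real CARD('n) - 1"
  proof -
    have "(\<Sum>i\<in>UNIV. \<Sum>j\<in>UNIV. P i j * P i j) = (\<Sum>i\<in>UNIV. \<Sum>j\<in>UNIV. (if i = j then 1 - 2 * (y i * y j) else 0) + (y i * y i) * (y j * y j))"
      by (intro sum.cong refl) (simp add: P_def algebra_simps)
    also have "\<dots> = (\<Sum>i\<in>UNIV. 1 - 2 * (y i * y i)) + (\<Sum>i\<in>UNIV. y i * y i) * (\<Sum>j\<in>UNIV. y j * y j)"
      by (simp add: sum.distrib sum_product)
    also have "\<dots> = real CARD('n) - 1"
      by (simp only: sum_subtractf sum_distrib_left[symmetric] y) simp
    finally show ?thesis .
  qed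
  \<comment> \<open>\<open>t * P\<close> is the multiple of \<open>P\<close> closest to
    \<open>M\<close>; the squared distance between them is the defect in the Cauchy-Schwarz
    inequality for the trace.\<close>
  define t where "t = \<tau> / (real CARD('n) - 1)"
  have n1: "real CARD('n) - 1 > 0" using n by simp
  have "0 \<le> (\<Sum>i\<in>UNIV. \<Sum>j\<in>UNIV. (M i j - t * P i j)\<^sup>2)" by (intro sum_nonneg) auto
  also have "\<dots> = (\<Sum>i\<in>UNIV. \<Sum>j\<in>UNIV. M i j * M i j) - 2 * t * (\<Sum>i\<in>UNIV. \<Sum>j\<in>UNIV. M i j * P i j) + t\<^sup>2 * (\<Sum>i\<in>UNIV. \<Sum>j\<in>UNIV. P i j * P i j)"
    unfolding sum_distrib_left sum.distrib[symmetric] sum_subtractf[symmetric]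
    by (intro sum.cong refl) (simp add: power2_eq_square algebra_simps)
  also have "\<dots> = (\<Sum>i\<in>UNIV. \<Sum>j\<in>UNIV. N i j * N j i) + 2 * b - \<tau>\<^sup>2 / (real CARD('n) - 1)"
  proof -
    have "S - 2 * (\<tau> / m) * \<tau> + (\<tau> / m)\<^sup>2 * m = S - \<tau>\<^sup>2 / m" if "m > 0" for S m :: real
      using that by (simp add: power2_eq_square field_simps)
    from this[OF n1] show ?thesis unfolding MM MP PP t_def .
  qed
  finally show ?thesis by (simp add: b_def \<tau>_def)
qed

context punctured_C2
begin

lemma jacobian_bound:
  assumes x: "x \<in> pball" and n: "CARD('n) \<ge> 2"
  shows "(dw x)\<^sup>2 / (real CARD('n) - 1) - 2 * w_drw x / norm x \<le> (\<Sum>i\<in>UNIV. \<Sum>j\<in>UNIV. pd i (w j) x * pd j (w i) x)"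
proof -
  have r: "norm x > 0" using x by simp
  let ?y = "\<lambda>i. x $ i / norm x" and ?v = "\<lambda>i. w i x / norm x" and ?D = "\<lambda>i. d_r (w i) x" and ?N = "\<lambda>i j. pd i (w j) x"
  have y: "(\<Sum>i\<in>UNIV. ?y i * ?y i) = 1"
    using r norm_sum_squares[of x] by (simp add: sum_divide_distrib[symmetric] power2_eq_square)
  have yv: "(\<Sum>i\<in>UNIV. ?y i * ?v i) = 0"
    using tang[of x] by (simp add: sum_divide_distrib[symmetric])
  have yD: "(\<Sum>i\<in>UNIV. ?y i * ?D i) = 0"
    using d_r_w_orth[OF x] by (simp add: sum_divide_distrib[symmetric])
  have Nr: "(\<Sum>j\<in>UNIV. ?y j * ?N i j) = - ?v i" for i
    using tang_pd[OF x, of i] by (simp add: sum_divide_distrib[symmetric])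
  have Nl: "(\<Sum>i\<in>UNIV. ?y i * ?N i j) = ?D j" for j by (simp add: d_r_def)
  \<comment> \<open>After \<open>pd_ur\<close> is substituted, only the Euclidean Hessian of
    \<open>u\<close> and terms symmetric in \<open>i\<close> and \<open>j\<close> remain, so
    \<open>sym\<close> reduces to \<open>pdpd_commute\<close>.\<close>
  have M: "?N i j + ?v i * ?y j - ?y i * ?D j = pd i (pd j u) x - ((if j = i then 1 else 0) - x $ j * x $ i / (norm x)\<^sup>2) / norm x * ur x
      - (?y j * ?D i + ?y i * ?D j) - ?y i * ?y j * d_r ur x" for i j
    unfolding pd_w[OF x] pd_ur[OF x] by (simp add: algebra_simps)
  have sym: "?N i j + ?v i * ?y j - ?y i * ?D j = ?N j i + ?v j * ?y i - ?y j * ?D i" for i j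
    unfolding M pdpd_commute[of i j] by (simp add: algebra_simps)
  from trace_square_bound[of ?y ?v ?D ?N, OF y yv yD Nr Nl sym n]
  show ?thesis by (simp add: w_drw_def dw_def sum_divide_distrib sum_distrib_left)
qed

lemma d_r_w_sq:
  assumes x: "x \<in> pball"
  shows "d_r w_sq x = 2 * w_drw x"
proof -
  have "pd i w_sq x = (\<Sum>j\<in>UNIV. pd i (\<lambda>x. w j x * w j x) x)" for i
    unfolding w_sq_def[abs_def] power2_eq_square
    by (intro pd_sum differentiable_mult w_diff x) auto
  also have "\<dots> i = (\<Sum>j\<in>UNIV. 2 * w j x * pd i (w j) x)" for i
    by (simp add: pd_mult[OF w_diff[OF x] w_diff[OF x]] mult_ac)
  finally have "d_r w_sq x = (\<Sum>i\<in>UNIV. \<Sum>j\<in>UNIV. 2 * w j x * (x $ i / norm x * pd i (w j) x))"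
    unfolding d_r_def by (simp add: sum_distrib_left mult_ac)
  also have "\<dots> = 2 * w_drw x" unfolding w_drw_def d_r_def
    by (subst sum.swap) (simp add: sum_distrib_left mult_ac)
  finally show ?thesis .
qed

lemma C1c_w_sq: "C1c w_sq"
  unfolding w_sq_def[abs_def] power2_eq_square by (intro C1c_sum C1c_mult C1c_C1 C1w) auto

text \<open>\<open>jacobian_bound\<close> inserted into \<open>integral_bochner\<close> leaves the
  term \<open>w_drw\<close>, which is half the radial derivative of \<open>w_sq\<close> and is
  removed by \<open>integral_radial_parts\<close>. Both sides then carry the factor n - 2, which is
  positive here and is cancelled.\<close>

lemma spectral_gap_ge3:
  assumes n: "CARD('n) \<ge> 3"
  shows "(real CARD('n) - 1) * (\<integral>x. W CARD('n) (norm x) * kap (norm x) ^ 4 * w_sq x / (norm x)\<^sup>2 \<partial>lborel)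
     \<le> (\<integral>x. W CARD('n) (norm x) * kap (norm x) ^ 4 * (dw x)\<^sup>2 \<partial>lborel)"
proof -
  let ?n = "real CARD('n)"
  let ?g = "\<lambda>r. W CARD('n) r * kap r ^ 4"
  obtain g' where g: "radial_C1 ?g g'" using radial_C1_Wkap[of 4] by blast
  note gr = radial_C1_divide_r[OF g]
  let ?NN = "\<lambda>x. \<Sum>i\<in>UNIV. \<Sum>j\<in>UNIV. pd i (w j) x * pd j (w i) x"
  let ?E4 = "\<lambda>x. ?g (norm x) * ((dw x)\<^sup>2 - ?NN x) + g' (norm x) / norm x * w_sq x"
  let ?E1 = "\<lambda>x. ?g (norm x) / norm x * d_r w_sq x + (g' (norm x) / norm x - ?g (norm x) / (norm x)\<^sup>2
     + (?n - 1) * (?g (norm x) / norm x) / norm x) * w_sq x"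
  let ?X = "\<lambda>x. ?g (norm x) * (dw x)\<^sup>2" and ?Y = "\<lambda>x. ?g (norm x) * w_sq x / (norm x)\<^sup>2"
  have E4: "(\<integral>x. ?E4 x \<partial>lborel) = 0" using integral_bochner[OF g] by (simp add: w_sq_def)
  have E1: "(\<integral>x. ?E1 x \<partial>lborel) = 0" using integral_radial_parts[OF C1c_w_sq gr] by simp
  have c4: "C0c ?E4"
    by (intro C0c_add C0c_mult C0c_diff C0c_power2 C0c_sum C0c_mult2 C1c_pd C1w C0c_dw C0c_w_sums radial_C1_continuous[OF g]
        continuous_on_divide radial_C1_continuous'[OF g] continuous_on_norm_id) auto
  have c1: "C0c ?E1"
    by (intro C0c_add C0c_mult C1c_d_r C1c_w_sq C0c_w_sums radial_C1_continuous[OF gr] radial_C1_continuous'[OF gr]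
        continuous_on_divide continuous_on_add continuous_on_mult continuous_on_const continuous_on_norm_id) auto
  have cX: "C0c ?X" by (intro C0c_mult C0c_power2 C0c_dw radial_C1_continuous[OF g])
  have cY: "C0c ?Y"
  proof -
    have "C0c (\<lambda>x. ?g (norm x) * (1 / norm x) * (1 / norm x) * w_sq x)"
      by (intro C0c_mult C0c_w_sums continuous_on_mult radial_C1_continuous[OF g] radial_C1_continuous[OF radial_C1_inverse])
    then show ?thesis by (simp add: power2_eq_square)
  qed
  \<comment> \<open>In this difference the terms with \<open>g'\<close> cancel, so its explicit form
    never enters.\<close>
  have "0 = (\<integral>x. ?E4 x \<partial>lborel) - (\<integral>x. ?E1 x \<partial>lborel)" using E4 E1 by simp
  also have "\<dots> = (\<integral>x. ?E4 x - ?E1 x \<partial>lborel)"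
    using c1 c4 C0c_integrable by simp
  also have "\<dots> \<le> (\<integral>x. (?n - 2) / (?n - 1) * ?X x - (?n - 2) * ?Y x \<partial>lborel)"
  proof (rule integral_mono)
    show "integrable lborel (\<lambda>x. ?E4 x - ?E1 x)"
      using c1 c4 C0c_integrable by simp
    show "integrable lborel (\<lambda>x. (?n - 2) / (?n - 1) * ?X x - (?n - 2) * ?Y x)"
      by (intro Bochner_Integration.integrable_diff integrable_mult_right C0c_integrable cX cY)
    fix x
    show "?E4 x - ?E1 x \<le> (?n - 2) / (?n - 1) * ?X x - (?n - 2) * ?Y x"
    proof (cases "x \<in> K")
      case True
      then have x: "x \<in> pball" using K_sub by auto
      then have r: "norm x > 0" by simp
      have gp: "?g (norm x) \<ge> 0" using W_pos[of "norm x" "CARD('n)"] kap_norm_pos[OF x] norm_pball[OF x] by simp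
      have "?g (norm x) * ((dw x)\<^sup>2 / (?n - 1) - 2 * w_drw x / norm x) \<le> ?g (norm x) * ?NN x"
        using n by (intro mult_left_mono gp jacobian_bound x) auto
      moreover have "?E4 x - ?E1 x = ?X x - ?g (norm x) * ?NN x - ?g (norm x) * (2 * w_drw x / norm x) - (?n - 2) * ?Y x"
        unfolding d_r_w_sq[OF x] using r by (simp add: power2_eq_square field_simps)
      moreover have "?X x - ?g (norm x) * ((dw x)\<^sup>2 / (?n - 1)) = (?n - 2) / (?n - 1) * ?X x"
        using n by (simp add: field_simps)
      ultimately show ?thesis by (simp add: right_diff_distrib)
    next
      case False
      then show ?thesis using C0c_zero[OF c1 False] C0c_zero[OF c4 False] C0c_zero[OF cX False] C0c_zero[OF cY False]
        by (simp only: mult_zero_right diff_self)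
    qed
  qed
  also have "\<dots> = (?n - 2) / (?n - 1) * (\<integral>x. ?X x \<partial>lborel) - (?n - 2) * (\<integral>x. ?Y x \<partial>lborel)"
    unfolding integral_mult_right_zero[symmetric]
    by (intro Bochner_Integration.integral_diff integrable_mult_right C0c_integrable cX cY)
  finally have "(?n - 2) * (\<integral>x. ?Y x \<partial>lborel) \<le> (?n - 2) * ((\<integral>x. ?X x \<partial>lborel) / (?n - 1))" by simp
  then have "(\<integral>x. ?Y x \<partial>lborel) \<le> (\<integral>x. ?X x \<partial>lborel) / (?n - 1)"
    by (rule mult_left_le_imp_le) (use n in auto)
  then show ?thesis using n by (simp add: pos_le_divide_eq mult.commute)
qed

text \<open>\<open>lap_H u\<close> is squared as a sum of its radial and angular parts, and
  \<open>cross_term\<close> replaces the mixed product. The lower bound takes the spectral gap as a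
  premise, so that its two sources, for the plane and for higher dimensions, serve the same
  argument.\<close>

lemma lap_norm_identity:
  "(hnorm (lap_H u))\<^sup>2 = (hnorm (lap_rho u))\<^sup>2 + (hnorm (\<lambda>x. lap_H u x - lap_rho u x))\<^sup>2
           + 2 * (\<Sum>j\<in>UNIV. (hnorm (d_rho (Lj j u)))\<^sup>2)
           - 2 * (\<Sum>j\<in>UNIV. (hnorm (Lj j u))\<^sup>2)
           - 2 * (\<Sum>j\<in>UNIV. (hnorm (\<lambda>x. Lj j u x / sinh (hrho x)))\<^sup>2)"
  and lap_norm_lower_bound:
  "(real CARD('n) - 1) * (\<integral>x. W CARD('n) (norm x) * kap (norm x) ^ 4 * w_sq x / (norm x)\<^sup>2 \<partial>lborel)
     \<le> (\<integral>x. W CARD('n) (norm x) * kap (norm x) ^ 4 * (dw x)\<^sup>2 \<partial>lborel) \<Longrightarrow>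
   (hnorm (lap_H u))\<^sup>2 \<ge> (hnorm (lap_rho u))\<^sup>2
           + 1/2 * (\<Sum>j\<in>UNIV. (hnorm (\<lambda>x. Lj j u x / hrho x))\<^sup>2)
           + (real CARD('n) + 1) * (real CARD('n) - 3) / 2 *
               (\<Sum>j\<in>UNIV. (hnorm (\<lambda>x. cosh (hrho x) / sinh (hrho x) * Lj j u x))\<^sup>2)"
proof -
  let ?n = "real CARD('n)"
  let ?W = "\<lambda>x. W CARD('n) (norm x)"
  define \<delta> where "\<delta> x = (kap (norm x))\<^sup>2 * dw x" for x
  define L2 where "L2 x = (\<Sum>j\<in>UNIV. (Lj j u x)\<^sup>2)" for x
  define D2 where "D2 x = (\<Sum>j\<in>UNIV. (d_rho (Lj j u) x)\<^sup>2)" for x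
  have \<delta>: "lap_H u x - lap_rho u x = \<delta> x" for x
  proof (cases "x \<in> K")
    case True
    then show ?thesis unfolding \<delta>_def using lap_diff_eq K_sub by blast
  qed (simp add: \<delta>_def lap_H_zero lap_rho_zero dw_zero)
  have Lz: "Lj j u x = 0" if "x \<notin> K" for x j using C1c_zero[OF C1c_Lj that] .
  have Dz: "d_rho (Lj j u) x = 0" if "x \<notin> K" for x j using C1c_d_r_zero[OF C1c_Lj that] by (simp add: d_rho_eq)
  have cL: "C0c (\<lambda>x. c (norm x) * (Lj j u x)\<^sup>2)" if "continuous_on pball (\<lambda>x::real^'n. c (norm x))" for c j
    by (intro C0c_mult that C0c_power2 C1c_C0c C1c_Lj)
  have cL2: "C0c (\<lambda>x. c (norm x) * L2 x)" if "continuous_on pball (\<lambda>x::real^'n. c (norm x))" for c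
    unfolding L2_def by (intro C0c_mult that C0c_power2 C1c_C0c C1c_Lj C0c_sum)
  have cD: "C0c (\<lambda>x. ?W x * (d_rho (Lj j u) x)\<^sup>2)" for j
    unfolding d_rho_eq by (intro C0c_mult C0c_power2 rcont C1c_d_r C1c_Lj)
  have cD2: "C0c (\<lambda>x. ?W x * D2 x)"
    unfolding D2_def d_rho_eq by (intro C0c_mult C0c_power2 C0c_sum rcont C1c_d_r C1c_Lj)
  have c\<delta>: "C0c \<delta>" unfolding \<delta>_def[abs_def] by (rule C0c_lap_diff)
  have sumL: "(\<Sum>j\<in>UNIV. (\<integral>x. c (norm x) * (Lj j u x)\<^sup>2 \<partial>lborel)) = (\<integral>x. c (norm x) * L2 x \<partial>lborel)"
    if "continuous_on pball (\<lambda>x::real^'n. c (norm x))" for c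
    unfolding L2_def sum_distrib_left
    by (rule Bochner_Integration.integral_sum[symmetric]) (intro C0c_integrable cL that)
  have hD: "(hnorm (d_rho (Lj j u)))\<^sup>2 = (\<integral>x. ?W x * (d_rho (Lj j u) x)\<^sup>2 \<partial>lborel)" for j
    by (rule hnorm_squared) (rule Dz)
  have sumD: "(\<Sum>j\<in>UNIV. (hnorm (d_rho (Lj j u)))\<^sup>2) = (\<integral>x. ?W x * D2 x \<partial>lborel)"
    unfolding D2_def sum_distrib_left hD
    by (rule Bochner_Integration.integral_sum[symmetric]) (intro C0c_integrable cD)
  have cont_inv: "continuous_on pball (\<lambda>x::real^'n. 1 / rho (norm x))"
      "continuous_on pball (\<lambda>x::real^'n. 1 / norm x)"
    by (rule radial_C1_continuous[OF radial_C1_inverse_rho], rule radial_C1_continuous[OF radial_C1_inverse])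
  \<comment> \<open>The squares of 1 / sinh, coth and 1 / rho against the hyperbolic volume, written
    with the factors whose continuity is known.\<close>
  define cs where "cs r = W CARD('n) r * (kap r * (1 / r))\<^sup>2" for r
  define cc where "cc r = W CARD('n) r * (coth_rho r)\<^sup>2" for r
  define cr where "cr r = W CARD('n) r * (1 / rho r)\<^sup>2" for r
  have ccs: "continuous_on pball (\<lambda>x::real^'n. cs (norm x))" "continuous_on pball (\<lambda>x::real^'n. cc (norm x))"
     "continuous_on pball (\<lambda>x::real^'n. cr (norm x))"
    unfolding cs_def cc_def cr_def by (intro continuous_on_mult continuous_on_power rcont cont_inv)+
  have hn: "(\<Sum>j\<in>UNIV. (hnorm (\<lambda>x. m x * Lj j u x))\<^sup>2) = (\<integral>x. c (norm x) * L2 x \<partial>lborel)"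
    if "continuous_on pball (\<lambda>x::real^'n. c (norm x))" "\<And>x. x \<in> pball \<Longrightarrow> c (norm x) = ?W x * (m x)\<^sup>2" for c m
  proof -
    have "(hnorm (\<lambda>x. m x * Lj j u x))\<^sup>2 = (\<integral>x. c (norm x) * (Lj j u x)\<^sup>2 \<partial>lborel)" for j
    proof -
      have "(hnorm (\<lambda>x. m x * Lj j u x))\<^sup>2 = (\<integral>x. ?W x * (m x * Lj j u x)\<^sup>2 \<partial>lborel)"
        by (rule hnorm_squared) (simp add: Lz)
      also have "\<dots> = (\<integral>x. c (norm x) * (Lj j u x)\<^sup>2 \<partial>lborel)"
      proof (rule integral_cong_K)
        fix x assume "x \<in> K"
        then have "c (norm x) = ?W x * (m x)\<^sup>2" using that(2) K_sub by blast
        then show "?W x * (m x * Lj j u x)\<^sup>2 = c (norm x) * (Lj j u x)\<^sup>2" by (simp add: power_mult_distrib)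
      qed (simp_all add: Lz)
      finally show ?thesis .
    qed
    then show ?thesis using sumL[OF that(1)] by simp
  qed
  have HL: "(\<Sum>j\<in>UNIV. (hnorm (Lj j u))\<^sup>2) = (\<integral>x. ?W x * L2 x \<partial>lborel)"
    using hn[of "W CARD('n)" "\<lambda>_. 1"] rcont(1) by simp
  have HS: "(\<Sum>j\<in>UNIV. (hnorm (\<lambda>x. Lj j u x / sinh (hrho x)))\<^sup>2) = (\<integral>x. cs (norm x) * L2 x \<partial>lborel)"
    using hn[of cs "\<lambda>x. 1 / sinh (hrho x)", OF ccs(1)] by (simp add: sinh_hrho cs_def)
  have HC: "(\<Sum>j\<in>UNIV. (hnorm (\<lambda>x. cosh (hrho x) / sinh (hrho x) * Lj j u x))\<^sup>2) = (\<integral>x. cc (norm x) * L2 x \<partial>lborel)"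
    by (rule hn[OF ccs(2)]) (simp add: coth_hrho cc_def)
  have HR: "(\<Sum>j\<in>UNIV. (hnorm (\<lambda>x. Lj j u x / hrho x))\<^sup>2) = (\<integral>x. cr (norm x) * L2 x \<partial>lborel)"
    using hn[of cr "\<lambda>x. 1 / hrho x", OF ccs(3)] by (simp add: hrho_eq cr_def)
  have Hrho: "(hnorm (lap_rho u))\<^sup>2 = (\<integral>x. ?W x * (lap_rho u x)\<^sup>2 \<partial>lborel)"
    by (rule hnorm_squared[OF lap_rho_zero])
  have Hd: "(hnorm (\<lambda>x. lap_H u x - lap_rho u x))\<^sup>2 = (\<integral>x. ?W x * (\<delta> x)\<^sup>2 \<partial>lborel)"
    unfolding \<delta> by (rule hnorm_squared) (simp add: \<delta>_def dw_zero)
  have HH: "(hnorm (lap_H u))\<^sup>2 = (\<integral>x. ?W x * (lap_H u x)\<^sup>2 \<partial>lborel)"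
    by (rule hnorm_squared[OF lap_H_zero])
  let ?T = "\<lambda>x. ?W x * (lap_rho u x * \<delta> x - D2 x + (coth_rho (norm x))\<^sup>2 * L2 x)"
  have T: "(\<integral>x. ?T x \<partial>lborel) = 0" using cross_term by (simp add: \<delta>_def D2_def L2_def)
  have int: "integrable lborel (\<lambda>x. ?W x * (lap_rho u x)\<^sup>2)" "integrable lborel (\<lambda>x. ?W x * (\<delta> x)\<^sup>2)"
     "integrable lborel (\<lambda>x. ?W x * D2 x)" "integrable lborel (\<lambda>x. cc (norm x) * L2 x)"
     "integrable lborel (\<lambda>x. cs (norm x) * L2 x)" "integrable lborel (\<lambda>x. ?W x * L2 x)"
     "integrable lborel (\<lambda>x. cr (norm x) * L2 x)"
    by (intro C0c_integrable C0c_mult C0c_power2 c\<delta> C0c_lap_rho rcont cD2 cL2 ccs)+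
  have intT: "integrable lborel ?T"
  proof -
    have "C0c (\<lambda>x. ?W x * (lap_rho u x * \<delta> x))" by (intro C0c_mult C0c_mult2 c\<delta> C0c_lap_rho rcont)
    from C0c_add[OF C0c_diff[OF this cD2] cL2[OF ccs(2)]] show ?thesis
      by (intro C0c_integrable) (simp add: cc_def algebra_simps)
  qed
  \<comment> \<open>\<open>?T\<close> has integral 0 by the cross term. Twice \<open>?T\<close> is
    what turns the mixed product of the expanded square into \<open>D2\<close> and the coth
    term.\<close>
  have "(\<integral>x. ?W x * (lap_H u x)\<^sup>2 \<partial>lborel) = (\<integral>x. ?W x * (lap_rho u x)\<^sup>2 + ?W x * (\<delta> x)\<^sup>2
      + 2 * ?T x + 2 * (?W x * D2 x) - 2 * (cc (norm x) * L2 x) \<partial>lborel)"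
  proof (rule Bochner_Integration.integral_cong[OF refl])
    fix x
    have "lap_H u x = lap_rho u x + \<delta> x" using \<delta>[of x] by simp
    then show "?W x * (lap_H u x)\<^sup>2 = ?W x * (lap_rho u x)\<^sup>2 + ?W x * (\<delta> x)\<^sup>2
      + 2 * ?T x + 2 * (?W x * D2 x) - 2 * (cc (norm x) * L2 x)"
      by (simp add: cc_def power2_eq_square algebra_simps)
  qed
  also have "\<dots> = (\<integral>x. ?W x * (lap_rho u x)\<^sup>2 \<partial>lborel) + (\<integral>x. ?W x * (\<delta> x)\<^sup>2 \<partial>lborel) + 2 * (\<integral>x. ?T x \<partial>lborel)
      + 2 * (\<integral>x. ?W x * D2 x \<partial>lborel) - 2 * (\<integral>x. cc (norm x) * L2 x \<partial>lborel)"
    using int intT by simp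
  finally have main: "(hnorm (lap_H u))\<^sup>2 = (hnorm (lap_rho u))\<^sup>2 + (hnorm (\<lambda>x. lap_H u x - lap_rho u x))\<^sup>2
      + 2 * (\<integral>x. ?W x * D2 x \<partial>lborel) - 2 * (\<integral>x. cc (norm x) * L2 x \<partial>lborel)"
    unfolding HH Hrho Hd T by simp
  have ccsplit: "(\<integral>x. cc (norm x) * L2 x \<partial>lborel) = (\<integral>x. ?W x * L2 x \<partial>lborel) + (\<integral>x. cs (norm x) * L2 x \<partial>lborel)"
  proof -
    have "(\<integral>x. cc (norm x) * L2 x \<partial>lborel) = (\<integral>x. ?W x * L2 x + cs (norm x) * L2 x \<partial>lborel)"
    proof (rule integral_cong_K)
      fix x assume "x \<in> K"
      then have "norm x > 0" using K_sub by auto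
      then show "cc (norm x) * L2 x = ?W x * L2 x + cs (norm x) * L2 x"
        by (simp add: cc_def cs_def coth_rho_squared algebra_simps)
    qed (simp_all add: L2_def Lz)
    then show ?thesis using int by simp
  qed
  show "(hnorm (lap_H u))\<^sup>2 = (hnorm (lap_rho u))\<^sup>2 + (hnorm (\<lambda>x. lap_H u x - lap_rho u x))\<^sup>2
           + 2 * (\<Sum>j\<in>UNIV. (hnorm (d_rho (Lj j u)))\<^sup>2)
           - 2 * (\<Sum>j\<in>UNIV. (hnorm (Lj j u))\<^sup>2)
           - 2 * (\<Sum>j\<in>UNIV. (hnorm (\<lambda>x. Lj j u x / sinh (hrho x)))\<^sup>2)"
    unfolding main sumD HL HS ccsplit by simp
  assume gap: "(?n - 1) * (\<integral>x. ?W x * kap (norm x) ^ 4 * w_sq x / (norm x)\<^sup>2 \<partial>lborel)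
     \<le> (\<integral>x. ?W x * kap (norm x) ^ 4 * (dw x)\<^sup>2 \<partial>lborel)"
  \<comment> \<open>Both sides are rewritten in hyperbolic terms: \<open>w_sq\<close> with the
    weight \<open>kap ^ 4 / r\<^sup>2\<close> is \<open>L2\<close> divided by sinh^2, and
    \<open>kap ^ 4\<close> times the square of \<open>dw\<close> is the square of
    \<open>\<delta>\<close>.\<close>
  have gap': "(?n - 1) * (\<integral>x. cs (norm x) * L2 x \<partial>lborel) \<le> (hnorm (\<lambda>x. lap_H u x - lap_rho u x))\<^sup>2"
  proof -
    have "cs (norm x) * L2 x = ?W x * kap (norm x) ^ 4 * w_sq x / (norm x)\<^sup>2" for x
      unfolding L2_def sum_Lj cs_def by (simp add: power_mult_distrib power_divide power2_eq_square power4_eq_xxxx)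
    moreover have "?W x * (\<delta> x)\<^sup>2 = ?W x * kap (norm x) ^ 4 * (dw x)\<^sup>2" for x
      unfolding \<delta>_def by (simp add: power2_eq_square power4_eq_xxxx)
    ultimately show ?thesis using gap unfolding Hd by (simp only:)
  qed
  have hardy': "1/4 * (\<integral>x. cr (norm x) * L2 x \<partial>lborel) + (?n - 1)\<^sup>2 / 4 * (\<integral>x. cc (norm x) * L2 x \<partial>lborel)
      - (?n - 1) / 2 * (\<integral>x. cs (norm x) * L2 x \<partial>lborel) \<le> (\<integral>x. ?W x * D2 x \<partial>lborel)"
  proof -
    let ?h = "\<lambda>x. 1/4 * cr (norm x) + (?n - 1)\<^sup>2 / 4 * cc (norm x) - (?n - 1) / 2 * cs (norm x)"
    have hc: "continuous_on pball (\<lambda>x::real^'n. ?h x)"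
      by (intro continuous_on_diff continuous_on_add continuous_on_mult ccs continuous_on_const)
    have "(\<integral>x. ?h x * (Lj j u x)\<^sup>2 \<partial>lborel) \<le> (\<integral>x. ?W x * (d_rho (Lj j u) x)\<^sup>2 \<partial>lborel)" for j
      using hardy[OF C1c_Lj, of j]
      by (simp add: cr_def cc_def cs_def power_divide algebra_simps)
    then have "(\<Sum>j\<in>UNIV. (\<integral>x. ?h x * (Lj j u x)\<^sup>2 \<partial>lborel)) \<le> (\<Sum>j\<in>UNIV. (hnorm (d_rho (Lj j u)))\<^sup>2)"
      unfolding hD by (rule sum_mono)
    then have "(\<integral>x. ?h x * L2 x \<partial>lborel) \<le> (\<integral>x. ?W x * D2 x \<partial>lborel)"
      unfolding sumD using sumL[OF hc] by simp
    moreover have "(\<integral>x. ?h x * L2 x \<partial>lborel) = (\<integral>x. 1/4 * (cr (norm x) * L2 x) + (?n - 1)\<^sup>2 / 4 * (cc (norm x) * L2 x)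
      - (?n - 1) / 2 * (cs (norm x) * L2 x) \<partial>lborel)"
      by (simp only: left_diff_distrib distrib_right mult.assoc)
    moreover have "\<dots> = 1/4 * (\<integral>x. cr (norm x) * L2 x \<partial>lborel) + (?n - 1)\<^sup>2 / 4 * (\<integral>x. cc (norm x) * L2 x \<partial>lborel)
      - (?n - 1) / 2 * (\<integral>x. cs (norm x) * L2 x \<partial>lborel)"
      using int by simp
    ultimately show ?thesis by simp
  qed
  have coef: "(?n + 1) * (?n - 3) / 2 = (?n - 1)\<^sup>2 / 2 - 2" by (simp add: power2_eq_square algebra_simps add_divide_distrib diff_divide_distrib)
  show "(hnorm (lap_H u))\<^sup>2 \<ge> (hnorm (lap_rho u))\<^sup>2
           + 1/2 * (\<Sum>j\<in>UNIV. (hnorm (\<lambda>x. Lj j u x / hrho x))\<^sup>2)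
           + (?n + 1) * (?n - 3) / 2 *
               (\<Sum>j\<in>UNIV. (hnorm (\<lambda>x. cosh (hrho x) / sinh (hrho x) * Lj j u x))\<^sup>2)"
    unfolding main HR HC coef left_diff_distrib using hardy' gap' by argo
qed

end

section \<open>Wirtinger inequality and rotations of the plane\<close>

text \<open>Comparison with \<open>k * tan (k * t)\<close> for \<open>k < 1\<close> instead of \<open>tan t\<close> keeps the
  integrand bounded up to the end points.\<close>

lemma wirtinger_half_period:
  fixes f f' :: "real \<Rightarrow> real"
  assumes f: "\<And>t. (f has_real_derivative f' t) (at t)" and f': "continuous_on UNIV f'"
    and z: "f \<alpha> = 0" "f (\<alpha> + pi) = 0"
  shows "integral {\<alpha>..\<alpha>+pi} (\<lambda>t. (f t)\<^sup>2) \<le> integral {\<alpha>..\<alpha>+pi} (\<lambda>t. (f' t)\<^sup>2)"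
\<comment> \<open>The bound is shown with a factor \<open>s < 1\<close>, the square of
  \<open>k\<close>; the claim is the limit as \<open>s\<close> tends to 1.\<close>
proof (rule field_le_mult_one_interval)
  fix s :: real assume s: "0 < s" "s < 1"
  define k where "k = sqrt s"
  have k: "0 < k" "k < 1" "k\<^sup>2 = s" using s by (auto simp: k_def)
  \<comment> \<open>Centred at the midpoint, the argument of the tangent has absolute value at most
    \<open>k * (pi / 2)\<close> on the whole interval.\<close>
  define m where "m = \<alpha> + pi / 2"
  let ?I = "{\<alpha>..\<alpha>+pi}"
  have fc: "continuous_on UNIV f" using DERIV_isCont[OF f] by (intro continuous_at_imp_continuous_on) auto
  have cos0: "cos (k * (t - m)) \<noteq> 0" if "t \<in> ?I" for t
  proof -
    have "\<bar>t - m\<bar> \<le> pi / 2" using that unfolding m_def atLeastAtMost_iff by linarith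
    then have "k * \<bar>t - m\<bar> \<le> k * (pi / 2)" using k by simp
    also have "\<dots> < pi / 2" using k by simp
    finally have "\<bar>k * (t - m)\<bar> < pi / 2" using k by (simp add: abs_mult)
    then have "cos (k * (t - m)) > 0" by (intro cos_gt_zero_pi) auto
    then show ?thesis by simp
  qed
  let ?T = "\<lambda>t. tan (k * (t - m))"
  let ?F = "\<lambda>t. k * ?T t * (f t)\<^sup>2"
  let ?F' = "\<lambda>t. s * (1 + (?T t)\<^sup>2) * (f t)\<^sup>2 + 2 * k * ?T t * f t * f' t"
  have dF: "(?F has_real_derivative ?F' t) (at t)" if "t \<in> ?I" for t
  proof -
    have c: "cos (k * (t - m)) \<noteq> 0" using cos0[OF that] .
    have sec: "inverse ((cos (k * (t - m)))\<^sup>2) = 1 + (?T t)\<^sup>2"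
      using c tan_sec[OF c] by (simp add: power_inverse)
    have "(?T has_real_derivative (1 + (?T t)\<^sup>2) * k) (at t)"
      unfolding sec[symmetric] by (rule DERIV_chain2[where g="\<lambda>t. k * (t - m)", OF DERIV_tan[OF c]]) (auto intro!: derivative_eq_intros)
    moreover have "((\<lambda>t. k * T t * (f t)\<^sup>2) has_real_derivative
        s * D * (f t)\<^sup>2 + 2 * k * T t * f t * f' t) (at t)"
      if "(T has_real_derivative D * k) (at t)" for T D
      unfolding k(3)[symmetric]
      by (auto intro!: derivative_eq_intros that f simp: power2_eq_square algebra_simps)
    ultimately show ?thesis by blast
  qed
  have "(?F' has_integral (?F (\<alpha> + pi) - ?F \<alpha>)) ?I"
    using dF by (intro fundamental_theorem_of_calculus)
      (auto simp: has_real_derivative_iff_has_vector_derivative[symmetric] intro: has_field_derivative_at_within)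
  then have iF: "(?F' has_integral 0) ?I" using z by simp
  have i1: "((\<lambda>t. (f t)\<^sup>2) has_integral integral ?I (\<lambda>t. (f t)\<^sup>2)) ?I"
    by (intro integrable_integral integrable_continuous_interval continuous_intros continuous_on_subset[OF fc]) auto
  have i2: "((\<lambda>t. (f' t)\<^sup>2) has_integral integral ?I (\<lambda>t. (f' t)\<^sup>2)) ?I"
    by (intro integrable_integral integrable_continuous_interval continuous_intros continuous_on_subset[OF f']) auto
  \<comment> \<open>Adding \<open>?F'\<close>, whose integral is 0 because \<open>f\<close> vanishes
    at both ends, completes the square of \<open>f' + k * tan * f\<close>; this rests on the Riccati
    equation of \<open>k * tan\<close>.\<close>
  have "((\<lambda>t. (f' t)\<^sup>2 - s * (f t)\<^sup>2 + ?F' t) has_integral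
     (integral ?I (\<lambda>t. (f' t)\<^sup>2) - s * integral ?I (\<lambda>t. (f t)\<^sup>2) + 0)) ?I"
    by (intro has_integral_add has_integral_diff has_integral_mult_right i1 i2 iF)
  then have "0 \<le> integral ?I (\<lambda>t. (f' t)\<^sup>2) - s * integral ?I (\<lambda>t. (f t)\<^sup>2) + 0"
  proof (rule has_integral_nonneg)
    fix t
    have "(f' t)\<^sup>2 - s * (f t)\<^sup>2 + ?F' t = (f' t + k * ?T t * f t)\<^sup>2"
      unfolding k(3)[symmetric] by (simp add: power2_eq_square algebra_simps)
    then show "0 \<le> (f' t)\<^sup>2 - s * (f t)\<^sup>2 + ?F' t" by simp
  qed
  then show "s * integral ?I (\<lambda>t. (f t)\<^sup>2) \<le> integral ?I (\<lambda>t. (f' t)\<^sup>2)" by simp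
qed

lemma integral_periodic_shift:
  fixes g :: "real \<Rightarrow> real"
  assumes g: "continuous_on UNIV g" and per: "\<And>t. g (t + p) = g t" and \<theta>: "0 \<le> \<theta>" "\<theta> \<le> p"
  shows "integral {\<theta>..\<theta>+p} g = integral {0..p} g"
proof -
  have int: "g integrable_on {a..b}" for a b
    by (intro integrable_continuous_interval continuous_on_subset[OF g]) auto
  have "integral {0..\<theta>} g = integral {0..\<theta>} (g \<circ> (\<lambda>t. t + p))" by (simp add: per o_def)
  also have "\<dots> = integral {0+p..\<theta>+p} g" by (rule integral_shift) (rule continuous_on_subset[OF g], auto)
  finally have sh: "integral {0..\<theta>} g = integral {p..\<theta>+p} g" by simp
  have "integral {\<theta>..\<theta>+p} g = integral {\<theta>..p} g + integral {p..\<theta>+p} g"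
    using \<theta> by (intro Henstock_Kurzweil_Integration.integral_combine[symmetric] int) auto
  also have "\<dots> = integral {0..\<theta>} g + integral {\<theta>..p} g" using sh by simp
  also have "\<dots> = integral {0..p} g"
    using \<theta> by (intro Henstock_Kurzweil_Integration.integral_combine int) auto
  finally show ?thesis .
qed

text \<open>The periodic primitive \<open>y\<close> says that \<open>v\<close> has mean zero. If
  \<open>v\<close> takes one value \<open>c\<close> at two points half a period apart,
  \<open>wirtinger_half_period\<close> applies to \<open>v - c\<close> on both halves, and by the
  zero mean the integral of the square of \<open>v - c\<close> is at least that of the square of
  \<open>v\<close>.\<close>

lemma wirtinger:
  fixes y v v' :: "real \<Rightarrow> real"
  assumes y: "\<And>t. (y has_real_derivative v t) (at t)" and v: "\<And>t. (v has_real_derivative v' t) (at t)"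
    and v': "continuous_on UNIV v'"
    and per: "\<And>t. y (t + 2 * pi) = y t" "\<And>t. v (t + 2 * pi) = v t" "\<And>t. v' (t + 2 * pi) = v' t"
  shows "integral {0..2*pi} (\<lambda>t. (v t)\<^sup>2) \<le> integral {0..2*pi} (\<lambda>t. (v' t)\<^sup>2)"
proof -
  have vc: "continuous_on UNIV v" using DERIV_isCont[OF v] by (intro continuous_at_imp_continuous_on) auto
  let ?g = "\<lambda>t. v (t + pi) - v t"
  have gc: "continuous_on S ?g" for S
    by (intro continuous_intros continuous_on_compose2[OF vc] continuous_on_subset[OF vc]) auto
  \<comment> \<open>The sign change between 0 and pi supplies two points half a period apart with
    equal values.\<close>
  have g\<pi>: "?g pi = - ?g 0" using per(2)[of 0] by simp
  have "\<exists>\<theta>\<ge>0. \<theta> \<le> pi \<and> ?g \<theta> = 0"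
  proof (cases "?g 0 \<le> 0")
    case True
    then show ?thesis using IVT'[of ?g 0 0 pi] gc g\<pi> by simp
  next
    case False
    then show ?thesis using IVT2'[of ?g pi 0 0] gc g\<pi> by simp
  qed
  then obtain \<theta> where \<theta>: "0 \<le> \<theta>" "\<theta> \<le> pi" "v (\<theta> + pi) = v \<theta>" by auto
  define c where "c = v \<theta>"
  let ?h = "\<lambda>t. v t - c"
  have h: "(?h has_real_derivative v' t) (at t)" for t by (auto intro!: derivative_eq_intros v)
  have 1: "integral {\<theta>..\<theta>+pi} (\<lambda>t. (?h t)\<^sup>2) \<le> integral {\<theta>..\<theta>+pi} (\<lambda>t. (v' t)\<^sup>2)"
    by (rule wirtinger_half_period[OF h v']) (auto simp: c_def \<theta>)
  have "v (\<theta> + pi + pi) = v \<theta>" using per(2)[of \<theta>] by (simp add: algebra_simps)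
  then have 2: "integral {\<theta>+pi..\<theta>+pi+pi} (\<lambda>t. (?h t)\<^sup>2) \<le> integral {\<theta>+pi..\<theta>+pi+pi} (\<lambda>t. (v' t)\<^sup>2)"
    by (intro wirtinger_half_period[OF h v']) (auto simp: c_def \<theta>)
  have c1: "continuous_on UNIV (\<lambda>t. (?h t)\<^sup>2)" and c2: "continuous_on UNIV (\<lambda>t. (v' t)\<^sup>2)"
    and c3: "continuous_on UNIV (\<lambda>t. (v t)\<^sup>2)"
    using vc v' by (auto intro!: continuous_intros)
  have int: "g integrable_on {a..b}" if "continuous_on UNIV g" for g :: "real \<Rightarrow> real" and a b
    by (intro integrable_continuous_interval continuous_on_subset[OF that]) auto
  have comb: "integral {\<theta>..\<theta>+pi} g + integral {\<theta>+pi..\<theta>+pi+pi} g = integral {\<theta>..\<theta>+2*pi} g"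
    if "continuous_on UNIV g" for g :: "real \<Rightarrow> real"
  proof -
    have "integral {\<theta>..\<theta>+pi} g + integral {\<theta>+pi..\<theta>+pi+pi} g = integral {\<theta>..\<theta>+pi+pi} g"
      by (intro Henstock_Kurzweil_Integration.integral_combine int that) auto
    then show ?thesis by (simp add: algebra_simps)
  qed
  have "(v has_integral (y (\<theta> + 2 * pi) - y \<theta>)) {\<theta>..\<theta>+2*pi}"
    using y by (intro fundamental_theorem_of_calculus)
      (auto simp: has_real_derivative_iff_has_vector_derivative[symmetric] intro: has_field_derivative_at_within)
  then have v0: "(v has_integral 0) {\<theta>..\<theta>+2*pi}" by (simp add: per)
  have "((\<lambda>t. (v t)\<^sup>2 - 2 * c * v t + c\<^sup>2) has_integral
     (integral {\<theta>..\<theta>+2*pi} (\<lambda>t. (v t)\<^sup>2) - 2 * c * 0 + measure lborel {\<theta>..\<theta>+2*pi} *\<^sub>R c\<^sup>2)) {\<theta>..\<theta>+2*pi}"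
    by (intro has_integral_add has_integral_diff has_integral_mult_right v0 integrable_integral int c3 has_integral_const_real)
  moreover have "(\<lambda>t. (v t)\<^sup>2 - 2 * c * v t + c\<^sup>2) = (\<lambda>t. (?h t)\<^sup>2)" by (auto simp: power2_eq_square algebra_simps)
  ultimately have "integral {\<theta>..\<theta>+2*pi} (\<lambda>t. (?h t)\<^sup>2) = integral {\<theta>..\<theta>+2*pi} (\<lambda>t. (v t)\<^sup>2) + 2 * pi * c\<^sup>2"
    by (auto dest: integral_unique)
  then have "integral {\<theta>..\<theta>+2*pi} (\<lambda>t. (v t)\<^sup>2) \<le> integral {\<theta>..\<theta>+2*pi} (\<lambda>t. (v' t)\<^sup>2)"
    using 1 2 comb[OF c1] comb[OF c2] by (smt (verit) mult_nonneg_nonneg pi_ge_zero zero_le_power2)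
  then show ?thesis
    using integral_periodic_shift[OF c3, of "2*pi" \<theta>] integral_periodic_shift[OF c2, of "2*pi" \<theta>] \<theta> per by simp
qed

section \<open>Invariance of planar Lebesgue measure under shears and rotations\<close>

lemma lborel_shear_fst:
  "distr lborel borel (\<lambda>(s, t). (s + c * t, t)) = (lborel :: (real \<times> real) measure)"
proof (rule measure_eqI)
  fix A assume "A \<in> sets (distr lborel borel (\<lambda>(s::real, t::real). (s + c * t, t)))"
  then have A[measurable]: "A \<in> sets borel" by simp
  let ?S = "\<lambda>(s::real, t::real). (s + c * t, t)"
  have S[measurable]: "?S \<in> borel \<rightarrow>\<^sub>M borel"
    by (intro borel_measurable_continuous_onI) (auto simp: case_prod_unfold intro!: continuous_intros)
  have SA: "?S -` A \<in> sets borel" using measurable_sets[OF S A] by simp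
  have fib: "(\<lambda>s. (s, t)) -` A \<in> sets borel" for t
  proof -
    have "(\<lambda>s::real. (s, t)) \<in> borel \<rightarrow>\<^sub>M borel"
      by (intro borel_measurable_continuous_onI continuous_intros)
    from measurable_sets[OF this A] show ?thesis by simp
  qed
  have "emeasure (distr lborel borel ?S) A = emeasure (lborel \<Otimes>\<^sub>M lborel) (?S -` A)"
    by (simp add: emeasure_distr lborel_prod)
  \<comment> \<open>On the fibre with fixed second coordinate \<open>t\<close> the shear is the
    translation by \<open>c * t\<close>, which preserves length.\<close>
  also have "\<dots> = (\<integral>\<^sup>+t. emeasure lborel ((\<lambda>s. (s, t)) -` (?S -` A)) \<partial>lborel)"
    using SA by (intro lborel_pair.emeasure_pair_measure_alt2) (unfold lborel_prod, simp)
  also have "\<dots> = (\<integral>\<^sup>+t. emeasure lborel ((\<lambda>s. (s, t)) -` A) \<partial>lborel)"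
  proof (rule nn_integral_cong)
    fix t :: real
    have "emeasure lborel ((\<lambda>s. (s, t)) -` A) = emeasure (distr lborel borel ((+) (c * t))) ((\<lambda>s. (s, t)) -` A)"
      by (simp add: lborel_distr_plus)
    also have "\<dots> = emeasure lborel ((+) (c * t) -` ((\<lambda>s. (s, t)) -` A))"
      using fib by (subst emeasure_distr) auto
    also have "(+) (c * t) -` ((\<lambda>s. (s, t)) -` A) = (\<lambda>s. (s, t)) -` (?S -` A)" by (auto simp: add.commute)
    finally show "emeasure lborel ((\<lambda>s. (s, t)) -` (?S -` A)) = emeasure lborel ((\<lambda>s. (s, t)) -` A)" by simp
  qed
  also have "\<dots> = emeasure (lborel \<Otimes>\<^sub>M lborel) A"
    using A by (intro lborel_pair.emeasure_pair_measure_alt2[symmetric]) (unfold lborel_prod, simp)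
  finally show "emeasure (distr lborel borel ?S) A = emeasure lborel A" by (simp add: lborel_prod)
qed simp

lemma lborel_swap:
  "distr lborel borel (\<lambda>(s, t). (t, s)) = (lborel :: (real \<times> real) measure)"
proof -
  have "distr (lborel \<Otimes>\<^sub>M lborel) (lborel \<Otimes>\<^sub>M lborel) (\<lambda>(x, y). (y, x)) = (lborel \<Otimes>\<^sub>M lborel :: (real \<times> real) measure)"
    using lborel_pair.distr_pair_swap[where ?'a=real and ?'b=real] by simp
  then have "distr lborel lborel (\<lambda>(x, y). (y, x)) = (lborel :: (real \<times> real) measure)" unfolding lborel_prod .
  moreover have "distr lborel lborel (\<lambda>(x::real, y::real). (y, x)) = distr lborel borel (\<lambda>(x, y). (y, x))"
    by (rule distr_cong) auto
  ultimately show ?thesis by simp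
qed

lemma lborel_distr_comp:
  fixes S T :: "real \<times> real \<Rightarrow> real \<times> real"
  assumes "distr lborel borel S = lborel" "distr lborel borel T = lborel"
    "continuous_on UNIV S" "continuous_on UNIV T"
  shows "distr lborel borel (S \<circ> T) = lborel"
proof -
  have [measurable]: "S \<in> borel \<rightarrow>\<^sub>M borel" "T \<in> borel \<rightarrow>\<^sub>M borel"
    using assms(3,4) borel_measurable_continuous_onI by auto
  have "distr lborel borel (S \<circ> T) = distr (distr lborel borel T) borel S"
    by (rule distr_distr[symmetric]) auto
  then show ?thesis by (simp add: assms)
qed

lemma continuous_linear_pair: "continuous_on UNIV (\<lambda>(s::real, t::real). (a * s + b * t, c * s + d * t))"
  by (auto simp: case_prod_unfold intro!: continuous_intros)

text \<open>A rotation other than the half turn is a product of three shears, each of which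
  preserves area.\<close>

lemma lborel_rotation:
  fixes p q :: real
  assumes pq: "p\<^sup>2 + q\<^sup>2 = 1"
  shows "distr lborel borel (\<lambda>(s, t). (p * s - q * t, q * s + p * t)) = (lborel :: (real \<times> real) measure)"
proof -
  have S1: "distr lborel borel (\<lambda>(s, t). (s + c * t, t)) = (lborel :: (real \<times> real) measure)"
     "continuous_on UNIV (\<lambda>(s::real, t::real). (s + c * t, t))" for c :: real
    using lborel_shear_fst continuous_linear_pair[of 1 c 0 1] by auto
  have sw: "continuous_on UNIV (\<lambda>(s::real, t::real). (t, s))" using continuous_linear_pair[of 0 1 1 0] by simp
  have S2: "distr lborel borel (\<lambda>(s, t). (s, t + d * s)) = (lborel :: (real \<times> real) measure)"
     "continuous_on UNIV (\<lambda>(s::real, t::real). (s, t + d * s))" for d :: real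
  proof -
    have "(\<lambda>(s::real, t::real). (s, t + d * s)) = (\<lambda>(s, t). (t, s)) \<circ> ((\<lambda>(s, t). (s + d * t, t)) \<circ> (\<lambda>(s, t). (t, s)))"
      by auto
    moreover have "distr lborel borel ((\<lambda>(s::real, t::real). (t, s)) \<circ> ((\<lambda>(s, t). (s + d * t, t)) \<circ> (\<lambda>(s, t). (t, s)))) = lborel"
      by (intro lborel_distr_comp lborel_swap S1 sw continuous_on_compose[OF sw]) (auto intro: continuous_on_subset S1)
    ultimately show "distr lborel borel (\<lambda>(s, t). (s, t + d * s)) = (lborel :: (real \<times> real) measure)" by simp
    show "continuous_on UNIV (\<lambda>(s::real, t::real). (s, t + d * s))"
      using continuous_linear_pair[of 1 0 d 1] by (simp add: add.commute)
  qed
  have rot: "distr lborel borel (\<lambda>(s, t). (p * s - q * t, q * s + p * t)) = (lborel :: (real \<times> real) measure)"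
    if pq: "p\<^sup>2 + q\<^sup>2 = 1" and p: "p \<noteq> -1" for p q :: real
  proof -
    \<comment> \<open>For \<open>p = cos \<theta>\<close> and \<open>q = sin \<theta>\<close> this
      is minus the tangent of half the angle.\<close>
    define c where "c = - q / (1 + p)"
    have p1: "1 + p \<noteq> 0" using p by linarith
    have c1: "c * (1 + p) = - q" using p1 by (simp add: c_def)
    have "(1 + p) * (1 + c * q) = (1 + p) * p" using c1 pq by algebra
    then have cq: "1 + c * q = p" using p1 by simp
    have e: "(\<lambda>(s, t). (p * s - q * t, q * s + p * t)) =
      (\<lambda>(s, t). (s + c * t, t)) \<circ> ((\<lambda>(s, t). (s, t + q * s)) \<circ> (\<lambda>(s, t). (s + c * t, t)))"
    proof (rule ext, clarify)
      fix s t :: real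
      have "s + c * t + c * (t + q * (s + c * t)) = (1 + c * q) * s + c * (1 + (1 + c * q)) * t"
        by (simp add: algebra_simps)
      then have "p * s - q * t = s + c * t + c * (t + q * (s + c * t))" unfolding cq c1 by simp
      moreover have "q * s + p * t = t + q * (s + c * t)" unfolding cq[symmetric] by (simp add: algebra_simps)
      ultimately show "(p * s - q * t, q * s + p * t) = ((\<lambda>(s, t). (s + c * t, t)) \<circ> ((\<lambda>(s, t). (s, t + q * s)) \<circ> (\<lambda>(s, t). (s + c * t, t)))) (s, t)"
        by simp
    qed
    show ?thesis unfolding e
      by (intro lborel_distr_comp S1 S2 continuous_on_compose[OF S1(2)]) (auto intro: continuous_on_subset S2)
  qed
  show ?thesis
  proof (cases "p = -1")
    case True
    then have q: "q = 0" using pq by simp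
    \<comment> \<open>At the half turn the shear coefficient has a pole; the half turn is two
      quarter turns.\<close>
    have "distr lborel borel ((\<lambda>(s, t). (0 * s - 1 * t, 1 * s + 0 * t)) \<circ> (\<lambda>(s, t). (0 * s - 1 * t, 1 * s + 0 * t))) = (lborel :: (real \<times> real) measure)"
      using continuous_linear_pair[of 0 "-1" 1 0] by (intro lborel_distr_comp rot) auto
    moreover have "((\<lambda>(s::real, t::real). (0 * s - 1 * t, 1 * s + 0 * t)) \<circ> (\<lambda>(s, t). (0 * s - 1 * t, 1 * s + 0 * t)))
       = (\<lambda>(s, t). (p * s - q * t, q * s + p * t))" using True q by auto
    ultimately show ?thesis by simp
  qed (use rot[OF pq] in auto)
qed

section \<open>Spectral gap in dimension two\<close>

text \<open>An index type with two elements has no distinguished ones, so a chosen pair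
  \<open>a\<close>, \<open>b\<close> identifies the space with the product of two lines, where the
  rotation invariance is available.\<close>

definition plane :: "'n::finite \<Rightarrow> 'n \<Rightarrow> real \<times> real \<Rightarrow> real^'n" where
  "plane a b p = fst p *\<^sub>R axis a 1 + snd p *\<^sub>R axis b 1"

definition rot :: "'n::finite \<Rightarrow> 'n \<Rightarrow> real \<Rightarrow> real^'n \<Rightarrow> real^'n" where
  "rot a b \<theta> x = plane a b (cos \<theta> * x $ a - sin \<theta> * x $ b, sin \<theta> * x $ a + cos \<theta> * x $ b)"

text \<open>The derivative in the polar angle, the infinitesimal generator of \<open>rot\<close>;
  see \<open>rot_has_derivative\<close>.\<close>

definition ang :: "'n::finite \<Rightarrow> 'n \<Rightarrow> (real^'n \<Rightarrow> real) \<Rightarrow> real^'n \<Rightarrow> real" where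
  "ang a b f x = x $ a * pd b f x - x $ b * pd a f x"

locale two_coordinates =
  fixes a b :: "'n::finite"
  assumes ab: "a \<noteq> b" and UNIV_ab: "UNIV = {a, b}"
begin

lemma sum_ab: "(\<Sum>i\<in>UNIV. f i) = f a + (f b :: 'c::comm_monoid_add)"
  using ab by (subst UNIV_ab) simp

lemma plane_nth: "plane a b p $ a = fst p" "plane a b p $ b = snd p"
  using ab by (auto simp: plane_def axis_def)

lemma rot_nth: "rot a b \<theta> x $ a = cos \<theta> * x $ a - sin \<theta> * x $ b" "rot a b \<theta> x $ b = sin \<theta> * x $ a + cos \<theta> * x $ b"
  by (simp_all add: rot_def plane_nth)

lemma norm_ab: "(norm (x::real^'n))\<^sup>2 = x $ a * x $ a + x $ b * x $ b"
  unfolding norm_sum_squares[symmetric] sum_ab ..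

lemma norm_rot: "norm (rot a b \<theta> x) = norm x"
proof -
  have "(norm (rot a b \<theta> x))\<^sup>2 = ((cos \<theta>)\<^sup>2 + (sin \<theta>)\<^sup>2) * (norm x)\<^sup>2"
    unfolding norm_ab rot_nth by algebra
  then have "(norm (rot a b \<theta> x))\<^sup>2 = (norm x)\<^sup>2" by simp
  then show ?thesis by (simp add: power2_eq_iff_nonneg)
qed

lemma rot_periodic: "rot a b (\<theta> + 2 * pi) x = rot a b \<theta> x"
  by (simp add: rot_def)

lemma continuous_rot: "continuous_on S (\<lambda>z. rot a b (fst z) (snd z))"
  unfolding rot_def plane_def by (auto intro!: continuous_intros)

lemma continuous_rot_snd: "continuous_on S (rot a b \<theta>)"
  unfolding rot_def plane_def by (auto intro!: continuous_intros)

lemma continuous_plane: "continuous_on S (plane a b)"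
  unfolding plane_def by (auto intro!: continuous_intros)

lemma rot_has_derivative:
  fixes f :: "real^'n \<Rightarrow> real"
  assumes "\<And>y. f differentiable (at y)"
  shows "((\<lambda>\<theta>. f (rot a b \<theta> x)) has_real_derivative ang a b f (rot a b \<theta> x)) (at \<theta>)"
proof -
  let ?y = "rot a b \<theta> x"
  have "((\<lambda>\<theta>. rot a b \<theta> x) has_derivative (\<lambda>h. (h * (- (?y $ b))) *\<^sub>R axis a 1 + (h * ?y $ a) *\<^sub>R axis b 1)) (at \<theta>)"
    unfolding rot_nth unfolding rot_def plane_def
    by (auto intro!: derivative_eq_intros simp: algebra_simps)
  from has_derivative_compose[OF this has_derivative_pd[OF assms]]
  have "((\<lambda>\<theta>. f (rot a b \<theta> x)) has_derivative
    (\<lambda>h. \<Sum>i\<in>UNIV. ((h * (- (?y $ b))) *\<^sub>R axis a 1 + (h * ?y $ a) *\<^sub>R axis b 1) $ i * pd i f ?y)) (at \<theta>)" .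
  moreover have "(\<lambda>h. \<Sum>i\<in>UNIV. ((h * (- (?y $ b))) *\<^sub>R axis a 1 + (h * ?y $ a) *\<^sub>R axis b 1) $ i * pd i f ?y)
     = (*) (ang a b f ?y)"
    using ab unfolding sum_ab by (auto simp: ang_def axis_def algebra_simps)
  ultimately show ?thesis by (simp add: has_field_derivative_def)
qed

text \<open>Lebesgue measure is determined by its values on boxes, and the preimage of a box is a
  product of two intervals.\<close>

lemma lborel_plane: "distr lborel borel (plane a b) = (lborel :: (real^'n) measure)"
proof (rule lborel_eqI[symmetric])
  fix l u :: "real^'n" assume le: "\<And>c. c \<in> Basis \<Longrightarrow> l \<bullet> c \<le> u \<bullet> c"
  have T: "plane a b \<in> borel \<rightarrow>\<^sub>M borel" by (intro borel_measurable_continuous_onI continuous_plane)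
  have all: "(\<forall>i. P i) \<longleftrightarrow> P a \<and> P b" for P using UNIV_ab by (metis UNIV_I insertE singletonD)
  have lu: "l $ a \<le> u $ a" "l $ b \<le> u $ b" using le[of "axis a 1"] le[of "axis b 1"]
    by (auto simp: inner_axis axis_in_Basis_iff)
  have Basis: "(Basis :: (real^'n) set) = {axis a 1, axis b 1}"
    unfolding Basis_vec_def UNIV_ab by auto
  have ne: "axis a (1::real) \<noteq> axis b 1" using ab by (simp add: axis_eq_axis)
  have "plane a b -` box l u = box (l $ a) (u $ a) \<times> box (l $ b) (u $ b)"
    by (auto simp: mem_box_cart all plane_nth)
  then have "emeasure (distr lborel borel (plane a b)) (box l u)
     = emeasure (lborel \<Otimes>\<^sub>M lborel) (box (l $ a) (u $ a) \<times> box (l $ b) (u $ b))"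
    using T by (simp add: emeasure_distr lborel_prod)
  also have "\<dots> = emeasure lborel (box (l $ a) (u $ a)) * emeasure lborel (box (l $ b) (u $ b))"
    by (rule lborel.emeasure_pair_measure_Times) auto
  also have "\<dots> = ennreal ((u $ a - l $ a) * (u $ b - l $ b))"
    using lu by (simp add: ennreal_mult)
  finally show "emeasure (distr lborel borel (plane a b)) (box l u) = (\<Prod>c\<in>Basis. (u - l) \<bullet> c)"
    unfolding Basis using ne by (simp add: inner_axis)
qed simp

lemma lborel_rot: "distr lborel borel (rot a b \<theta>) = (lborel :: (real^'n) measure)"
proof -
  let ?R = "\<lambda>(s, t). (cos \<theta> * s - sin \<theta> * t, sin \<theta> * s + cos \<theta> * t)"
  have [measurable]: "plane a b \<in> borel \<rightarrow>\<^sub>M borel" "rot a b \<theta> \<in> borel \<rightarrow>\<^sub>M borel" "?R \<in> borel \<rightarrow>\<^sub>M borel"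
    using continuous_plane continuous_rot_snd continuous_linear_pair[of "cos \<theta>" "- sin \<theta>" "sin \<theta>" "cos \<theta>"]
    by (auto intro: borel_measurable_continuous_onI)
  have R: "distr lborel borel ?R = lborel" by (rule lborel_rotation) simp
  have c: "rot a b \<theta> \<circ> plane a b = plane a b \<circ> ?R"
    by (auto simp: rot_def plane_nth)
  have "distr lborel borel (rot a b \<theta>) = distr (distr lborel borel (plane a b)) borel (rot a b \<theta>)"
    by (simp add: lborel_plane)
  also have "\<dots> = distr lborel borel (plane a b \<circ> ?R)"
    unfolding c[symmetric] by (rule distr_distr) auto
  also have "\<dots> = distr (distr lborel borel ?R) borel (plane a b)"
    by (rule distr_distr[symmetric]) auto
  finally show ?thesis by (simp add: R lborel_plane)
qed

text \<open>This takes the place of polar coordinates: the order of integration is exchanged and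
  each rotation preserves the measure. As rotations preserve the norm, the integrand on the product
  is supported in a compact set.\<close>

lemma rotation_average:
  fixes p :: "real^'n \<Rightarrow> real"
  assumes p: "continuous_on UNIV p" and z: "\<And>x. norm x > 1 \<Longrightarrow> p x = 0"
  shows "integrable lborel (\<lambda>x. integral {0..2*pi} (\<lambda>\<theta>. p (rot a b \<theta> x)))"
    and "(\<integral>x. integral {0..2*pi} (\<lambda>\<theta>. p (rot a b \<theta> x)) \<partial>lborel) = 2 * pi * (\<integral>x. p x \<partial>lborel)"
proof -
  let ?f = "\<lambda>\<theta> x. indicator {0..2*pi} \<theta> *\<^sub>R p (rot a b \<theta> x)"
  let ?C = "{0..2*pi} \<times> cball (0::real^'n) 1"
  have "integrable lborel (\<lambda>z. indicator ?C z *\<^sub>R p (rot a b (fst z) (snd z)))"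
    by (intro borel_integrable_compact compact_Times continuous_on_compose2[OF p continuous_rot]) auto
  moreover have "(\<lambda>z. indicator ?C z *\<^sub>R p (rot a b (fst z) (snd z))) = case_prod ?f"
  proof (rule ext, clarify)
    fix \<theta> x
    show "indicator ?C (\<theta>, x) *\<^sub>R p (rot a b (fst (\<theta>, x)) (snd (\<theta>, x))) = ?f \<theta> x"
      using z[of "rot a b \<theta> x"] by (cases "norm x > 1") (auto simp: indicator_def norm_rot)
  qed
  ultimately have int: "integrable (lborel \<Otimes>\<^sub>M lborel) (case_prod ?f)" by (simp add: lborel_prod)
  have inner: "(\<integral>\<theta>. ?f \<theta> x \<partial>lborel) = integral {0..2*pi} (\<lambda>\<theta>. p (rot a b \<theta> x))" for x
  proof -
    have "continuous_on {0..2*pi} (\<lambda>\<theta>. p (rot a b \<theta> x))"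
      unfolding rot_def plane_def by (rule continuous_on_compose2[OF p]) (auto intro!: continuous_intros)
    then have "set_integrable lborel {0..2*pi} (\<lambda>\<theta>. p (rot a b \<theta> x))"
      unfolding set_integrable_def by (intro borel_integrable_compact) auto
    from set_borel_integral_eq_integral(2)[OF this] show ?thesis by (simp add: set_lebesgue_integral_def)
  qed
  show "integrable lborel (\<lambda>x. integral {0..2*pi} (\<lambda>\<theta>. p (rot a b \<theta> x)))"
    using lborel_pair.integrable_snd[OF int] unfolding inner .
  have "(\<integral>x. integral {0..2*pi} (\<lambda>\<theta>. p (rot a b \<theta> x)) \<partial>lborel) = (\<integral>x. (\<integral>\<theta>. ?f \<theta> x \<partial>lborel) \<partial>lborel)"
    unfolding inner ..
  also have "\<dots> = (\<integral>\<theta>. (\<integral>x. ?f \<theta> x \<partial>lborel) \<partial>lborel)" by (rule lborel_pair.Fubini_integral[OF int])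
  also have "\<dots> = (\<integral>\<theta>. indicator {0..2*pi} \<theta> *\<^sub>R (\<integral>x. p x \<partial>lborel) \<partial>(lborel :: real measure))"
  proof -
    have "(\<integral>x. p (rot a b \<theta> x) \<partial>lborel) = (\<integral>x. p x \<partial>lborel)" for \<theta>
    proof -
      have "(\<integral>x. p x \<partial>distr lborel borel (rot a b \<theta>)) = (\<integral>x. p (rot a b \<theta> x) \<partial>lborel)"
        using p continuous_rot_snd by (intro integral_distr) (auto intro: borel_measurable_continuous_onI)
      then show ?thesis by (simp add: lborel_rot)
    qed
    then show ?thesis by simp
  qed
  also have "\<dots> = 2 * pi * (\<integral>x. p x \<partial>lborel)" by simp
  finally show "(\<integral>x. integral {0..2*pi} (\<lambda>\<theta>. p (rot a b \<theta> x)) \<partial>lborel) = 2 * pi * (\<integral>x. p x \<partial>lborel)" .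
qed

end

context punctured_C2
begin

lemma C0c_continuous_UNIV:
  assumes "C0c f" shows "continuous_on UNIV f"
proof -
  have op: "open (- K)" using compact_K by (simp add: compact_imp_closed open_Compl)
  have un: "pball \<union> - K = UNIV" using K_sub by auto
  have "continuous_on (- K) f"
    using C0c_zero[OF assms] by (subst continuous_on_cong[of _ _ _ "\<lambda>_. 0"]) auto
  moreover have "continuous_on pball f" using assms by (simp add: C0c_def)
  ultimately show ?thesis using continuous_on_open_Un[OF open_pball op] un by metis
qed

text \<open>In the plane the tangential gradient is the rotated position vector times
  \<open>v / r\<^sup>2\<close>, where \<open>v\<close> is the angular derivative of
  \<open>u\<close>, and its divergence is \<open>v' / r\<^sup>2\<close>. On each circle the claim is
  the Wirtinger inequality for \<open>v\<close>.\<close>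

lemma spectral_gap_2:
  assumes n: "CARD('n) = 2"
  shows "(real CARD('n) - 1) * (\<integral>x. W CARD('n) (norm x) * kap (norm x) ^ 4 * w_sq x / (norm x)\<^sup>2 \<partial>lborel)
     \<le> (\<integral>x. W CARD('n) (norm x) * kap (norm x) ^ 4 * (dw x)\<^sup>2 \<partial>lborel)"
proof -
  obtain a b :: 'n where ab: "a \<noteq> b" "UNIV = {a, b}"
    using n card_2_iff[of "UNIV :: 'n set"] by auto
  interpret two_coordinates a b by standard (fact ab)+
  define v where "v = ang a b u"
  have C1v: "C1c v"
    unfolding v_def ang_def[abs_def] by (intro C1c_diff C1c_mult C1_on_coord C1pdu)
  define v' where "v' = ang a b v"
  have C0v': "C0c v'"
    unfolding v'_def ang_def[abs_def] by (intro C0c_diff C0c_mult C1c_pd C1v norm_coord_continuous)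
  let ?h = "\<lambda>r::real. 1 / r * (1 / r)"
  obtain h' where h: "radial_C1 ?h h'" using radial_C1_mult[OF radial_C1_inverse radial_C1_inverse] by blast
  have wab: "w a x = ?h (norm x) * (- 1 * x $ b * v x)" "w b x = ?h (norm x) * (x $ a * v x)" if x: "x \<in> pball" for x
  proof -
    define r where "r = norm x"
    have r: "r > 0" using x by (simp add: r_def)
    have rr: "r * r = x $ a * x $ a + x $ b * x $ b" using norm_ab[of x] by (simp add: r_def power2_eq_square)
    have zz: "ur x = (x $ a * pd a u x + x $ b * pd b u x) / r" unfolding ur_def d_r_eq sum_ab r_def ..
    have "w a x * (r * r) = pd a u x * (r * r) - x $ a * (x $ a * pd a u x + x $ b * pd b u x)"
      using r by (simp add: w_def zz r_def[symmetric] field_simps)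
    also have "\<dots> = - 1 * x $ b * v x" unfolding rr v_def ang_def by (simp add: algebra_simps)
    finally show "w a x = ?h (norm x) * (- 1 * x $ b * v x)" using r unfolding r_def[symmetric] by (simp add: field_simps)
    have "w b x * (r * r) = pd b u x * (r * r) - x $ b * (x $ a * pd a u x + x $ b * pd b u x)"
      using r by (simp add: w_def zz r_def[symmetric] field_simps)
    also have "\<dots> = x $ a * v x" unfolding rr v_def ang_def by (simp add: algebra_simps)
    finally show "w b x = ?h (norm x) * (x $ a * v x)" using r unfolding r_def[symmetric] by (simp add: field_simps)
  qed
  have Cv: "w_sq x = (v x)\<^sup>2 * ?h (norm x)" if x: "x \<in> pball" for x
  proof -
    have r: "norm x > 0" using x by simp
    have "w_sq x = (?h (norm x))\<^sup>2 * (v x)\<^sup>2 * (norm x)\<^sup>2"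
      unfolding w_sq_def sum_ab wab[OF x] norm_ab power_mult_distrib power2_eq_square[of "x $ a"] power2_eq_square[of "x $ b"]
      by (simp add: power_mult_distrib distrib_left mult_ac)
    then show ?thesis using r by (simp add: power2_eq_square)
  qed
  have dwv: "dw x = ?h (norm x) * v' x" if x: "x \<in> pball" for x
  proof -
    have hd: "(\<lambda>x. ?h (norm x)) differentiable (at x)" using C1_on_D(1)[OF radial_C1_on[OF h] x] .
    have vd: "v differentiable (at x)" using C1c_diff_at[OF C1v x] .
    have "pd a (w a) x = pd a (\<lambda>x. ?h (norm x) * (- 1 * x $ b * v x)) x"
      by (rule pd_cong_open[OF open_pball x wab(1)])
    also have "\<dots> = ?h (norm x) * (- 1 * x $ b * pd a v x) + h' (norm x) * (x $ a / norm x) * (- 1 * x $ b * v x)"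
      by (subst pd_mult[OF hd], intro differentiable_mult differentiable_const differentiable_coord vd,
          subst radial_pd[OF h x], subst pd_mult[OF _ vd], intro differentiable_mult differentiable_const differentiable_coord,
          subst pd_mult[OF differentiable_const differentiable_coord]) (use ab in \<open>simp add: pd_coord\<close>)
    finally have 1: "pd a (w a) x = ?h (norm x) * (- 1 * x $ b * pd a v x) + h' (norm x) * (x $ a / norm x) * (- 1 * x $ b * v x)" .
    have "pd b (w b) x = pd b (\<lambda>x. ?h (norm x) * (x $ a * v x)) x"
      by (rule pd_cong_open[OF open_pball x wab(2)])
    also have "\<dots> = ?h (norm x) * (x $ a * pd b v x) + h' (norm x) * (x $ b / norm x) * (x $ a * v x)"
      by (subst pd_mult[OF hd differentiable_mult[OF differentiable_coord vd]],
          subst radial_pd[OF h x], subst pd_mult[OF differentiable_coord vd]) (use ab in \<open>simp add: pd_coord\<close>)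
    finally have 2: "pd b (w b) x = ?h (norm x) * (x $ a * pd b v x) + h' (norm x) * (x $ b / norm x) * (x $ a * v x)" .
    show ?thesis unfolding dw_def sum_ab 1 2 v'_def ang_def by (simp add: algebra_simps)
  qed
  \<comment> \<open>The weight \<open>W * kap ^ 4\<close> divided by the fourth power of
    \<open>r\<close>. It is constant on circles, so it can be taken out of the integral over the
    angle.\<close>
  define g where "g r = W CARD('n) r * kap r ^ 4 * (?h r * ?h r)" for r
  have gc: "continuous_on pball (\<lambda>x::real^'n. g (norm x))"
    unfolding g_def by (intro continuous_on_mult radial_C1_continuous[OF radial_C1_Wkap] radial_C1_continuous[OF h])
  define p where "p x = g (norm x) * (v x)\<^sup>2" for x
  define q where "q x = g (norm x) * (v' x)\<^sup>2" for x
  have cp: "C0c p" unfolding p_def[abs_def] by (intro C0c_mult gc C0c_power2 C1c_C0c C1v)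
  have cq: "C0c q" unfolding q_def[abs_def] by (intro C0c_mult gc C0c_power2 C0v')
  have z1: "f x = 0" if "C0c f" "norm x > 1" for f x using that K_sub C0c_zero[OF that(1), of x] by force
  have vdiff: "u differentiable (at y)" "v differentiable (at y)" for y
    using C1c_global[OF C1u] C1c_global[OF C1v] by (auto simp: C1_on_def)
  have pw: "integral {0..2*pi} (\<lambda>\<theta>. p (rot a b \<theta> x)) \<le> integral {0..2*pi} (\<lambda>\<theta>. q (rot a b \<theta> x))" for x
  proof (cases "x \<in> pball")
    case True
    have g0: "g (norm x) \<ge> 0"
      using W_pos[of "norm x" "CARD('n)"] kap_norm_pos[OF True] norm_pball[OF True] by (simp add: g_def)
    \<comment> \<open>The periodic primitive demanded by \<open>wirtinger\<close> is
      \<open>u\<close> itself along the circle.\<close>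
    have "integral {0..2*pi} (\<lambda>\<theta>. (v (rot a b \<theta> x))\<^sup>2) \<le> integral {0..2*pi} (\<lambda>\<theta>. (v' (rot a b \<theta> x))\<^sup>2)"
    proof (rule wirtinger)
      show "((\<lambda>\<theta>. u (rot a b \<theta> x)) has_real_derivative v (rot a b \<theta> x)) (at \<theta>)" for \<theta>
        unfolding v_def by (rule rot_has_derivative[OF vdiff(1)])
      show "((\<lambda>\<theta>. v (rot a b \<theta> x)) has_real_derivative v' (rot a b \<theta> x)) (at \<theta>)" for \<theta>
        unfolding v'_def by (rule rot_has_derivative[OF vdiff(2)])
      show "continuous_on UNIV (\<lambda>\<theta>. v' (rot a b \<theta> x))"
        unfolding rot_def plane_def
        by (rule continuous_on_compose2[OF C0c_continuous_UNIV[OF C0v']]) (auto intro!: continuous_intros)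
    qed (simp_all add: rot_periodic)
    then have "g (norm x) * integral {0..2*pi} (\<lambda>\<theta>. (v (rot a b \<theta> x))\<^sup>2) \<le> g (norm x) * integral {0..2*pi} (\<lambda>\<theta>. (v' (rot a b \<theta> x))\<^sup>2)"
      using g0 by (rule mult_left_mono)
    then show ?thesis by (simp add: p_def q_def norm_rot)
  next
    \<comment> \<open>The whole orbit of such a point lies at the origin or outside the ball, hence
      off \<open>K\<close>, and both integrals are 0.\<close>
    case False
    then have "rot a b \<theta> x \<notin> K" for \<theta> using norm_rot[of \<theta> x] K_sub by (auto simp: subset_iff)
    then show ?thesis using C0c_zero[OF cp] C0c_zero[OF cq] by simp
  qed
  have "2 * pi * (\<integral>x. p x \<partial>lborel) \<le> 2 * pi * (\<integral>x. q x \<partial>lborel)"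
  proof -
    have av: "integrable lborel (\<lambda>x. integral {0..2*pi} (\<lambda>\<theta>. f (rot a b \<theta> x)))"
      "2 * pi * (\<integral>x. f x \<partial>lborel) = (\<integral>x. integral {0..2*pi} (\<lambda>\<theta>. f (rot a b \<theta> x)) \<partial>lborel)"
      if "C0c f" for f
      using rotation_average[OF C0c_continuous_UNIV[OF that]] z1[OF that] by auto
    show ?thesis unfolding av(2)[OF cp] av(2)[OF cq] by (rule integral_mono[OF av(1)[OF cp] av(1)[OF cq] pw])
  qed
  then have "(\<integral>x. p x \<partial>lborel) \<le> (\<integral>x. q x \<partial>lborel)" by simp
  also have "(\<integral>x. p x \<partial>lborel) = (\<integral>x. W CARD('n) (norm x) * kap (norm x) ^ 4 * w_sq x / (norm x)\<^sup>2 \<partial>lborel)"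
  proof (rule integral_cong_K)
    fix x assume "x \<in> K"
    then have "x \<in> pball" using K_sub by blast
    from Cv[OF this] show "p x = W CARD('n) (norm x) * kap (norm x) ^ 4 * w_sq x / (norm x)\<^sup>2"
      by (simp add: p_def g_def power2_eq_square)
  qed (simp_all add: w_sums_zero C0c_zero[OF cp])
  also have "(\<integral>x. q x \<partial>lborel) = (\<integral>x. W CARD('n) (norm x) * kap (norm x) ^ 4 * (dw x)\<^sup>2 \<partial>lborel)"
  proof (rule integral_cong_K)
    fix x assume "x \<in> K"
    then have "x \<in> pball" using K_sub by blast
    from dwv[OF this] show "q x = W CARD('n) (norm x) * kap (norm x) ^ 4 * (dw x)\<^sup>2"
      by (simp add: q_def g_def power2_eq_square)
  qed (simp_all add: dw_zero C0c_zero[OF cq])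
  finally show ?thesis by (simp add: n)
qed

end

text \<open>\<open>C2_on\<close> speaks of the punctured ball only. On the open complement of the
  support \<open>u\<close> is zero, which gives the vanishing of its derivatives there that
  \<open>C1c\<close> asks for.\<close>

lemma Cc2_punct_punctured_C2:
  assumes "Cc2_punct u"
  shows "punctured_C2 (closure {x. u x \<noteq> 0}) u"
proof -
  let ?K = "closure {x. u x \<noteq> 0}"
  interpret punctured_support ?K
    using assms by unfold_locales (auto simp: Cc2_punct_def)
  have C2: "C2_on pball u" using assms by (simp add: Cc2_punct_def)
  have u0: "u x = 0" if "x \<notin> ?K" for x using that closure_subset[of "{x. u x \<noteq> 0}"] by auto
  show ?thesis
  proof
    have "pd i u x = 0" if "x \<notin> ?K" for i x by (rule pd_zero_K[OF _ that]) (rule u0)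
    then show pd: "C1c (pd i u)" for i
      using C2 unfolding C1c_def C1_on_def C2_on_def by blast
    have "continuous_on pball (pd i u)" for i using C1_on_continuous[OF C1c_C1[OF pd]] .
    then show "C1c u" using C2 u0 unfolding C1c_def C1_on_def C2_on_def by blast
  qed
qed

theorem theorem1p6:
  fixes u :: "real^'n \<Rightarrow> real"
  assumes "CARD('n) \<ge> 2" and "Cc2_punct u"
  shows "((hnorm (lap_H u))\<^sup>2 =
           (hnorm (lap_rho u))\<^sup>2 + (hnorm (\<lambda>x. lap_H u x - lap_rho u x))\<^sup>2
           + 2 * (\<Sum>j\<in>UNIV. (hnorm (d_rho (Lj j u)))\<^sup>2)
           - 2 * (\<Sum>j\<in>UNIV. (hnorm (Lj j u))\<^sup>2)
           - 2 * (\<Sum>j\<in>UNIV. (hnorm (\<lambda>x. Lj j u x / sinh (hrho x)))\<^sup>2)) \<and>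
       ((hnorm (lap_H u))\<^sup>2 \<ge>
           (hnorm (lap_rho u))\<^sup>2
           + 1/2 * (\<Sum>j\<in>UNIV. (hnorm (\<lambda>x. Lj j u x / hrho x))\<^sup>2)
           + (real CARD('n) + 1) * (real CARD('n) - 3) / 2 *
               (\<Sum>j\<in>UNIV. (hnorm (\<lambda>x. cosh (hrho x) / sinh (hrho x) * Lj j u x))\<^sup>2)) \<and>
       (CARD('n) \<ge> 3 \<longrightarrow> hnorm (lap_H u) \<ge> hnorm (lap_rho u))"
proof -
  interpret punctured_C2 "closure {x. u x \<noteq> 0}" u by (rule Cc2_punct_punctured_C2[OF assms(2)])
  have gap: "(real CARD('n) - 1) * (\<integral>x. W CARD('n) (norm x) * kap (norm x) ^ 4 * w_sq x / (norm x)\<^sup>2 \<partial>lborel)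
     \<le> (\<integral>x. W CARD('n) (norm x) * kap (norm x) ^ 4 * (dw x)\<^sup>2 \<partial>lborel)"
    using spectral_gap_2 spectral_gap_ge3 assms(1) by (cases "CARD('n) = 2") auto
  note bound = lap_norm_lower_bound[OF gap]
  have "hnorm (lap_H u) \<ge> hnorm (lap_rho u)" if n: "CARD('n) \<ge> 3"
  proof (rule power2_le_imp_le)
    have "0 \<le> 1/2 * (\<Sum>j\<in>UNIV. (hnorm (\<lambda>x. Lj j u x / hrho x))\<^sup>2)"
      by (intro mult_nonneg_nonneg sum_nonneg) auto
    moreover have "0 \<le> (real CARD('n) + 1) * (real CARD('n) - 3) / 2 *
               (\<Sum>j\<in>UNIV. (hnorm (\<lambda>x. cosh (hrho x) / sinh (hrho x) * Lj j u x))\<^sup>2)"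
      using n by (intro mult_nonneg_nonneg divide_nonneg_nonneg sum_nonneg) auto
    ultimately show "(hnorm (lap_rho u))\<^sup>2 \<le> (hnorm (lap_H u))\<^sup>2" using bound by linarith
    show "0 \<le> hnorm (lap_H u)" unfolding hnorm_def set_lebesgue_integral_def
      by (intro real_sqrt_ge_zero Bochner_Integration.integral_nonneg)
         (auto simp: indicator_def abs_square_le_1 intro!: mult_nonneg_nonneg zero_le_power)
  qed
  with lap_norm_identity bound show ?thesis by blast
qed

end
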